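(* Let $m\ge1$. Consider gluon and graviton momentum eigenstates on flat $\mathbb C^{4m}$, $$a^{\mathsf a}_{\alpha\dot\alpha}=\mathsf T^{\mathsf a}\,\epsilon_{\alpha\dot\alpha}\,e^{ik\cdot x},\qquad h_{\alpha\dot\alpha\beta\dot\beta}=\epsilon_{\alpha\dot\alpha}\,\epsilon_{\beta\dot\beta}\,e^{ik\cdot x},\qquad k^2=k\cdot\epsilon=\epsilon\cdot\epsilon=0,$$ with complex momenta. Parametrize a general null momentum as $k^{\alpha\dot\alpha}=\kappa^{\alpha\,a}\,\tilde\kappa^{\dot\alpha}_a$ ($a=1,2$) with $[\tilde\kappa_1\,\tilde\kappa_2]=0$, and take the polarization of a hyperholomorphic gluon to be of the form $\epsilon^{\rm HH}_{\alpha\dot\alpha}=\epsilon^a_\alpha\,\tilde\kappa_{\dot\alpha\,a}$ for some $\epsilon^a_\alpha$. Then the hyperholomorphic conditions on the linearised field strength become $$\kappa^a_{(\alpha}\epsilon^b_{\beta)}\,[\tilde\kappa_a\,\tilde\kappa_b]=0,\qquad \kappa^a_{(\alpha}\epsilon^b_{\beta)}\,\tilde\kappa_{[\dot\alpha\,|a|}\,\tilde\kappa_{\dot\beta]\,b}=0 .$$ The first is satisfied identically because $[\tilde\kappa_1\,\tilde\kappa_2]=0$; the second requires $\tilde\kappa_{[\dot\alpha\,|a|}\tilde\kappa_{\dot\beta]\,b}=0$, so that $\tilde\kappa_1^{\dot\alpha}\propto\tilde\kappa_2^{\dot\alpha}$. Hence the hyperholomorphic condition forces the gluon momentum to be simple,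 and the same happens for hyperkähler gravitons. That is, all hyperkähler gravitons and hyperholomorphic gluons on $\mathbb C^{4m}$ have momentum of the form $$k^{\alpha\dot\alpha}=\kappa^\alpha\,\tilde\kappa^{\dot\alpha},$$ with underlying polarization vector of the form $$\epsilon_{\alpha\dot\alpha}=\frac{\iota_\alpha\,\tilde\kappa_{\dot\alpha}}{\langle\kappa\,\iota\rangle},$$ where the choice of the constant spinor $\iota_\alpha$ corresponds to fixing the residual gauge freedom. In particular, for $m>1$ these conditions do more than select one of the $4m-2$ on-shell polarizations: they also constrain the momentum to a subvariety of codimension $2m-2$ of the null cone.
   Context: The index $\alpha\in\{0,1\}$ is an $SL(2,\mathbb C)$ index and $\dot\alpha\in\{1,\dots,2m\}$ an $Sp(m,\mathbb C)$ index. $\varepsilon_{\alpha\beta}$ and $\varepsilon_{\dot\alpha\dot\beta}$ are the standard symplectic forms on $\mathbb C^2$ and $\mathbb C^{2m}$, used to raise and lower indices; $\langle a\,b\rangle=a^\alpha b_\alpha$ and $[\tilde a\,\tilde b]=\tilde a^{\dot\alpha}\tilde b_{\dot\alpha}$. The metric on $\mathbb C^{4m}$ is $ds^2=\varepsilon_{\alpha\beta}\varepsilon_{\dot\alpha\dot\beta}dx^{\alpha\dot\alpha}dx^{\beta\dot\beta}$. $\mathsf T^{\mathsf a}$ is a generator of the Lie algebra of the gauge group. Round and square brackets on indices denote symmetrization and antisymmetrization; in the latter, bars exclude the label $a$. A field strength decomposes as $$F_{\alpha\dot\alpha\beta\dot\beta}=\varepsilon_{\alpha\beta}\tilde F_{\dot\alpha\dot\beta}+\varepsilon_{\dot\alpha\dot\beta}\hat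 F_{\alpha\beta}+\breve F_{\alpha\beta\,\dot\alpha\dot\beta},$$ with $\tilde F$ and $\hat F$ symmetric, $\breve F$ symmetric in $\alpha\beta$, antisymmetric in $\dot\alpha\dot\beta$ and with $\varepsilon^{\dot\alpha\dot\beta}\breve F_{\alpha\beta\,\dot\alpha\dot\beta}=0$. A gluon is hyperholomorphic if its linearised field strength has $\hat F_{\alpha\beta}=0=\breve F_{\alpha\beta\,\dot\alpha\dot\beta}$. A graviton is hyperkähler if its linearised curvature tensor is contained in the totally symmetric representation $\tilde\psi_{\dot\alpha\dot\beta\dot\gamma\dot\delta}$ of $\mathfrak{sp}(m,\mathbb C)$. The form $\epsilon^a_\alpha\tilde\kappa_{\dot\alpha a}$ of the polarization is imposed by demanding consistency with the case of simple momentum $k^{\alpha\dot\alpha}=\kappa^\alpha\tilde\kappa^{\dot\alpha}$, where the polarization is taken to be $\iota_\alpha\tilde\kappa_{\dot\alpha}/\langle\kappa\,\iota\rangle$, inherited from that of a positive helicity gluon in four dimensions.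
   Formalization: Gluons and gravitons are assumed to have nonzero linearised field strength or curvature (pure gauge ε=k is a counterexample for non-simple k), and the step to κ̃₁∝κ̃₂ assumes κ¹, κ² linearly independent (it fails for κ¹=κ²). *)

theory Defs
  imports "HOL-Analysis.Analysis"
begin

section \<open>Indices, symplectic forms and the flat metric on \<open>\<complex>\<^sup>4\<^sup>m\<close>\<close>

text \<open>
  The undotted index runs over the two-element type \<open>2\<close> (elements \<open>0\<close> and \<open>1\<close>), the dotted index
  over \<open>'m + 'm\<close>, so that \<open>m = CARD('m)\<close> is an arbitrary positive integer. A pair of indices
  \<open>(\<alpha>, \<alpha>')\<close> labels a coordinate of \<open>\<complex>\<^sup>4\<^sup>m\<close>.
\<close>

type_synonym 'm dotted = "'m + 'm"
type_synonym 'm index = "2 \<times> ('m + 'm)"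
type_synonym 'm vec4m = "complex ^ (2 \<times> ('m + 'm))"

definition eps_undotted :: "2 \<Rightarrow> 2 \<Rightarrow> complex" where
  "eps_undotted \<alpha> \<beta> = (if \<alpha> = 0 \<and> \<beta> = 1 then 1 else if \<alpha> = 1 \<and> \<beta> = 0 then - 1 else 0)"

fun eps_dotted :: "'m + 'm \<Rightarrow> 'm + 'm \<Rightarrow> complex" where
  "eps_dotted (Inl i) (Inr j) = (if i = j then 1 else 0)"
| "eps_dotted (Inr i) (Inl j) = (if i = j then - 1 else 0)"
| "eps_dotted (Inl i) (Inl j) = 0"
| "eps_dotted (Inr i) (Inr j) = 0"

text \<open>
  Convention: \<open>v\<^sub>\<alpha> = v\<^sup>\<beta> \<epsilon>\<^sub>\<beta>\<^sub>\<alpha>\<close> and \<open>v\<^sup>\<alpha> = \<epsilon>\<^sup>\<alpha>\<^sup>\<beta> v\<^sub>\<beta>\<close>, where \<open>\<epsilon>\<^sup>\<alpha>\<^sup>\<beta>\<close> and \<open>\<epsilon>\<^sub>\<alpha>\<^sub>\<beta>\<close> are the same array of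
  numbers (then raising inverts lowering); likewise for dotted indices. Momenta, positions and
  spinors are stored with upper indices, polarizations with lower indices.
\<close>

definition lower_undotted :: "complex ^ 2 \<Rightarrow> complex ^ 2" where
  "lower_undotted v = (\<chi> \<alpha>. \<Sum>\<beta>\<in>UNIV. v $ \<beta> * eps_undotted \<beta> \<alpha>)"

definition lower_dotted :: "complex ^ ('m + 'm) \<Rightarrow> complex ^ ('m::finite + 'm)" where
  "lower_dotted v = (\<chi> \<alpha>. \<Sum>\<beta>\<in>UNIV. v $ \<beta> * eps_dotted \<beta> \<alpha>)"

definition angle_bracket :: "complex ^ 2 \<Rightarrow> complex ^ 2 \<Rightarrow> complex" where
  "angle_bracket a b = (\<Sum>\<alpha>\<in>UNIV. a $ \<alpha> * lower_undotted b $ \<alpha>)"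

definition square_bracket :: "complex ^ ('m::finite + 'm) \<Rightarrow> complex ^ ('m + 'm) \<Rightarrow> complex" where
  "square_bracket a b = (\<Sum>\<alpha>\<in>UNIV. a $ \<alpha> * lower_dotted b $ \<alpha>)"

definition lower_vec :: "'m::finite vec4m \<Rightarrow> 'm vec4m" where
  "lower_vec v = (\<chi> A. \<Sum>\<beta>\<in>UNIV. \<Sum>\<beta>'\<in>UNIV.
      v $ (\<beta>, \<beta>') * eps_undotted \<beta> (fst A) * eps_dotted \<beta>' (snd A))"

definition raise_vec :: "'m::finite vec4m \<Rightarrow> 'm vec4m" where
  "raise_vec w = (\<chi> A. \<Sum>\<beta>\<in>UNIV. \<Sum>\<beta>'\<in>UNIV.
      eps_undotted (fst A) \<beta> * eps_dotted (snd A) \<beta>' * w $ (\<beta>, \<beta>'))"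

text \<open>Complex-bilinear pairing of an upper-index with a lower-index vector.\<close>

definition pairing :: "'m::finite vec4m \<Rightarrow> 'm vec4m \<Rightarrow> complex" where
  "pairing v w = (\<Sum>A\<in>UNIV. v $ A * w $ A)"

definition null_momentum :: "'m::finite vec4m \<Rightarrow> bool" where
  "null_momentum k \<longleftrightarrow> pairing k (lower_vec k) = 0"

definition on_shell :: "'m::finite vec4m \<Rightarrow> 'm vec4m \<Rightarrow> bool" where
  "on_shell k \<epsilon> \<longleftrightarrow> null_momentum k \<and> pairing k \<epsilon> = 0 \<and> pairing (raise_vec \<epsilon>) \<epsilon> = 0"


section \<open>Momentum eigenstates\<close>

definition plane_wave :: "'m::finite vec4m \<Rightarrow> 'm vec4m \<Rightarrow> complex" where
  "plane_wave k x = exp (\<i> * pairing x (lower_vec k))"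

text \<open>
  The gauge algebra is represented by coordinates \<open>complex ^ 'g\<close> in some basis. Its bracket does
  not enter the linearised theory about the flat connection.
\<close>

type_synonym ('m, 'g) gauge_field = "'m vec4m \<Rightarrow> 'm index \<Rightarrow> complex ^ 'g"
type_synonym 'm metric_field = "'m vec4m \<Rightarrow> 'm index \<Rightarrow> 'm index \<Rightarrow> complex"

definition gluon :: "complex ^ 'g \<Rightarrow> 'm vec4m \<Rightarrow> 'm vec4m \<Rightarrow> ('m::finite, 'g::finite) gauge_field" where
  "gluon T \<epsilon> k = (\<lambda>x A. (\<epsilon> $ A * plane_wave k x) *s T)"

definition graviton :: "'m vec4m \<Rightarrow> 'm vec4m \<Rightarrow> 'm::finite metric_field" where
  "graviton \<epsilon> k = (\<lambda>x A B. \<epsilon> $ A * \<epsilon> $ B * plane_wave k x)"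

text \<open>The holomorphic partial derivative \<open>\<partial>\<^sub>A = \<partial>/\<partial>x\<^sup>A\<close>.\<close>

definition partial :: "'m::finite index \<Rightarrow> ('m vec4m \<Rightarrow> complex) \<Rightarrow> 'm vec4m \<Rightarrow> complex" where
  "partial A f x = deriv (\<lambda>t. f (x + t *s axis A 1)) 0"

definition linearised_field_strength ::
  "('m::finite, 'g::finite) gauge_field \<Rightarrow> 'm vec4m \<Rightarrow> 'm index \<Rightarrow> 'm index \<Rightarrow> complex ^ 'g" where
  "linearised_field_strength a x A B =
     (\<chi> c. partial A (\<lambda>y. a y B $ c) x - partial B (\<lambda>y. a y A $ c) x)"

definition linearised_riemann ::
  "'m::finite metric_field \<Rightarrow> 'm vec4m \<Rightarrow> 'm index \<Rightarrow> 'm index \<Rightarrow> 'm index \<Rightarrow> 'm index \<Rightarrow> complex" where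
  "linearised_riemann h x A B C D =
     (partial B (partial C (\<lambda>y. h y A D)) x + partial A (partial D (\<lambda>y. h y B C)) x
      - partial A (partial C (\<lambda>y. h y B D)) x - partial B (partial D (\<lambda>y. h y A C)) x) / 2"

text \<open>A state is nontrivial if it has nonvanishing curvature, i.e. if it is not pure gauge.\<close>

definition nontrivial_gluon :: "('m::finite, 'g::finite) gauge_field \<Rightarrow> bool" where
  "nontrivial_gluon a \<longleftrightarrow> (\<exists>x A B. linearised_field_strength a x A B \<noteq> 0)"

definition nontrivial_graviton :: "'m::finite metric_field \<Rightarrow> bool" where
  "nontrivial_graviton h \<longleftrightarrow> (\<exists>x A B C D. linearised_riemann h x A B C D \<noteq> 0)"

definition gauge_transform ::
  "('m vec4m \<Rightarrow> complex ^ 'g) \<Rightarrow> ('m, 'g) gauge_field \<Rightarrow> ('m::finite, 'g::finite) gauge_field" where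
  "gauge_transform lam a = (\<lambda>x A. a x A + (\<chi> c. partial A (\<lambda>y. lam y $ c) x))"

definition diffeo_transform ::
  "('m vec4m \<Rightarrow> 'm index \<Rightarrow> complex) \<Rightarrow> 'm metric_field \<Rightarrow> 'm::finite metric_field" where
  "diffeo_transform \<xi> h =
     (\<lambda>x A B. h x A B + partial A (\<lambda>y. \<xi> y B) x + partial B (\<lambda>y. \<xi> y A) x)"


section \<open>Hyperholomorphic gluons and hyperkaehler gravitons\<close>

definition field_strength_decomposition ::
  "('m index \<Rightarrow> 'm index \<Rightarrow> complex ^ 'g) \<Rightarrow> ('m dotted \<Rightarrow> 'm dotted \<Rightarrow> complex ^ 'g)
    \<Rightarrow> (2 \<Rightarrow> 2 \<Rightarrow> complex ^ 'g) \<Rightarrow> (2 \<Rightarrow> 2 \<Rightarrow> 'm::finite dotted \<Rightarrow> 'm dotted \<Rightarrow> complex ^ 'g::finite)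
    \<Rightarrow> bool" where
  "field_strength_decomposition F F_tilde F_hat F_breve \<longleftrightarrow>
     (\<forall>\<alpha> \<alpha>' \<beta> \<beta>'. F (\<alpha>, \<alpha>') (\<beta>, \<beta>') =
        eps_undotted \<alpha> \<beta> *s F_tilde \<alpha>' \<beta>' + eps_dotted \<alpha>' \<beta>' *s F_hat \<alpha> \<beta> + F_breve \<alpha> \<beta> \<alpha>' \<beta>') \<and>
     (\<forall>\<alpha>' \<beta>'. F_tilde \<alpha>' \<beta>' = F_tilde \<beta>' \<alpha>') \<and>
     (\<forall>\<alpha> \<beta>. F_hat \<alpha> \<beta> = F_hat \<beta> \<alpha>) \<and>
     (\<forall>\<alpha> \<beta> \<alpha>' \<beta>'. F_breve \<alpha> \<beta> \<alpha>' \<beta>' = F_breve \<beta> \<alpha> \<alpha>' \<beta>') \<and>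
     (\<forall>\<alpha> \<beta> \<alpha>' \<beta>'. F_breve \<alpha> \<beta> \<alpha>' \<beta>' = - F_breve \<alpha> \<beta> \<beta>' \<alpha>') \<and>
     (\<forall>\<alpha> \<beta>. (\<Sum>\<alpha>'\<in>UNIV. \<Sum>\<beta>'\<in>UNIV. eps_dotted \<alpha>' \<beta>' *s F_breve \<alpha> \<beta> \<alpha>' \<beta>') = 0)"

lemma exhaust_undotted: "\<alpha> = 0 \<or> \<alpha> = (1 :: 2)"
  using exhaust_2[of \<alpha>] by auto

lemma eps_dotted_antisym: "eps_dotted \<beta> \<alpha> = - eps_dotted \<alpha> \<beta>"
  by (cases \<alpha>; cases \<beta>) auto

lemma sum_eps_dotted_squared:
  "(\<Sum>\<alpha>\<in>UNIV. \<Sum>\<beta>\<in>UNIV. eps_dotted \<alpha> \<beta> * eps_dotted \<alpha> (\<beta> :: 'm::finite + 'm)) = 2 * of_nat CARD('m)"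
proof -
  have split: "sum f UNIV = (\<Sum>i\<in>UNIV. f (Inl i)) + (\<Sum>i\<in>UNIV. f (Inr i))"
    for f :: "'m + 'm \<Rightarrow> complex"
    by (simp add: UNIV_Plus_UNIV[symmetric] sum.Plus del: UNIV_Plus_UNIV)
  have delta: "(\<Sum>j\<in>UNIV. (if i = j then c else 0) * (if i = j then c else 0)) = c * c"
    for i :: 'm and c :: complex
  proof -
    have "(\<Sum>j\<in>UNIV. (if i = j then c else 0) * (if i = j then c else 0)) =
          (\<Sum>j\<in>UNIV. if i = j then c * c else 0)" by (intro sum.cong) auto
    then show ?thesis by simp
  qed
  show ?thesis by (simp add: split delta)
qed

lemma field_strength_decomposition_exists:
  fixes F :: "'m::finite index \<Rightarrow> 'm index \<Rightarrow> complex ^ 'g::finite"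
  assumes anti: "\<And>A B. F A B = - F B A"
  shows "\<exists>F_tilde F_hat F_breve. field_strength_decomposition F F_tilde F_hat F_breve"
proof -
  define S where "S \<alpha> \<beta> \<alpha>' \<beta>' = (1/2) *s (F (\<alpha>, \<alpha>') (\<beta>, \<beta>') + F (\<beta>, \<alpha>') (\<alpha>, \<beta>'))" for \<alpha> \<beta> \<alpha>' \<beta>'
  define Ft where "Ft \<alpha>' \<beta>' = (1/2) *s (F (0, \<alpha>') (1, \<beta>') - F (1, \<alpha>') (0, \<beta>'))" for \<alpha>' \<beta>'
  define Fh where "Fh \<alpha> \<beta> = (1 / (2 * of_nat CARD('m))) *s
      (\<Sum>\<alpha>'\<in>UNIV. \<Sum>\<beta>'\<in>UNIV. eps_dotted \<alpha>' \<beta>' *s S \<alpha> \<beta> \<alpha>' \<beta>')" for \<alpha> \<beta>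
  define Fb where "Fb \<alpha> \<beta> \<alpha>' \<beta>' = S \<alpha> \<beta> \<alpha>' \<beta>' - eps_dotted \<alpha>' \<beta>' *s Fh \<alpha> \<beta>" for \<alpha> \<beta> \<alpha>' \<beta>'
  have anti_c: "F A B $ c = - (F B A $ c)" for A B c
    using anti[of A B] by simp
  have S_sym: "S \<alpha> \<beta> \<alpha>' \<beta>' = S \<beta> \<alpha> \<alpha>' \<beta>'" for \<alpha> \<beta> \<alpha>' \<beta>'
    by (simp add: S_def add.commute)
  have S_anti: "S \<alpha> \<beta> \<alpha>' \<beta>' = - S \<alpha> \<beta> \<beta>' \<alpha>'" for \<alpha> \<beta> \<alpha>' \<beta>'
    using anti_c[of "(\<alpha>, \<alpha>')" "(\<beta>, \<beta>')"] anti_c[of "(\<beta>, \<alpha>')" "(\<alpha>, \<beta>')"]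
    by (simp add: S_def vec_eq_iff algebra_simps)
  have Fh_sym: "Fh \<alpha> \<beta> = Fh \<beta> \<alpha>" for \<alpha> \<beta>
    using S_sym[of \<alpha> \<beta>] by (simp add: Fh_def)
  have F_eq: "F (\<alpha>, \<alpha>') (\<beta>, \<beta>') = eps_undotted \<alpha> \<beta> *s Ft \<alpha>' \<beta>' + S \<alpha> \<beta> \<alpha>' \<beta>'" for \<alpha> \<alpha>' \<beta> \<beta>'
    using exhaust_undotted[of \<alpha>] exhaust_undotted[of \<beta>]
    by (auto simp: S_def Ft_def eps_undotted_def vec_eq_iff field_simps)
  have Ft_sym: "Ft \<alpha>' \<beta>' = Ft \<beta>' \<alpha>'" for \<alpha>' \<beta>'
    using anti_c[of "(0, \<alpha>')" "(1, \<beta>')"] anti_c[of "(1, \<alpha>')" "(0, \<beta>')"]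
    by (simp add: Ft_def vec_eq_iff)
  have trace: "(\<Sum>\<alpha>'\<in>UNIV. \<Sum>\<beta>'\<in>UNIV. eps_dotted \<alpha>' \<beta>' *s Fb \<alpha> \<beta> \<alpha>' \<beta>') = 0" for \<alpha> \<beta>
  proof -
    have "(\<Sum>\<alpha>'\<in>UNIV. \<Sum>\<beta>'\<in>UNIV. eps_dotted \<alpha>' \<beta>' *s Fb \<alpha> \<beta> \<alpha>' \<beta>') =
        (\<Sum>\<alpha>'\<in>UNIV. \<Sum>\<beta>'\<in>UNIV. eps_dotted \<alpha>' \<beta>' *s S \<alpha> \<beta> \<alpha>' \<beta>') -
        (\<Sum>\<alpha>'\<in>UNIV. \<Sum>\<beta>'\<in>UNIV. eps_dotted \<alpha>' \<beta>' * eps_dotted \<alpha>' (\<beta>' :: 'm dotted)) *s Fh \<alpha> \<beta>"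
      by (simp add: Fb_def vec_eq_iff sum_subtractf sum_distrib_right right_diff_distrib mult.assoc)
    also have "\<dots> = 0"
      by (simp only: sum_eps_dotted_squared) (simp add: Fh_def vec_eq_iff)
    finally show ?thesis .
  qed
  have "field_strength_decomposition F Ft Fh Fb"
    unfolding field_strength_decomposition_def
  proof (intro conjI allI)
    fix \<alpha> \<beta> :: 2 and \<alpha>' \<beta>' :: "'m dotted"
    show "F (\<alpha>, \<alpha>') (\<beta>, \<beta>') = eps_undotted \<alpha> \<beta> *s Ft \<alpha>' \<beta>' + eps_dotted \<alpha>' \<beta>' *s Fh \<alpha> \<beta> + Fb \<alpha> \<beta> \<alpha>' \<beta>'"
      by (simp add: F_eq Fb_def)
    show "Fb \<alpha> \<beta> \<alpha>' \<beta>' = Fb \<beta> \<alpha> \<alpha>' \<beta>'"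
      by (simp add: Fb_def S_sym[of \<alpha> \<beta>] Fh_sym[of \<alpha> \<beta>])
    show "Fb \<alpha> \<beta> \<alpha>' \<beta>' = - Fb \<alpha> \<beta> \<beta>' \<alpha>'"
      by (simp add: Fb_def S_anti[of \<alpha> \<beta> \<alpha>'] eps_dotted_antisym[of \<beta>' \<alpha>'] vec_eq_iff)
  qed (fact Ft_sym Fh_sym trace)+
  then show ?thesis by blast
qed

lemma field_strength_decomposition_unique:
  fixes F :: "'m::finite index \<Rightarrow> 'm index \<Rightarrow> complex ^ 'g::finite"
  assumes "field_strength_decomposition F Ft Fh Fb" "field_strength_decomposition F Ft' Fh' Fb'"
  shows "Ft = Ft' \<and> Fh = Fh' \<and> Fb = Fb'"
proof -
  have eps_anti: "eps_undotted \<beta> \<alpha> = - eps_undotted \<alpha> \<beta>" for \<alpha> \<beta>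
    using exhaust_undotted[of \<alpha>] exhaust_undotted[of \<beta>] by (auto simp: eps_undotted_def)
  have dec: "G1 = (\<lambda>\<alpha>' \<beta>'. (1/2) *s (F (0, \<alpha>') (1, \<beta>') - F (1, \<alpha>') (0, \<beta>'))) \<and>
      G2 = (\<lambda>\<alpha> \<beta>. (1 / (2 * of_nat CARD('m))) *s (\<Sum>\<alpha>'\<in>UNIV. \<Sum>\<beta>'\<in>UNIV.
        eps_dotted \<alpha>' \<beta>' *s ((1/2) *s (F (\<alpha>, \<alpha>') (\<beta>, \<beta>') + F (\<beta>, \<alpha>') (\<alpha>, \<beta>'))))) \<and>
      G3 = (\<lambda>\<alpha> \<beta> \<alpha>' \<beta>'. F (\<alpha>, \<alpha>') (\<beta>, \<beta>') - eps_undotted \<alpha> \<beta> *s G1 \<alpha>' \<beta>' - eps_dotted \<alpha>' \<beta>' *s G2 \<alpha> \<beta>)"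
    if G: "field_strength_decomposition F G1 G2 G3" for G1 G2 G3
  proof (intro conjI ext)
    have eq: "F (\<alpha>, \<alpha>') (\<beta>, \<beta>') = eps_undotted \<alpha> \<beta> *s G1 \<alpha>' \<beta>' + eps_dotted \<alpha>' \<beta>' *s G2 \<alpha> \<beta> + G3 \<alpha> \<beta> \<alpha>' \<beta>'"
      and s2: "G2 \<alpha> \<beta> = G2 \<beta> \<alpha>" and s3: "G3 \<alpha> \<beta> \<alpha>' \<beta>' = G3 \<beta> \<alpha> \<alpha>' \<beta>'"
      and tr: "(\<Sum>\<alpha>'\<in>UNIV. \<Sum>\<beta>'\<in>UNIV. eps_dotted \<alpha>' \<beta>' *s G3 \<alpha> \<beta> \<alpha>' \<beta>') = 0" for \<alpha> \<beta> \<alpha>' \<beta>'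
      using G unfolding field_strength_decomposition_def by blast+
    show "G1 \<alpha>' \<beta>' = (1/2) *s (F (0, \<alpha>') (1, \<beta>') - F (1, \<alpha>') (0, \<beta>'))" for \<alpha>' \<beta>'
      using s2[of 0 1] s3[of 0 1 \<alpha>' \<beta>'] by (simp add: eq eps_undotted_def vec_eq_iff)
    show "G3 \<alpha> \<beta> \<alpha>' \<beta>' = F (\<alpha>, \<alpha>') (\<beta>, \<beta>') - eps_undotted \<alpha> \<beta> *s G1 \<alpha>' \<beta>' - eps_dotted \<alpha>' \<beta>' *s G2 \<alpha> \<beta>"
      for \<alpha> \<beta> \<alpha>' \<beta>' by (simp add: eq)
    fix \<alpha> \<beta>
    have S: "(1/2) *s (F (\<alpha>, \<alpha>') (\<beta>, \<beta>') + F (\<beta>, \<alpha>') (\<alpha>, \<beta>')) = eps_dotted \<alpha>' \<beta>' *s G2 \<alpha> \<beta> + G3 \<alpha> \<beta> \<alpha>' \<beta>'"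
      for \<alpha>' \<beta>'
      by (simp add: eq s2[of \<beta> \<alpha>] s3[of \<beta> \<alpha>] eps_anti[of \<beta> \<alpha>] vec_eq_iff)
    have "(\<Sum>\<alpha>'\<in>UNIV. \<Sum>\<beta>'\<in>UNIV. eps_dotted \<alpha>' \<beta>' *s (eps_dotted \<alpha>' \<beta>' *s G2 \<alpha> \<beta> + G3 \<alpha> \<beta> \<alpha>' \<beta>'))
        = (\<Sum>\<alpha>'\<in>UNIV. \<Sum>\<beta>'\<in>UNIV. eps_dotted \<alpha>' \<beta>' * eps_dotted \<alpha>' (\<beta>' :: 'm dotted)) *s G2 \<alpha> \<beta>
          + (\<Sum>\<alpha>'\<in>UNIV. \<Sum>\<beta>'\<in>UNIV. eps_dotted \<alpha>' \<beta>' *s G3 \<alpha> \<beta> \<alpha>' \<beta>')"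
      by (simp add: vec_eq_iff sum.distrib sum_distrib_right distrib_left mult.assoc)
    also have "\<dots> = (2 * of_nat CARD('m)) *s G2 \<alpha> \<beta>"
      by (simp only: sum_eps_dotted_squared tr) simp
    finally show "G2 \<alpha> \<beta> = (1 / (2 * of_nat CARD('m))) *s (\<Sum>\<alpha>'\<in>UNIV. \<Sum>\<beta>'\<in>UNIV.
        eps_dotted \<alpha>' \<beta>' *s ((1/2) *s (F (\<alpha>, \<alpha>') (\<beta>, \<beta>') + F (\<beta>, \<alpha>') (\<alpha>, \<beta>'))))"
      by (simp only: S) (simp add: vec_eq_iff)
  qed
  show ?thesis using dec[OF assms(1)] dec[OF assms(2)] by simp
qed

text \<open>
  Every \<open>F\<close> with \<open>F A B = - F B A\<close> has exactly one decomposition, so the following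
  says that the components \<open>F_hat\<close> and \<open>F_breve\<close> of the field strength vanish.
\<close>

definition hyperholomorphic :: "('m::finite, 'g::finite) gauge_field \<Rightarrow> bool" where
  "hyperholomorphic a \<longleftrightarrow> (\<forall>x. \<exists>F_tilde.
     field_strength_decomposition (linearised_field_strength a x) F_tilde (\<lambda>_ _. 0) (\<lambda>_ _ _ _. 0))"

definition totally_symmetric :: "('d \<Rightarrow> 'd \<Rightarrow> 'd \<Rightarrow> 'd \<Rightarrow> complex) \<Rightarrow> bool" where
  "totally_symmetric \<psi> \<longleftrightarrow>
     (\<forall>a b c d. \<psi> a b c d = \<psi> b a c d \<and> \<psi> a b c d = \<psi> a c b d \<and> \<psi> a b c d = \<psi> a b d c)"

definition hyperkaehler :: "'m::finite metric_field \<Rightarrow> bool" where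
  "hyperkaehler h \<longleftrightarrow> (\<forall>x. \<exists>\<psi>. totally_symmetric \<psi> \<and>
     (\<forall>\<alpha> \<alpha>' \<beta> \<beta>' \<gamma> \<gamma>' \<delta> \<delta>'.
        linearised_riemann h x (\<alpha>, \<alpha>') (\<beta>, \<beta>') (\<gamma>, \<gamma>') (\<delta>, \<delta>') =
          eps_undotted \<alpha> \<beta> * eps_undotted \<gamma> \<delta> * \<psi> \<alpha>' \<beta>' \<gamma>' \<delta>'))"


section \<open>Spinor parametrizations\<close>

definition spinor_product :: "complex ^ 2 \<Rightarrow> complex ^ ('m + 'm) \<Rightarrow> 'm::finite vec4m" where
  "spinor_product u v = (\<chi> A. u $ fst A * v $ snd A)"

definition simple_momentum :: "'m::finite vec4m \<Rightarrow> bool" where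
  "simple_momentum k \<longleftrightarrow> (\<exists>\<kappa> \<kappa>t. k = spinor_product \<kappa> \<kappa>t)"

text \<open>
  \<open>\<kappa> a\<close> is \<open>\<kappa>\<^sup>\<alpha>\<^sup>a\<close>, \<open>\<kappa>t a\<close> is \<open>\<kappa>~\<^sup>\<alpha>'\<^sub>a\<close> and \<open>e a\<close> is \<open>\<epsilon>\<^sup>a\<^sub>\<alpha>\<close> (stored with its lower spinor index).
  The label \<open>a = 1, 2\<close> ranges over the type \<open>2\<close>, in which \<open>2 = 0\<close>.
\<close>

definition general_momentum :: "(2 \<Rightarrow> complex ^ 2) \<Rightarrow> (2 \<Rightarrow> complex ^ ('m + 'm)) \<Rightarrow> 'm::finite vec4m" where
  "general_momentum \<kappa> \<kappa>t = (\<Sum>a\<in>UNIV. spinor_product (\<kappa> a) (\<kappa>t a))"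

definition hh_polarization :: "(2 \<Rightarrow> complex ^ 2) \<Rightarrow> (2 \<Rightarrow> complex ^ ('m + 'm)) \<Rightarrow> 'm::finite vec4m" where
  "hh_polarization e \<kappa>t = (\<Sum>a\<in>UNIV. spinor_product (e a) (lower_dotted (\<kappa>t a)))"

definition simple_polarization ::
  "complex ^ 2 \<Rightarrow> complex ^ ('m + 'm) \<Rightarrow> complex ^ 2 \<Rightarrow> 'm::finite vec4m" where
  "simple_polarization \<kappa> \<kappa>t \<iota> =
     (\<chi> A. lower_undotted \<iota> $ fst A * lower_dotted \<kappa>t $ snd A / angle_bracket \<kappa> \<iota>)"

definition sym_kappa_eps :: "complex ^ 2 \<Rightarrow> complex ^ 2 \<Rightarrow> 2 \<Rightarrow> 2 \<Rightarrow> complex" where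
  "sym_kappa_eps u v \<alpha> \<beta> =
     (lower_undotted u $ \<alpha> * v $ \<beta> + lower_undotted u $ \<beta> * v $ \<alpha>) / 2"

definition wedge :: "complex ^ ('m::finite + 'm) \<Rightarrow> complex ^ ('m + 'm) \<Rightarrow> 'm dotted \<Rightarrow> 'm dotted \<Rightarrow> complex" where
  "wedge u v \<alpha> \<beta> =
     (lower_dotted u $ \<alpha> * lower_dotted v $ \<beta> - lower_dotted u $ \<beta> * lower_dotted v $ \<alpha>) / 2"

definition trace_condition ::
  "(2 \<Rightarrow> complex ^ 2) \<Rightarrow> (2 \<Rightarrow> complex ^ 2) \<Rightarrow> (2 \<Rightarrow> complex ^ ('m::finite + 'm)) \<Rightarrow> bool" where
  "trace_condition \<kappa> e \<kappa>t \<longleftrightarrow> (\<forall>\<alpha> \<beta>.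
     (\<Sum>a\<in>UNIV. \<Sum>b\<in>UNIV. sym_kappa_eps (\<kappa> a) (e b) \<alpha> \<beta> * square_bracket (\<kappa>t a) (\<kappa>t b)) = 0)"

definition wedge_condition ::
  "(2 \<Rightarrow> complex ^ 2) \<Rightarrow> (2 \<Rightarrow> complex ^ 2) \<Rightarrow> (2 \<Rightarrow> complex ^ ('m::finite + 'm)) \<Rightarrow> bool" where
  "wedge_condition \<kappa> e \<kappa>t \<longleftrightarrow> (\<forall>\<alpha> \<beta> \<alpha>' \<beta>'.
     (\<Sum>a\<in>UNIV. \<Sum>b\<in>UNIV. sym_kappa_eps (\<kappa> a) (e b) \<alpha> \<beta> * wedge (\<kappa>t a) (\<kappa>t b) \<alpha>' \<beta>') = 0)"

definition proportional :: "complex ^ 'n \<Rightarrow> complex ^ 'n \<Rightarrow> bool" where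
  "proportional u v \<longleftrightarrow> (\<exists>c. u = c *s v) \<or> (\<exists>c. v = c *s u)"


section \<open>Counting polarizations\<close>

text \<open>
  For a subspace \<open>W\<close> containing \<open>k\<^sub>\<alpha>\<^sub>\<alpha>'\<close>, the dimension of the quotient of \<open>W\<close> by the pure-gauge
  direction \<open>\<epsilon> \<propto> k\<close>.
\<close>

definition polarizations_mod_gauge :: "'m::finite vec4m \<Rightarrow> 'm vec4m set \<Rightarrow> nat" where
  "polarizations_mod_gauge k W = vec.dim W - vec.dim {lower_vec k}"


section \<open>Affine varieties, dimension and codimension\<close>

text \<open>The algebra of functions generated by the constants and a set \<open>X\<close> of coordinate functions.\<close>

inductive_set poly_functions :: "('v \<Rightarrow> complex) set \<Rightarrow> ('v \<Rightarrow> complex) set"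
  for X :: "('v \<Rightarrow> complex) set" where
  const: "(\<lambda>_. c) \<in> poly_functions X"
| coord: "f \<in> X \<Longrightarrow> f \<in> poly_functions X"
| add: "f \<in> poly_functions X \<Longrightarrow> g \<in> poly_functions X \<Longrightarrow> (\<lambda>z. f z + g z) \<in> poly_functions X"
| mult: "f \<in> poly_functions X \<Longrightarrow> g \<in> poly_functions X \<Longrightarrow> (\<lambda>z. f z * g z) \<in> poly_functions X"

definition polys_on_space :: "(complex ^ 'n \<Rightarrow> complex) set" where
  "polys_on_space = poly_functions {\<lambda>z. z $ i |i. True}"

definition polys_in_variables :: "nat \<Rightarrow> ((nat \<Rightarrow> complex) \<Rightarrow> complex) set" where
  "polys_in_variables r = poly_functions {\<lambda>w. w j |j. j < r}"

definition algebraic_set :: "(complex ^ 'n) set \<Rightarrow> bool" where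
  "algebraic_set V \<longleftrightarrow> (\<exists>P \<subseteq> polys_on_space. V = {z. \<forall>p\<in>P. p z = 0})"

text \<open>
  Algebraic independence of \<open>f 0, \<dots>, f (r - 1)\<close> as elements of the coordinate ring of \<open>V\<close>.
  Over the infinite field of complex numbers a polynomial is zero iff its function is.
\<close>

definition algebraically_independent_on ::
  "(complex ^ 'n) set \<Rightarrow> nat \<Rightarrow> (nat \<Rightarrow> complex ^ 'n \<Rightarrow> complex) \<Rightarrow> bool" where
  "algebraically_independent_on V r f \<longleftrightarrow>
     (\<forall>P \<in> polys_in_variables r. (\<forall>z\<in>V. P (\<lambda>j. f j z) = 0) \<longrightarrow> (\<forall>w. P w = 0))"

text \<open>
  The dimension of a nonempty affine variety: the maximal number of algebraically independent
  elements of its coordinate ring (the transcendence degree of the function field, if irreducible).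
\<close>

definition variety_dim :: "(complex ^ 'n) set \<Rightarrow> nat" where
  "variety_dim V = (GREATEST r. \<exists>f. (\<forall>j<r. f j \<in> polys_on_space) \<and> algebraically_independent_on V r f)"

text \<open>
  The codimension of \<open>S\<close> in \<open>N\<close> is the difference of dimensions, as for irreducible \<open>N\<close>; it is
  applied to the null cone, which is an irreducible quadric because its rank \<open>4m\<close> is at least 3.
\<close>

definition subvariety_of_codim ::
  "(complex ^ 'n) set \<Rightarrow> (complex ^ 'n) set \<Rightarrow> nat \<Rightarrow> bool" where
  "subvariety_of_codim S N d \<longleftrightarrow>
     algebraic_set S \<and> algebraic_set N \<and> S \<subseteq> N \<and> variety_dim S + d = variety_dim N"

definition null_cone :: "'m::finite vec4m set" where
  "null_cone = {k. null_momentum k}"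

definition simple_momenta :: "'m::finite vec4m set" where
  "simple_momenta = {k. simple_momentum k}"

definition hyperholomorphic_momenta :: "complex ^ 'g::finite \<Rightarrow> 'm::finite vec4m set" where
  "hyperholomorphic_momenta T = {k. \<exists>\<epsilon>. on_shell k \<epsilon> \<and>
     nontrivial_gluon (gluon T \<epsilon> k) \<and> hyperholomorphic (gluon T \<epsilon> k)}"

definition hyperkaehler_momenta :: "'m::finite vec4m set" where
  "hyperkaehler_momenta = {k. \<exists>\<epsilon>. on_shell k \<epsilon> \<and>
     nontrivial_graviton (graviton \<epsilon> k) \<and> hyperkaehler (graviton \<epsilon> k)}"

end

theory Submission
  imports Defs
begin

text \<open>
  For plane waves the linearised field strength is \<open>F = \<i> e\<^sup>i\<^sup>k\<^sup>x (k \<and> \<epsilon>) T\<close> and the linearised curvature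
  is \<open>(k \<and> \<epsilon>) \<otimes> (k \<and> \<epsilon>)\<close> up to a nonvanishing factor, so both conditions say that the part of
  \<open>k \<and> \<epsilon>\<close> symmetric in the undotted indices vanishes. The diagonal components of this equation
  make the rows \<open>k\<^sub>0, \<epsilon>\<^sub>0\<close> and \<open>k\<^sub>1, \<epsilon>\<^sub>1\<close> pairwise proportional; if \<open>k\<^sub>0\<close> and \<open>k\<^sub>1\<close> are independent,
  the mixed component forces \<open>\<epsilon> \<propto> k\<close>, which is pure gauge, and otherwise
  \<open>k = \<kappa> \<otimes> \<kappa>~\<close> and \<open>\<epsilon> = e \<otimes> \<kappa>~\<close>.

  The dimensions are read off from the growth of the coordinate rings: if the functions of degree at
  most \<open>D\<close> on a variety span a space of dimension \<open>O(D\<^sup>d)\<close>, then more than \<open>d\<close> functions satisfy a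
  polynomial relation, since they have too many monomials. Conversely, independent functions come
  from projections of the variety whose image is dense.
\<close>

section \<open>Linearised curvature of plane waves\<close>

text \<open>Pure gauge is the obstacle throughout: \<epsilon> proportional to k satisfies both
  conditions for every null momentum, so only nonvanishing curvature can force k to be simple. For
  the gluon, what remains of k wedge \<epsilon> is automatically an admissible
  \<open>F_tilde\<close>. The graviton asks for more: \<psi> must be symmetric in all four indices,
  which a product \<open>t a b * t c d\<close> with t merely symmetric is not, so the solutions are
  classified before that equivalence is proved. The normalized polarization has no free scale,
  because a rescaling of \<iota> drops out. The scale is absorbed into the splitting of k into two
  spinors, at the price of a complex square root. The codimension is a difference of two counts. The
  quadric removes one of 4m coordinates. The 2m + 2 spinor components of a simple momentum lose one
  to the common rescaling of the two factors, which leaves 2m + 1.\<close>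

lemma two_eq_0: "(2::2) = 0" by simp

text \<open>The labels 1, 2 live in a type where the numeral 2 is 0, so sums over labels and over
  spinor indices are both written with 0 and 1.\<close>

lemma sum_UNIV_2: "sum f (UNIV :: 2 set) = f 0 + f 1"
  by (simp only: sum_2 two_eq_0 add.commute)

section \<open>Contractions with the symplectic forms\<close>

text \<open>Each column a of \<open>eps_dotted\<close> has a single nonzero entry, in row
  \<open>bar_dotted a\<close> and with value \<open>sgn_dotted a\<close>, so every contraction
  collapses to one term.\<close>

definition bar_dotted :: "'m + 'm \<Rightarrow> 'm + 'm" where
  "bar_dotted = case_sum Inr Inl"

definition sgn_dotted :: "'m + 'm \<Rightarrow> complex" where
  "sgn_dotted = case_sum (\<lambda>_. - 1) (\<lambda>_. 1)"

lemma bar_dotted_simps [simp]: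
  "bar_dotted (Inl i) = Inr i" "bar_dotted (Inr i) = Inl i"
  "sgn_dotted (Inl i) = - 1" "sgn_dotted (Inr i) = 1"
  by (simp_all add: bar_dotted_def sgn_dotted_def)

lemma bar_dotted_bar [simp]: "bar_dotted (bar_dotted a) = a"
  by (cases a) auto

lemma sgn_dotted_bar [simp]: "sgn_dotted (bar_dotted a) = - sgn_dotted a"
  by (cases a) auto

lemma sgn_dotted_square [simp]: "sgn_dotted a * sgn_dotted a = 1"
  by (cases a) auto

lemma eps_dotted_eq: "eps_dotted b a = (if b = bar_dotted a then sgn_dotted a else 0)"
  by (cases a; cases b) auto

lemma sum_eps_dotted:
  "(\<Sum>b\<in>UNIV. g b * eps_dotted b a) = sgn_dotted a * g (bar_dotted (a :: 'm::finite + 'm))"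
  by (simp add: eps_dotted_eq if_distrib cong: if_cong)

lemma lower_undotted_nth [simp]:
  "lower_undotted v $ 0 = - (v $ 1)" "lower_undotted v $ 1 = v $ 0"
  by (simp_all add: lower_undotted_def sum_UNIV_2 eps_undotted_def)

lemma lower_dotted_nth: "lower_dotted v $ a = sgn_dotted a * v $ bar_dotted a"
  by (simp add: lower_dotted_def sum_eps_dotted)

lemma lower_vec_nth:
  "lower_vec v $ (0, a) = - (sgn_dotted a * v $ (1, bar_dotted a))"
  "lower_vec v $ (1, a) = sgn_dotted a * v $ (0, bar_dotted a)"
  by (simp_all add: lower_vec_def sum_UNIV_2 eps_undotted_def sum_eps_dotted sum_negf)

lemma raise_vec_nth:
  "raise_vec v $ (0, a) = - (sgn_dotted a * v $ (1, bar_dotted a))"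
  "raise_vec v $ (1, a) = sgn_dotted a * v $ (0, bar_dotted a)"
proof -
  have e: "eps_dotted a b = - eps_dotted b a" for b by (rule eps_dotted_antisym)
  have s: "(\<Sum>b\<in>UNIV. eps_dotted a b * g b) = - (sgn_dotted a * g (bar_dotted a))" for g :: "'a + 'a \<Rightarrow> complex"
    using sum_eps_dotted[of g a] by (simp add: e sum_negf mult.commute)
  show "raise_vec v $ (0, a) = - (sgn_dotted a * v $ (1, bar_dotted a))"
   "raise_vec v $ (1, a) = sgn_dotted a * v $ (0, bar_dotted a)"
    by (simp_all add: raise_vec_def sum_UNIV_2 eps_undotted_def s sum_negf)
qed

lemma all_2: "(\<forall>\<alpha>::2. P \<alpha>) \<longleftrightarrow> P 0 \<and> P 1"
  using exhaust_undotted by metis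

text \<open>Raising contracts with the transposed arrays, and the signs from the undotted and the
  dotted form cancel. Likewise lowering is an involution on vectors although it squares to -1 on
  each spinor factor.\<close>

lemma raise_vec_eq_lower_vec: "raise_vec = lower_vec"
proof
  fix v :: "'m::finite vec4m"
  have "raise_vec v $ (\<alpha>, a) = lower_vec v $ (\<alpha>, a)" for \<alpha> a
    using exhaust_undotted[of \<alpha>] by (auto simp: raise_vec_nth lower_vec_nth)
  then show "raise_vec v = lower_vec v" by (auto simp: vec_eq_iff)
qed

lemma lower_vec_lower_vec [simp]: "lower_vec (lower_vec v) = v"
proof -
  have "lower_vec (lower_vec v) $ (\<alpha>, a) = v $ (\<alpha>, a)" for \<alpha> a
    using exhaust_undotted[of \<alpha>] by (auto simp: lower_vec_nth)
  then show ?thesis by (auto simp: vec_eq_iff)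
qed

lemma lower_spinors [simp]:
  "lower_undotted (lower_undotted u) = - u" "lower_dotted (lower_dotted v) = - v"
  by (simp_all add: vec_eq_iff all_2 lower_dotted_nth)

lemma spinor_product_nth [simp]: "spinor_product u v $ (\<alpha>, a) = u $ \<alpha> * v $ a"
  by (simp add: spinor_product_def)

lemma lower_vec_spinor_product:
  "lower_vec (spinor_product u v) = spinor_product (lower_undotted u) (lower_dotted v)"
proof -
  have "lower_vec (spinor_product u v) $ (\<alpha>, a) = spinor_product (lower_undotted u) (lower_dotted v) $ (\<alpha>, a)" for \<alpha> a
    using exhaust_undotted[of \<alpha>] by (auto simp: lower_vec_nth lower_dotted_nth)
  then show ?thesis by (auto simp: vec_eq_iff)
qed

lemma sum_prod_2: "(\<Sum>A\<in>UNIV. f (A :: 2 \<times> 'a::finite)) = (\<Sum>a\<in>UNIV. f (0, a) + f (1, a))"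
proof -
  have "(\<Sum>A\<in>UNIV. f (A :: 2 \<times> 'a)) = (\<Sum>\<alpha>\<in>UNIV. \<Sum>a\<in>UNIV. f (\<alpha>, a))"
    by (simp add: sum.cartesian_product)
  then show ?thesis by (simp add: sum_UNIV_2 sum.distrib)
qed

lemma angle_bracket_eq: "angle_bracket a b = a $ 1 * b $ 0 - a $ 0 * b $ 1"
  by (simp add: angle_bracket_def sum_UNIV_2)

lemma square_bracket_anti: "square_bracket a b = - square_bracket b a"
proof -
  have "(\<Sum>c\<in>UNIV. a $ c * (sgn_dotted c * b $ bar_dotted c)) =
     (\<Sum>c\<in>UNIV. a $ bar_dotted c * (- sgn_dotted c * b $ c))"
    by (rule sum.reindex_bij_witness[of _ bar_dotted bar_dotted]) auto
  then show ?thesis by (simp add: square_bracket_def lower_dotted_nth sum_negf mult_ac)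
qed

lemma pairing_spinor_product:
  "pairing (spinor_product u v) (spinor_product u' (lower_dotted v')) = (u $ 0 * u' $ 0 + u $ 1 * u' $ 1) * square_bracket v v'"
  by (simp add: pairing_def sum_prod_2 square_bracket_def sum_distrib_left algebra_simps sum.distrib)

lemma pairing_lin:
  "pairing (a + b) c = pairing a c + pairing b c"
  "pairing c (a + b) = pairing c a + pairing c b"
  "pairing (s *s a) c = s * pairing a c"
  "pairing c (s *s a) = s * pairing c a"
  by (simp_all add: pairing_def sum.distrib algebra_simps sum_distrib_left)

lemma lower_vec_lin:
  "lower_vec (a + b) = lower_vec a + lower_vec b"
  "lower_vec (s *s a) = s *s lower_vec a"
  by (simp_all add: lower_vec_def vec_eq_iff sum.distrib algebra_simps sum_distrib_left)

section \<open>Field strength and curvature of plane waves\<close>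

text \<open>The constant c keeps the right-hand side in the shape of the differentiated function, so
  the rule applies a second time, as the curvature requires.\<close>

lemma plane_wave_deriv:
  "partial A (\<lambda>y. c * plane_wave k y) x = \<i> * lower_vec k $ A * c * plane_wave k x"
proof -
  have a: "pairing (axis A 1) w = w $ A" for w :: "'a vec4m"
  proof -
    have "pairing (axis A 1) w = (\<Sum>B\<in>UNIV. if B = A then w $ B else 0)"
      unfolding pairing_def axis_def by (intro sum.cong) auto
    then show ?thesis by simp
  qed
  have "((\<lambda>t. c * exp (\<i> * (pairing x (lower_vec k) + t * lower_vec k $ A))) has_field_derivative
      \<i> * lower_vec k $ A * c * exp (\<i> * pairing x (lower_vec k))) (at 0)"
    by (auto intro!: derivative_eq_intros)
  then show ?thesis
    unfolding partial_def plane_wave_def pairing_lin a by (rule DERIV_imp_deriv)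
qed

definition wedge_form :: "'m::finite vec4m \<Rightarrow> 'm vec4m \<Rightarrow> 'm index \<Rightarrow> 'm index \<Rightarrow> complex" where
  "wedge_form p q A B = p $ A * q $ B - p $ B * q $ A"

lemma plane_wave_nonzero [simp]: "plane_wave k x \<noteq> 0"
  by (simp add: plane_wave_def)

lemma field_strength_gluon:
  "linearised_field_strength (gluon T \<epsilon> k) x A B =
     (\<i> * plane_wave k x * wedge_form (lower_vec k) \<epsilon> A B) *s T"
proof -
  have "partial A (\<lambda>y. gluon T \<epsilon> k y B $ c) x = \<i> * lower_vec k $ A * (\<epsilon> $ B * T $ c) * plane_wave k x" for A B c
    using plane_wave_deriv[of A "\<epsilon> $ B * T $ c" k x] by (simp add: gluon_def mult_ac)
  then show ?thesis
    by (simp add: linearised_field_strength_def vec_eq_iff wedge_form_def algebra_simps)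
qed

text \<open>Since h is the tensor square of \<epsilon>, the four second derivatives are the
  expansion of a product of two minors; \<open>\<i> * \<i> = - 1\<close> fixes the sign.\<close>

lemma riemann_graviton:
  "linearised_riemann (graviton \<epsilon> k) x A B C D =
     plane_wave k x / 2 * wedge_form (lower_vec k) \<epsilon> A B * wedge_form (lower_vec k) \<epsilon> C D"
proof -
  have "partial A (partial B (\<lambda>y. graviton \<epsilon> k y C D)) x =
      - (lower_vec k $ A * lower_vec k $ B * \<epsilon> $ C * \<epsilon> $ D * plane_wave k x)" for A B C D
  proof -
    have "partial B (\<lambda>y. graviton \<epsilon> k y C D) = (\<lambda>x. (\<i> * lower_vec k $ B * (\<epsilon> $ C * \<epsilon> $ D)) * plane_wave k x)"
    proof
      show "partial B (\<lambda>y. graviton \<epsilon> k y C D) x = (\<i> * lower_vec k $ B * (\<epsilon> $ C * \<epsilon> $ D)) * plane_wave k x" for x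
        unfolding graviton_def by (rule plane_wave_deriv)
    qed
    then have "partial A (partial B (\<lambda>y. graviton \<epsilon> k y C D)) x =
        \<i> * lower_vec k $ A * (\<i> * lower_vec k $ B * (\<epsilon> $ C * \<epsilon> $ D)) * plane_wave k x"
      by (simp only: plane_wave_deriv)
    also have "\<dots> = (\<i> * \<i>) * (lower_vec k $ A * lower_vec k $ B * \<epsilon> $ C * \<epsilon> $ D * plane_wave k x)"
      by (simp only: mult_ac)
    finally show ?thesis by simp
  qed
  then show ?thesis by (simp add: linearised_riemann_def wedge_form_def field_simps)
qed

lemma nontrivial_gluon_iff:
  assumes "T \<noteq> 0"
  shows "nontrivial_gluon (gluon T \<epsilon> k) \<longleftrightarrow> (\<exists>A B. wedge_form (lower_vec k) \<epsilon> A B \<noteq> 0)"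
  using assms by (simp add: nontrivial_gluon_def field_strength_gluon)

lemma nontrivial_graviton_iff:
  "nontrivial_graviton (graviton \<epsilon> k) \<longleftrightarrow> (\<exists>A B. wedge_form (lower_vec k) \<epsilon> A B \<noteq> 0)"
  by (auto simp: nontrivial_graviton_def riemann_graviton)

section \<open>Pairs of vectors whose wedge has no symmetric part\<close>

text \<open>Symmetric in the undotted and hence antisymmetric in the dotted indices: up to
  normalization this one array holds \<open>F_hat\<close> as its trace and \<open>F_breve\<close> as
  its traceless rest.\<close>

definition sym_part :: "'m::finite vec4m \<Rightarrow> 'm vec4m \<Rightarrow> 2 \<Rightarrow> 2 \<Rightarrow> 'm dotted \<Rightarrow> 'm dotted \<Rightarrow> complex" where
  "sym_part p q \<alpha> \<beta> a b = (wedge_form p q (\<alpha>, a) (\<beta>, b) + wedge_form p q (\<beta>, a) (\<alpha>, b)) / 2"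

definition self_dual :: "'m::finite vec4m \<Rightarrow> 'm vec4m \<Rightarrow> bool" where
  "self_dual p q \<longleftrightarrow> (\<forall>\<alpha> \<beta> a b. sym_part p q \<alpha> \<beta> a b = 0)"

lemma wedge_form_anti: "wedge_form p q A B = - wedge_form p q B A"
  by (simp add: wedge_form_def)

text \<open>An antisymmetric array over two index values is a multiple of
  \<open>eps_undotted\<close>; the factor t is its (0, 1) entry.\<close>

lemma self_dual_iff:
  "self_dual p q \<longleftrightarrow> (\<exists>t. \<forall>\<alpha> a \<beta> b. wedge_form p q (\<alpha>, a) (\<beta>, b) = eps_undotted \<alpha> \<beta> * t a b)"
proof
  assume "self_dual p q"
  then have s: "wedge_form p q (\<alpha>, a) (\<beta>, b) = - wedge_form p q (\<beta>, a) (\<alpha>, b)" for \<alpha> \<beta> a b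
    unfolding self_dual_def sym_part_def by (metis add_eq_0_iff2 divide_eq_0_iff zero_neq_numeral)
  have "wedge_form p q (\<alpha>, a) (\<beta>, b) = eps_undotted \<alpha> \<beta> * wedge_form p q (0, a) (1, b)" for \<alpha> \<beta> a b
  proof -
    have "wedge_form p q (0, a) (0, b) = 0" "wedge_form p q (1, a) (1, b) = 0"
      using s[of 0 a 0 b] s[of 1 a 1 b] by simp_all
    moreover note s[of 1 a 0 b]
    ultimately show ?thesis
      using exhaust_undotted[of \<alpha>] exhaust_undotted[of \<beta>] by (elim disjE) (simp_all add: eps_undotted_def)
  qed
  then show "\<exists>t. \<forall>\<alpha> a \<beta> b. wedge_form p q (\<alpha>, a) (\<beta>, b) = eps_undotted \<alpha> \<beta> * t a b"
    by (intro exI[of _ "\<lambda>a b. wedge_form p q (0, a) (1, b)"]) blast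
next
  assume "\<exists>t. \<forall>\<alpha> a \<beta> b. wedge_form p q (\<alpha>, a) (\<beta>, b) = eps_undotted \<alpha> \<beta> * t a b"
  then show "self_dual p q"
    by (auto simp: self_dual_def sym_part_def all_2 eps_undotted_def)
qed

lemma hyperholomorphic_gluon_iff:
  assumes "T \<noteq> 0"
  shows "hyperholomorphic (gluon T \<epsilon> k) \<longleftrightarrow> self_dual (lower_vec k) \<epsilon>"
proof
  assume "hyperholomorphic (gluon T \<epsilon> k)"
  then obtain F where F: "field_strength_decomposition (linearised_field_strength (gluon T \<epsilon> k) 0) F (\<lambda>_ _. 0) (\<lambda>_ _ _ _. 0)"
    unfolding hyperholomorphic_def by blast
  \<comment> \<open>A nonvanishing component of T and the nonvanishing plane wave permit division,
    so the condition at the single point 0 already determines \<open>wedge_form\<close>.\<close>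
  obtain c where c: "T $ c \<noteq> 0" using assms by (auto simp: vec_eq_iff)
  have "wedge_form (lower_vec k) \<epsilon> (\<alpha>, a) (\<beta>, b) = eps_undotted \<alpha> \<beta> * (F a b $ c / (\<i> * plane_wave k 0 * T $ c))" for \<alpha> a \<beta> b
  proof -
    have "(\<i> * plane_wave k 0 * wedge_form (lower_vec k) \<epsilon> (\<alpha>, a) (\<beta>, b)) *s T = eps_undotted \<alpha> \<beta> *s F a b"
      using F by (simp add: field_strength_decomposition_def field_strength_gluon)
    then have "\<i> * plane_wave k 0 * wedge_form (lower_vec k) \<epsilon> (\<alpha>, a) (\<beta>, b) * T $ c = eps_undotted \<alpha> \<beta> * F a b $ c"
      by (simp add: vec_eq_iff)
    then show ?thesis using c by (simp add: field_simps)
  qed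
  then show "self_dual (lower_vec k) \<epsilon>" unfolding self_dual_iff
    by (intro exI[of _ "\<lambda>a b. F a b $ c / (\<i> * plane_wave k 0 * T $ c)"]) blast
next
  assume "self_dual (lower_vec k) \<epsilon>"
  then obtain t where t: "\<And>\<alpha> a \<beta> b. wedge_form (lower_vec k) \<epsilon> (\<alpha>, a) (\<beta>, b) = eps_undotted \<alpha> \<beta> * t a b"
    unfolding self_dual_iff by blast
  \<comment> \<open>Exchanging both index pairs flips \<open>wedge_form\<close> and
    \<open>eps_undotted\<close> alike, so t has the symmetry demanded of
    \<open>F_tilde\<close>.\<close>
  have sym: "t a b = t b a" for a b
    using t[of 0 a 1 b] t[of 1 b 0 a] wedge_form_anti[of "lower_vec k" \<epsilon> "(0, a)" "(1, b)"]
    by (simp add: eps_undotted_def)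
  show "hyperholomorphic (gluon T \<epsilon> k)"
    unfolding hyperholomorphic_def
  proof
    fix x
    have "field_strength_decomposition (linearised_field_strength (gluon T \<epsilon> k) x)
       (\<lambda>a b. (\<i> * plane_wave k x * t a b) *s T) (\<lambda>_ _. 0) (\<lambda>_ _ _ _. 0)"
      using sym by (auto simp: field_strength_decomposition_def field_strength_gluon t vec_eq_iff)
    then show "\<exists>F. field_strength_decomposition (linearised_field_strength (gluon T \<epsilon> k) x) F (\<lambda>_ _. 0) (\<lambda>_ _ _ _. 0)"
      by blast
  qed
qed

text \<open>Rank at most one for a 2 by 2m matrix, expressed by its minors. The factors are read off
  from row 0, or from row 1 if row 0 vanishes.\<close>

lemma simple_momentum_iff:
  "simple_momentum k \<longleftrightarrow> (\<forall>a b. k $ (0, a) * k $ (1, b) = k $ (0, b) * k $ (1, a))"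
proof
  assume R: "\<forall>a b. k $ (0, a) * k $ (1, b) = k $ (0, b) * k $ (1, a)"
  show "simple_momentum k"
  proof (cases "\<exists>a. k $ (0, a) \<noteq> 0")
    case True
    then obtain a where a: "k $ (0, a) \<noteq> 0" by blast
    have "k $ A = spinor_product (\<chi> \<alpha>. k $ (\<alpha>, a) / k $ (0, a)) (\<chi> b. k $ (0, b)) $ A" for A
      using a R[rule_format, of a "snd A"] exhaust_undotted[of "fst A"]
      by (cases A) (auto simp: field_simps)
    then show ?thesis unfolding simple_momentum_def vec_eq_iff by blast
  next
    case False
    have "k $ A = spinor_product (\<chi> \<alpha>. if \<alpha> = 0 then 0 else 1) (\<chi> b. k $ (1, b)) $ A" for A
      using False exhaust_undotted[of "fst A"] by (cases A) auto
    then show ?thesis unfolding simple_momentum_def vec_eq_iff by blast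
  qed
qed (auto simp: simple_momentum_def)

lemma simple_momentum_lower_vec: "simple_momentum (lower_vec k) \<longleftrightarrow> simple_momentum k"
  unfolding simple_momentum_def by (metis lower_vec_spinor_product lower_vec_lower_vec)

lemma wedge_form_spinor_product:
  "wedge_form (spinor_product u v) (spinor_product e v) A B =
     (u $ fst A * e $ fst B - u $ fst B * e $ fst A) * (v $ snd A * v $ snd B)"
  by (cases A; cases B) (simp add: wedge_form_def algebra_simps)

text \<open>A common dotted factor v makes the wedge symmetric in the dotted indices, whereas
  \<open>sym_part\<close> is antisymmetric in them.\<close>

lemma self_dual_spinor_product: "self_dual (spinor_product u v) (spinor_product e v)"
  by (simp add: self_dual_def sym_part_def wedge_form_spinor_product algebra_simps)

lemma self_dual_scale: "self_dual p (c *s p)"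
  by (simp add: self_dual_def sym_part_def wedge_form_def)

lemma self_dual_diag:
  assumes "self_dual p q" 
  shows "p $ (\<alpha>, a) * q $ (\<alpha>, b) = p $ (\<alpha>, b) * q $ (\<alpha>, a)"
proof -
  have "sym_part p q \<alpha> \<alpha> a b = 0" using assms by (simp add: self_dual_def)
  then show ?thesis by (simp add: sym_part_def wedge_form_def)
qed

lemma self_dual_mixed:
  assumes "self_dual p q" 
  shows "p $ (\<alpha>, a) * q $ (\<beta>, b) - p $ (\<beta>, b) * q $ (\<alpha>, a) + (p $ (\<beta>, a) * q $ (\<alpha>, b) - p $ (\<alpha>, b) * q $ (\<beta>, a)) = 0"
proof -
  have "sym_part p q \<alpha> \<beta> a b = 0" using assms by (simp add: self_dual_def)
  then show ?thesis by (simp add: sym_part_def wedge_form_def)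
qed

text \<open>A diagonal component says nothing about a row where u vanishes. Such a row is reached
  through the mixed component with a row where u does not vanish.\<close>

lemma self_dual_simple:
  assumes "self_dual (spinor_product u v) q" "spinor_product u v \<noteq> 0"
  shows "\<exists>e. q = spinor_product e v"
proof -
  obtain \<alpha> j where nz: "u $ \<alpha> \<noteq> 0" "v $ j \<noteq> 0"
    using assms(2) by (auto simp: vec_eq_iff)
  have q\<alpha>: "q $ (\<alpha>, b) = q $ (\<alpha>, j) / v $ j * v $ b" for b
    using self_dual_diag[OF assms(1), of \<alpha> j b] nz by (simp add: field_simps)
  have "q $ (\<beta>, b) = q $ (\<beta>, j) / v $ j * v $ b" for \<beta> b
  proof -
    \<comment> \<open>These are the two terms that cancel in the mixed component;
      \<open>u $ \<beta>\<close> may be zero and is therefore not divided out.\<close>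
    have "u $ \<beta> * (v $ b * q $ (\<alpha>, j)) = u $ \<beta> * (v $ j * q $ (\<alpha>, b))"
      using q\<alpha>[of b] nz by (simp add: field_simps)
    then have "u $ \<alpha> * (v $ j * q $ (\<beta>, b)) = u $ \<alpha> * (v $ b * q $ (\<beta>, j))"
      using self_dual_mixed[OF assms(1), of \<alpha> j \<beta> b] unfolding spinor_product_nth by algebra
    then show ?thesis using nz by (simp add: field_simps)
  qed
  then have "q = spinor_product (\<chi> \<beta>. q $ (\<beta>, j) / v $ j) v"
    unfolding vec_eq_iff split_paired_All spinor_product_nth vec_lambda_beta by blast
  then show ?thesis by blast
qed

lemma self_dual_not_simple:
  assumes sd: "self_dual p q" and "\<not> simple_momentum p"
  shows "\<exists>c. q = c *s p"
proof -
  obtain i j where ij: "p $ (0, i) * p $ (1, j) \<noteq> p $ (0, j) * p $ (1, i)"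
    using assms(2) by (auto simp: simple_momentum_iff)
  \<comment> \<open>Neither row of p vanishes, since the minor at i, j is nonzero; so the diagonal
    components give one factor per row.\<close>
  have proportional: "\<exists>c. \<forall>b. q $ (\<alpha>, b) = c * p $ (\<alpha>, b)" for \<alpha>
  proof -
    obtain a where a: "p $ (\<alpha>, a) \<noteq> 0"
      using ij exhaust_undotted[of \<alpha>] by (cases "p $ (\<alpha>, i) = 0"; cases "p $ (\<alpha>, j) = 0") auto
    have "q $ (\<alpha>, b) = q $ (\<alpha>, a) / p $ (\<alpha>, a) * p $ (\<alpha>, b)" for b
      using self_dual_diag[OF sd, of \<alpha> a b] a by (simp add: field_simps)
    then show ?thesis by blast
  qed
  obtain c0 c1 where c: "\<And>b. q $ (0, b) = c0 * p $ (0, b)" "\<And>b. q $ (1, b) = c1 * p $ (1, b)"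
    using proportional by metis
  \<comment> \<open>The mixed component at i, j is the difference of the two row factors times the
    nonzero minor.\<close>
  have "(c1 - c0) * (p $ (0, i) * p $ (1, j) - p $ (0, j) * p $ (1, i)) = 0"
    using self_dual_mixed[OF sd, of 0 i 1 j] by (simp add: c algebra_simps)
  then have "c1 = c0" using ij by simp
  then have "q = c0 *s p"
    using c all_2[of "\<lambda>\<alpha>. \<forall>b. q $ (\<alpha>, b) = c0 * p $ (\<alpha>, b)"] by (auto simp: vec_eq_iff)
  then show ?thesis by blast
qed

lemma hyperkaehler_graviton_iff:
  "hyperkaehler (graviton \<epsilon> k) \<longleftrightarrow> self_dual (lower_vec k) \<epsilon>"
proof
  let ?w = "wedge_form (lower_vec k) \<epsilon>"
  assume hk: "hyperkaehler (graviton \<epsilon> k)"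
  show "self_dual (lower_vec k) \<epsilon>"
  proof (cases "\<exists>C D. ?w C D \<noteq> 0")
    case True
    then obtain \<gamma> c \<delta> d where nz: "?w (\<gamma>, c) (\<delta>, d) \<noteq> 0" by fastforce
    obtain \<psi> where \<psi>: "\<And>\<alpha> a \<beta> b \<gamma> c \<delta> d. linearised_riemann (graviton \<epsilon> k) 0 (\<alpha>, a) (\<beta>, b) (\<gamma>, c) (\<delta>, d) =
          eps_undotted \<alpha> \<beta> * eps_undotted \<gamma> \<delta> * \<psi> a b c d"
      using hk unfolding hyperkaehler_def by blast
    \<comment> \<open>With the second index pair frozen where the wedge is nonzero, the quadratic
      condition becomes a linear one.\<close>
    have "?w (\<alpha>, a) (\<beta>, b) = eps_undotted \<alpha> \<beta> * (2 * eps_undotted \<gamma> \<delta> * \<psi> a b c d / (plane_wave k 0 * ?w (\<gamma>, c) (\<delta>, d)))" for \<alpha> a \<beta> b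
      using \<psi>[of \<alpha> a \<beta> b \<gamma> c \<delta> d] nz by (simp add: riemann_graviton field_simps)
    then show ?thesis unfolding self_dual_iff
      by (intro exI[of _ "\<lambda>a b. 2 * eps_undotted \<gamma> \<delta> * \<psi> a b c d / (plane_wave k 0 * ?w (\<gamma>, c) (\<delta>, d))"]) blast
  next
    case False
    then show ?thesis by (simp add: self_dual_def sym_part_def)
  qed
next
  let ?p = "lower_vec k"
  assume sd: "self_dual ?p \<epsilon>"
  \<comment> \<open>The rank-one factor \<open>v a * v b\<close> is what makes \<psi> totally
    symmetric; it is supplied by the classification of the solutions.\<close>
  have "\<exists>s v. \<forall>\<alpha> a \<beta> b. wedge_form ?p \<epsilon> (\<alpha>, a) (\<beta>, b) = eps_undotted \<alpha> \<beta> * s * (v a * v b)"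
  proof (cases "simple_momentum ?p \<and> ?p \<noteq> 0")
    case True
    then obtain u v where uv: "?p = spinor_product u v" unfolding simple_momentum_def by blast
    obtain e where e: "\<epsilon> = spinor_product e v" using self_dual_simple sd True unfolding uv by blast
    have "wedge_form ?p \<epsilon> (\<alpha>, a) (\<beta>, b) = eps_undotted \<alpha> \<beta> * (u $ 0 * e $ 1 - u $ 1 * e $ 0) * (v $ a * v $ b)" for \<alpha> a \<beta> b
      using exhaust_undotted[of \<alpha>] exhaust_undotted[of \<beta>]
      by (auto simp: uv e wedge_form_spinor_product eps_undotted_def algebra_simps)
    then show ?thesis
      by (intro exI[of _ "u $ 0 * e $ 1 - u $ 1 * e $ 0"] exI[of _ "\<lambda>a. v $ a"]) blast
  next
    case False
    \<comment> \<open>Here k vanishes or \<epsilon> is proportional to it; there is no curvature,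
      and s = 0 serves.\<close>
    have "wedge_form ?p \<epsilon> A B = 0" for A B
    proof (cases "?p = 0")
      case False
      then obtain c where "\<epsilon> = c *s ?p" using self_dual_not_simple[OF sd] \<open>\<not> (simple_momentum ?p \<and> ?p \<noteq> 0)\<close> by blast
      then show ?thesis by (simp add: wedge_form_def)
    qed (simp add: wedge_form_def)
    then show ?thesis by (intro exI[of _ "0::complex"]) simp
  qed
  then obtain s v where w: "\<And>\<alpha> a \<beta> b. wedge_form ?p \<epsilon> (\<alpha>, a) (\<beta>, b) = eps_undotted \<alpha> \<beta> * s * (v a * v b)"
    by blast
  show "hyperkaehler (graviton \<epsilon> k)"
    unfolding hyperkaehler_def
  proof (rule allI)
    fix x
    define \<psi> where "\<psi> a b c d = plane_wave k x / 2 * s * s * (v a * v b * v c * v d)" for a b c d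
    have "totally_symmetric \<psi>"
      by (simp add: totally_symmetric_def \<psi>_def mult_ac)
    moreover have "linearised_riemann (graviton \<epsilon> k) x (\<alpha>, a) (\<beta>, b) (\<gamma>, c) (\<delta>, d) =
        eps_undotted \<alpha> \<beta> * eps_undotted \<gamma> \<delta> * \<psi> a b c d" for \<alpha> a \<beta> b \<gamma> c \<delta> d
      by (simp add: riemann_graviton w \<psi>_def mult_ac)
    ultimately show "\<exists>\<psi>. totally_symmetric \<psi> \<and> (\<forall>\<alpha> a \<beta> b \<gamma> c \<delta> d.
        linearised_riemann (graviton \<epsilon> k) x (\<alpha>, a) (\<beta>, b) (\<gamma>, c) (\<delta>, d) =
          eps_undotted \<alpha> \<beta> * eps_undotted \<gamma> \<delta> * \<psi> a b c d)"
      by blast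
  qed
qed

section \<open>Spinor parametrizations and residual gauge freedom\<close>

lemma vec_index_eq_iff: "(p :: 'm::finite vec4m) = q \<longleftrightarrow> (\<forall>a. p $ (0, a) = q $ (0, a) \<and> p $ (1, a) = q $ (1, a))"
  by (auto simp: vec_eq_iff all_2)

lemma pairing_lower_vec:
  "pairing k (lower_vec k) = 2 * square_bracket (\<chi> a. k $ (1, a)) (\<chi> a. k $ (0, a))"
proof -
  have "pairing k (lower_vec k) = square_bracket (\<chi> a. k $ (1, a)) (\<chi> a. k $ (0, a)) - square_bracket (\<chi> a. k $ (0, a)) (\<chi> a. k $ (1, a))"
    by (simp add: pairing_def sum_prod_2 square_bracket_def lower_vec_nth lower_dotted_nth sum_subtractf algebra_simps)
  then show ?thesis
    using square_bracket_anti[of "\<chi> a. k $ (0, a)" "\<chi> a. k $ (1, a)"] by simp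
qed

section \<open>General null momenta and the components of the gluon field strength\<close>

text \<open>Take the standard basis for \<kappa> and the two rows of the matrix k for \<kappa>t; the
  bracket of the rows is half of k squared.\<close>

lemma null_momentum_parametrization:
  fixes k :: "'m::finite vec4m"
  assumes "null_momentum k"
  shows "\<exists>\<kappa> \<kappa>t. angle_bracket (\<kappa> 1) (\<kappa> 2) \<noteq> 0 \<and> square_bracket (\<kappa>t 1) (\<kappa>t 2) = 0 \<and>
          k = general_momentum \<kappa> \<kappa>t"
proof -
  define \<kappa> :: "2 \<Rightarrow> complex ^ 2" where "\<kappa> a = (\<chi> \<alpha>. if \<alpha> = a then 1 else 0)" for a
  define \<kappa>t :: "2 \<Rightarrow> complex ^ ('m + 'm)" where "\<kappa>t a = (\<chi> b. k $ (a, b))" for a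
  have "angle_bracket (\<kappa> 1) (\<kappa> 0) \<noteq> 0" by (simp add: angle_bracket_eq \<kappa>_def)
  moreover have "square_bracket (\<kappa>t 1) (\<kappa>t 0) = 0"
    using assms by (simp add: null_momentum_def pairing_lower_vec \<kappa>t_def)
  moreover have "k = general_momentum \<kappa> \<kappa>t"
    by (simp add: vec_index_eq_iff general_momentum_def sum_UNIV_2 \<kappa>_def \<kappa>t_def)
  ultimately show ?thesis unfolding two_eq_0[symmetric] by (metis two_eq_0)
qed

lemma square_bracket_self [simp]: "square_bracket a a = 0"
  using square_bracket_anti[of a a] by simp

lemma square_bracket_zero_all:
  assumes "square_bracket (\<kappa>t 1) (\<kappa>t (2::2)) = 0"
  shows "square_bracket (\<kappa>t a) (\<kappa>t b) = 0"
  using assms exhaust_undotted[of a] exhaust_undotted[of b] square_bracket_anti[of "\<kappa>t 0" "\<kappa>t 1"]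
  by (auto simp: two_eq_0)

lemma square_bracket_minus [simp]: "square_bracket (- a) b = - square_bracket a b"
  by (simp add: square_bracket_def sum_negf)

text \<open>All three pairings are combinations of brackets of \<kappa>t a with \<kappa>t b, which
  vanish by antisymmetry for equal labels and by assumption for different ones.\<close>

lemma on_shell_hh_polarization:
  assumes "square_bracket (\<kappa>t 1) (\<kappa>t 2) = 0"
  shows "on_shell (general_momentum \<kappa> \<kappa>t) (hh_polarization e \<kappa>t)"
  by (simp add: on_shell_def null_momentum_def general_momentum_def hh_polarization_def sum_UNIV_2
      raise_vec_eq_lower_vec lower_vec_lin lower_vec_spinor_product pairing_lin pairing_spinor_product
      square_bracket_zero_all[OF assms])

lemma on_shell_simple_polarization:
  "on_shell (spinor_product \<kappa> \<kappa>t) (simple_polarization \<kappa> \<kappa>t \<iota>)"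
proof -
  have "simple_polarization \<kappa> \<kappa>t \<iota> = spinor_product (inverse (angle_bracket \<kappa> \<iota>) *s lower_undotted \<iota>) (lower_dotted \<kappa>t)"
    by (simp add: vec_index_eq_iff simple_polarization_def field_simps)
  then show ?thesis
    by (simp add: on_shell_def null_momentum_def 
      raise_vec_eq_lower_vec lower_vec_spinor_product pairing_spinor_product)
qed

lemma lower_general_momentum:
  "lower_vec (general_momentum \<kappa> \<kappa>t) = (\<Sum>a\<in>UNIV. spinor_product (lower_undotted (\<kappa> a)) (lower_dotted (\<kappa>t a)))"
  by (simp add: general_momentum_def sum_UNIV_2 lower_vec_lin lower_vec_spinor_product)

text \<open>\<open>sym_kappa_eps\<close> and \<open>wedge\<close> each contain a factor 1/2 but
  \<open>sym_part\<close> only one, hence the 2.\<close>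

lemma sym_part_general:
  "sym_part (lower_vec (general_momentum \<kappa> \<kappa>t)) (hh_polarization e \<kappa>t) \<alpha> \<beta> a b =
    2 * (\<Sum>c\<in>UNIV. \<Sum>d\<in>UNIV. sym_kappa_eps (\<kappa> c) (e d) \<alpha> \<beta> * wedge (\<kappa>t c) (\<kappa>t d) a b)"
  by (simp add: lower_general_momentum hh_polarization_def sum_UNIV_2 sym_part_def wedge_form_def sym_kappa_eps_def wedge_def field_simps)

lemma wedge_condition_iff:
  "wedge_condition \<kappa> e \<kappa>t \<longleftrightarrow> self_dual (lower_vec (general_momentum \<kappa> \<kappa>t)) (hh_polarization e \<kappa>t)"
  by (simp add: self_dual_def sym_part_general wedge_condition_def)

text \<open>This makes the first hyperholomorphic condition, up to sign, the trace of the
  second.\<close>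

lemma trace_wedge: "(\<Sum>a\<in>UNIV. \<Sum>b\<in>UNIV. eps_dotted a b * wedge u v a b) = square_bracket v u"
proof -
  have low: "(\<Sum>a\<in>UNIV. \<Sum>b\<in>UNIV. eps_dotted a b * (lower_dotted u $ a * lower_dotted v $ b)) = square_bracket v u" for u v :: "complex ^ ('a + 'a)"
  proof -
    have "(\<Sum>b\<in>UNIV. eps_dotted a b * (lower_dotted u $ a * lower_dotted v $ b)) = lower_dotted u $ a * v $ a" for a
    proof -
      have "(\<Sum>b\<in>UNIV. eps_dotted a b * (lower_dotted u $ a * lower_dotted v $ b)) = - (lower_dotted u $ a * (\<Sum>b\<in>UNIV. lower_dotted v $ b * eps_dotted b a))"
        by (simp add: eps_dotted_antisym[of a] sum_distrib_left sum_negf mult_ac)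
      also have "\<dots> = lower_dotted u $ a * v $ a"
        unfolding sum_eps_dotted by (simp add: lower_dotted_nth flip: mult.assoc)
      finally show ?thesis .
    qed
    then show ?thesis by (simp add: square_bracket_def mult.commute)
  qed
  have sw: "(\<Sum>a\<in>UNIV. \<Sum>b\<in>UNIV. eps_dotted a b * (lower_dotted u $ b * lower_dotted v $ a)) = square_bracket u v"
    using low[of v u] by (simp add: mult_ac)
  have "(\<Sum>a\<in>UNIV. \<Sum>b\<in>UNIV. eps_dotted a b * wedge u v a b) = (square_bracket v u - square_bracket u v) / 2"
    unfolding low[of u v, symmetric] sw[symmetric] 
    by (simp add: wedge_def sum_subtractf right_diff_distrib diff_divide_distrib sum_divide_distrib)
  then show ?thesis using square_bracket_anti[of u v] by simp
qed

lemma trace_condition_null: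
  assumes "square_bracket (\<kappa>t 1) (\<kappa>t 2) = 0"
  shows "trace_condition \<kappa> e \<kappa>t"
  by (simp add: trace_condition_def square_bracket_zero_all[OF assms])

text \<open>The trace of \<open>sym_part\<close> is a combination of brackets of the \<kappa>t and
  vanishes, so nothing is left for \<open>F_hat\<close> and all of \<open>sym_part\<close> is
  \<open>F_breve\<close>. The part antisymmetric in the undotted indices goes to
  \<open>F_tilde\<close>.\<close>

lemma gluon_decomposition:
  fixes \<kappa> e :: "2 \<Rightarrow> complex ^ 2" and \<kappa>t :: "2 \<Rightarrow> complex ^ ('m::finite + 'm)" and T :: "complex ^ 'g::finite"
  assumes sb: "square_bracket (\<kappa>t 1) (\<kappa>t 2) = 0"
  defines "p \<equiv> lower_vec (general_momentum \<kappa> \<kappa>t)" and "\<epsilon> \<equiv> hh_polarization e \<kappa>t"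
  shows "field_strength_decomposition (linearised_field_strength (gluon T \<epsilon> (general_momentum \<kappa> \<kappa>t)) x)
     (\<lambda>a b. (\<i> * plane_wave (general_momentum \<kappa> \<kappa>t) x * (wedge_form p \<epsilon> (0, a) (1, b) - sym_part p \<epsilon> 0 1 a b)) *s T)
     (\<lambda>_ _. 0)
     (\<lambda>\<alpha> \<beta> a b. (\<i> * plane_wave (general_momentum \<kappa> \<kappa>t) x * sym_part p \<epsilon> \<alpha> \<beta> a b) *s T)"
proof -
  have tr: "(\<Sum>a\<in>UNIV. \<Sum>b\<in>UNIV. eps_dotted a b * sym_part p \<epsilon> \<alpha> \<beta> a b) = 0" for \<alpha> \<beta>
  proof -
    have "(\<Sum>a\<in>UNIV. \<Sum>b\<in>UNIV. eps_dotted a b * sym_part p \<epsilon> \<alpha> \<beta> a b) =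
      2 * (\<Sum>c\<in>UNIV. \<Sum>d\<in>UNIV. sym_kappa_eps (\<kappa> c) (e d) \<alpha> \<beta> * (\<Sum>a\<in>UNIV. \<Sum>b\<in>UNIV. eps_dotted a b * wedge (\<kappa>t c) (\<kappa>t d) a b))"
      unfolding p_def \<epsilon>_def sym_part_general
      by (simp add: sum_UNIV_2 distrib_left sum.distrib sum_distrib_left mult_ac)
    then show ?thesis by (simp add: trace_wedge square_bracket_zero_all[OF sb])
  qed
  let ?c = "\<i> * plane_wave (general_momentum \<kappa> \<kappa>t) x"
  have trace: "(\<Sum>a\<in>UNIV. \<Sum>b\<in>UNIV. eps_dotted a b *s ((?c * sym_part p \<epsilon> \<alpha> \<beta> a b) *s T)) = 0" for \<alpha> \<beta>
  proof -
    have "(\<Sum>a\<in>UNIV. \<Sum>b\<in>UNIV. eps_dotted a b *s ((?c * sym_part p \<epsilon> \<alpha> \<beta> a b) *s T)) $ g = 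
       (?c * T $ g) * (\<Sum>a\<in>UNIV. \<Sum>b\<in>UNIV. eps_dotted a b * sym_part p \<epsilon> \<alpha> \<beta> a b)" for g
      by (simp add: sum_distrib_left mult_ac)
    then show ?thesis by (simp add: tr vec_eq_iff)
  qed
  have wf: "wedge_form p \<epsilon> (\<alpha>, a) (\<beta>, b) = eps_undotted \<alpha> \<beta> * (wedge_form p \<epsilon> (0, a) (1, b) - sym_part p \<epsilon> 0 1 a b) + sym_part p \<epsilon> \<alpha> \<beta> a b" for \<alpha> \<beta> a b
    using exhaust_undotted[of \<alpha>] exhaust_undotted[of \<beta>]
    by (auto simp: eps_undotted_def sym_part_def field_simps)
  have F: "(?c * wedge_form p \<epsilon> (\<alpha>, a) (\<beta>, b)) *s T = eps_undotted \<alpha> \<beta> *s ((?c * (wedge_form p \<epsilon> (0, a) (1, b) - sym_part p \<epsilon> 0 1 a b)) *s T)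
     + (?c * sym_part p \<epsilon> \<alpha> \<beta> a b) *s T" for \<alpha> \<beta> a b
    by (subst wf) (simp add: vec_eq_iff algebra_simps)
  have sym: "sym_part p \<epsilon> \<alpha> \<beta> a b = sym_part p \<epsilon> \<beta> \<alpha> a b" and anti: "sym_part p \<epsilon> \<alpha> \<beta> a b = - sym_part p \<epsilon> \<alpha> \<beta> b a" for \<alpha> \<beta> a b
    by (simp_all add: sym_part_def wedge_form_def field_simps)
  have tilde: "wedge_form p \<epsilon> (0, a) (1, b) - sym_part p \<epsilon> 0 1 a b = wedge_form p \<epsilon> (0, b) (1, a) - sym_part p \<epsilon> 0 1 b a" for a b
    by (simp add: sym_part_def wedge_form_def field_simps)
  show ?thesis
    unfolding field_strength_decomposition_def field_strength_gluon p_def[symmetric]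
  proof (intro conjI allI)
    fix \<alpha> \<beta> a b
    show "(?c * wedge_form p \<epsilon> (\<alpha>, a) (\<beta>, b)) *s T = eps_undotted \<alpha> \<beta> *s ((?c * (wedge_form p \<epsilon> (0, a) (1, b) - sym_part p \<epsilon> 0 1 a b)) *s T)
       + eps_dotted a b *s 0 + (?c * sym_part p \<epsilon> \<alpha> \<beta> a b) *s T"
      unfolding F[of \<alpha> a \<beta> b] by simp
    show "(?c * sym_part p \<epsilon> \<alpha> \<beta> a b) *s T = (?c * sym_part p \<epsilon> \<beta> \<alpha> a b) *s T"
      by (subst sym) (rule refl)
    show "(?c * sym_part p \<epsilon> \<alpha> \<beta> a b) *s T = - ((?c * sym_part p \<epsilon> \<alpha> \<beta> b a) *s T)"
      unfolding anti[of \<alpha> \<beta> a b] by (simp add: vec_eq_iff)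
    show "(?c * (wedge_form p \<epsilon> (0, a) (1, b) - sym_part p \<epsilon> 0 1 a b)) *s T = (?c * (wedge_form p \<epsilon> (0, b) (1, a) - sym_part p \<epsilon> 0 1 b a)) *s T"
      by (subst tilde) (rule refl)
  qed (simp_all only: trace)
qed

lemma self_dual_nontrivial:
  assumes "self_dual p q" "wedge_form p q A B \<noteq> 0"
  shows "\<exists>u v e. p = spinor_product u v \<and> q = spinor_product e v"
proof -
  have "p \<noteq> 0" using assms(2) by (auto simp: wedge_form_def)
  have "simple_momentum p"
  proof (rule ccontr)
    assume "\<not> simple_momentum p"
    then obtain c where "q = c *s p" using self_dual_not_simple[OF assms(1)] by blast
    then show False using assms(2) by (simp add: wedge_form_def)
  qed
  then obtain u v where "p = spinor_product u v" unfolding simple_momentum_def by blast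
  with self_dual_simple[of u v q] assms(1) \<open>p \<noteq> 0\<close> show ?thesis by blast
qed

lemma proportional_if_minors_zero:
  assumes "\<And>i j. u $ i * v $ j = u $ j * v $ i"
  shows "proportional u v"
proof (cases "v = 0")
  case True
  then have "v = 0 *s u" by simp
  then show ?thesis unfolding proportional_def by blast
next
  case False
  then obtain j where j: "v $ j \<noteq> 0" by (auto simp: vec_eq_iff)
  have "u = (u $ j / v $ j) *s v"
    using assms[of _ j] j by (simp add: vec_eq_iff field_simps)
  then show ?thesis unfolding proportional_def by blast
qed

text \<open>By Cauchy-Binet the minors of k are, up to sign, the minors of \<kappa>t times
  \<open>angle_bracket (\<kappa> 1) (\<kappa> 2)\<close>, which can be cancelled.\<close>

lemma simple_general_momentum:
  assumes s: "simple_momentum (general_momentum \<kappa> \<kappa>t)" and nz: "angle_bracket (\<kappa> 1) (\<kappa> 2) \<noteq> 0"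
  shows "wedge (\<kappa>t a) (\<kappa>t b) \<alpha>' \<beta>' = 0" "proportional (\<kappa>t 1) (\<kappa>t 2)"
proof -
  have m: "\<kappa>t 1 $ i * \<kappa>t 0 $ j = \<kappa>t 1 $ j * \<kappa>t 0 $ i" for i j
  proof -
    have "angle_bracket (\<kappa> 1) (\<kappa> 0) * (\<kappa>t 1 $ i * \<kappa>t 0 $ j - \<kappa>t 1 $ j * \<kappa>t 0 $ i) = 0"
      using s[unfolded simple_momentum_iff, rule_format, of i j]
      by (simp add: general_momentum_def sum_UNIV_2 angle_bracket_eq algebra_simps)
    then show ?thesis using nz by (simp add: two_eq_0)
  qed
  show "proportional (\<kappa>t 1) (\<kappa>t 2)"
    unfolding two_eq_0 by (rule proportional_if_minors_zero) (rule m)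
  have "wedge (\<kappa>t 1) (\<kappa>t 0) i j = 0" "wedge (\<kappa>t 0) (\<kappa>t 1) i j = 0" for i j
    using m[of "bar_dotted i" "bar_dotted j"] by (simp_all add: wedge_def lower_dotted_nth mult.commute)
  then show "wedge (\<kappa>t a) (\<kappa>t b) \<alpha>' \<beta>' = 0"
    using exhaust_undotted[of a] exhaust_undotted[of b] by (auto simp: wedge_def)
qed

lemma simple_form:
  fixes k :: "'m::finite vec4m"
  assumes "self_dual (lower_vec k) \<epsilon>" "wedge_form (lower_vec k) \<epsilon> A B \<noteq> 0"
  shows "\<exists>\<kappa> \<kappa>t \<iota>. angle_bracket \<kappa> \<iota> \<noteq> 0 \<and> k = spinor_product \<kappa> \<kappa>t \<and>
            \<epsilon> = simple_polarization \<kappa> \<kappa>t \<iota>"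
proof -
  obtain u v e where uv: "lower_vec k = spinor_product u v" and e: "\<epsilon> = spinor_product e v"
    using self_dual_nontrivial[OF assms] by blast
  have "(u $ fst A * e $ fst B - u $ fst B * e $ fst A) \<noteq> 0"
    using assms(2) by (simp add: uv e wedge_form_spinor_product)
  then have d: "u $ 1 * e $ 0 - u $ 0 * e $ 1 \<noteq> 0"
    using exhaust_undotted[of "fst A"] exhaust_undotted[of "fst B"] by (auto simp: algebra_simps)
  define d where "d = u $ 1 * e $ 0 - u $ 0 * e $ 1"
  \<comment> \<open>Scaling \<kappa> by s and \<kappa>t by 1/s keeps k and divides the normalized
    polarization by s squared; this s makes it exactly \<epsilon>.\<close>
  define s where "s = csqrt (inverse d)"
  have s: "s * s = inverse d" "s \<noteq> 0" "d \<noteq> 0"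
    using d by (auto simp: s_def d_def power2_csqrt simp flip: power2_eq_square)
  define \<kappa> where "\<kappa> = s *s lower_undotted u"
  define \<kappa>t where "\<kappa>t = inverse s *s lower_dotted v"
  \<comment> \<open>Lowering \<iota> gives - e and lowering \<kappa>t gives - v / s, so the two
    signs cancel.\<close>
  define \<iota> where "\<iota> = lower_undotted e"
  have ang: "angle_bracket \<kappa> \<iota> = s * d"
    by (simp add: \<kappa>_def \<iota>_def angle_bracket_eq d_def algebra_simps)
  have "k = lower_vec (spinor_product u v)" using uv by (metis lower_vec_lower_vec)
  then have "k = spinor_product \<kappa> \<kappa>t"
    using s by (simp add: lower_vec_spinor_product vec_index_eq_iff \<kappa>_def \<kappa>t_def)
  moreover have "\<epsilon> = simple_polarization \<kappa> \<kappa>t \<iota>"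
  proof -
    have low: "lower_dotted \<kappa>t = - (inverse s *s v)"
      by (simp add: \<kappa>t_def vec_eq_iff lower_dotted_nth)
    have "e $ \<alpha> * v $ a = - e $ \<alpha> * (- inverse s * v $ a) / (s * d)" for \<alpha> a
    proof -
      have "- e $ \<alpha> * (- inverse s * v $ a) / (s * d) = e $ \<alpha> * v $ a / (s * s * d)"
        using s(2) by (simp add: divide_simps)
      then show ?thesis using s by simp
    qed
    then show ?thesis
      by (simp add: vec_index_eq_iff e simple_polarization_def ang low) (simp add: \<iota>_def)
  qed
  moreover have "angle_bracket \<kappa> \<iota> \<noteq> 0" using ang s by simp
  ultimately show ?thesis by blast
qed

section \<open>Gauge shifts as changes of the spinor \<iota>\<close>

lemma angle_bracket_zero_proportional:
  assumes "angle_bracket \<kappa> s = 0" "\<kappa> \<noteq> 0"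
  shows "\<exists>c. s = c *s \<kappa>"
proof -
  obtain \<alpha> where \<alpha>: "\<kappa> $ \<alpha> \<noteq> 0" using assms(2) by (auto simp: vec_eq_iff)
  have "\<kappa> $ \<alpha> * s $ \<beta> = \<kappa> $ \<beta> * s $ \<alpha>" for \<beta>
    using assms(1) exhaust_undotted[of \<alpha>] exhaust_undotted[of \<beta>] by (auto simp: angle_bracket_eq)
  then have "s = (s $ \<alpha> / \<kappa> $ \<alpha>) *s \<kappa>"
    using \<alpha> by (simp add: vec_eq_iff field_simps)
  then show ?thesis by blast
qed

text \<open>Adding a multiple of \<kappa> to \<iota> preserves
  \<open>angle_bracket \<kappa> \<iota>\<close> and shifts the polarization along k. Conversely, two
  spinors normalized to bracket 1 with \<kappa> differ by one of bracket 0, hence by a multiple of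
  \<kappa>.\<close>

lemma simple_polarization_shift_iff:
  assumes "angle_bracket \<kappa> \<iota> \<noteq> 0"
  shows "(\<exists>c. \<epsilon>' = simple_polarization \<kappa> \<kappa>t \<iota> + c *s lower_vec (spinor_product \<kappa> \<kappa>t)) \<longleftrightarrow>
    (\<exists>\<iota>'. angle_bracket \<kappa> \<iota>' \<noteq> 0 \<and> \<epsilon>' = simple_polarization \<kappa> \<kappa>t \<iota>')"
proof
  assume "\<exists>c. \<epsilon>' = simple_polarization \<kappa> \<kappa>t \<iota> + c *s lower_vec (spinor_product \<kappa> \<kappa>t)"
  then obtain c where c: "\<epsilon>' = simple_polarization \<kappa> \<kappa>t \<iota> + c *s lower_vec (spinor_product \<kappa> \<kappa>t)" by blast
  define \<iota>' where "\<iota>' = \<iota> + (c * angle_bracket \<kappa> \<iota>) *s \<kappa>"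
  have a: "angle_bracket \<kappa> \<iota>' = angle_bracket \<kappa> \<iota>"
    by (simp add: \<iota>'_def angle_bracket_eq algebra_simps)
  have "\<epsilon>' = simple_polarization \<kappa> \<kappa>t \<iota>'"
    using assms unfolding c
    by (simp add: vec_index_eq_iff simple_polarization_def lower_vec_spinor_product a)
       (simp add: \<iota>'_def field_simps)
  then show "\<exists>\<iota>'. angle_bracket \<kappa> \<iota>' \<noteq> 0 \<and> \<epsilon>' = simple_polarization \<kappa> \<kappa>t \<iota>'" using a assms by metis
next
  assume "\<exists>\<iota>'. angle_bracket \<kappa> \<iota>' \<noteq> 0 \<and> \<epsilon>' = simple_polarization \<kappa> \<kappa>t \<iota>'"
  then obtain \<iota>' where \<iota>': "angle_bracket \<kappa> \<iota>' \<noteq> 0" "\<epsilon>' = simple_polarization \<kappa> \<kappa>t \<iota>'" by blast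
  define s where "s = inverse (angle_bracket \<kappa> \<iota>') *s \<iota>' - inverse (angle_bracket \<kappa> \<iota>) *s \<iota>"
  have "angle_bracket \<kappa> s = inverse (angle_bracket \<kappa> \<iota>') * angle_bracket \<kappa> \<iota>' - inverse (angle_bracket \<kappa> \<iota>) * angle_bracket \<kappa> \<iota>"
    unfolding s_def by (simp add: angle_bracket_eq algebra_simps)
  then have "angle_bracket \<kappa> s = 0" using assms \<iota>'(1) by simp
  moreover have "\<kappa> \<noteq> 0" using assms by (auto simp: angle_bracket_eq)
  ultimately obtain c where c: "s = c *s \<kappa>" using angle_bracket_zero_proportional by blast
  have i: "\<iota>' $ \<alpha> / angle_bracket \<kappa> \<iota>' = \<iota> $ \<alpha> / angle_bracket \<kappa> \<iota> + c * \<kappa> $ \<alpha>" for \<alpha>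
    using arg_cong[OF c, of "\<lambda>v. v $ \<alpha>"] by (simp add: s_def divide_inverse algebra_simps)
  have "lower_undotted \<iota>' $ \<alpha> / angle_bracket \<kappa> \<iota>' = lower_undotted \<iota> $ \<alpha> / angle_bracket \<kappa> \<iota> + c * lower_undotted \<kappa> $ \<alpha>" for \<alpha>
    using i[of 0] i[of 1] exhaust_undotted[of \<alpha>] by (auto simp: algebra_simps)
  then have "lower_undotted \<iota>' $ \<alpha> * x / angle_bracket \<kappa> \<iota>' = lower_undotted \<iota> $ \<alpha> * x / angle_bracket \<kappa> \<iota> + c * (lower_undotted \<kappa> $ \<alpha> * x)" for \<alpha> x
    by (metis (no_types, lifting) distrib_right mult.assoc times_divide_eq_left)
  then have "\<epsilon>' = simple_polarization \<kappa> \<kappa>t \<iota> + c *s lower_vec (spinor_product \<kappa> \<kappa>t)"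
    unfolding \<iota>'(2) lower_vec_spinor_product vec_eq_iff split_paired_All by (simp add: simple_polarization_def)
  then show "\<exists>c. \<epsilon>' = simple_polarization \<kappa> \<kappa>t \<iota> + c *s lower_vec (spinor_product \<kappa> \<kappa>t)" by blast
qed

lemma gluon_gauge_iff:
  assumes "T \<noteq> 0"
  shows "gluon T \<epsilon>' k = gauge_transform (\<lambda>x. (c * plane_wave k x) *s T) (gluon T \<epsilon> k) \<longleftrightarrow>
    \<epsilon>' = \<epsilon> + (\<i> * c) *s lower_vec k"
proof -
  obtain g where g: "T $ g \<noteq> 0" using assms by (auto simp: vec_eq_iff)
  have p: "partial A (\<lambda>y. ((c * plane_wave k y) *s T) $ g) x = \<i> * lower_vec k $ A * (c * T $ g) * plane_wave k x" for A g x
    using plane_wave_deriv[of A "c * T $ g" k x] by (simp add: mult_ac)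
  have gt: "gauge_transform (\<lambda>x. (c * plane_wave k x) *s T) (gluon T \<epsilon> k) = gluon T (\<epsilon> + (\<i> * c) *s lower_vec k) k"
    by (intro ext) (simp only: gauge_transform_def gluon_def p, simp add: vec_eq_iff algebra_simps)
  have "\<epsilon>' = \<epsilon>''" if eq: "gluon T \<epsilon>' k = gluon T \<epsilon>'' k" for \<epsilon>''
  proof -
    have "gluon T \<epsilon>' k 0 A $ g = gluon T \<epsilon>'' k 0 A $ g" for A using eq by simp
    then show ?thesis using g by (simp add: gluon_def vec_eq_iff)
  qed
  then show ?thesis unfolding gt by blast
qed

lemma gluon_residual_gauge:
  assumes T: "T \<noteq> 0" and nz: "angle_bracket \<kappa> \<iota> \<noteq> 0"
    and k: "k = spinor_product \<kappa> \<kappa>t" and \<epsilon>: "\<epsilon> = simple_polarization \<kappa> \<kappa>t \<iota>"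
  shows "(on_shell k \<epsilon>' \<and>
             (\<exists>c. gluon T \<epsilon>' k = gauge_transform (\<lambda>x. (c * plane_wave k x) *s T) (gluon T \<epsilon> k))) \<longleftrightarrow>
          (\<exists>\<iota>'. angle_bracket \<kappa> \<iota>' \<noteq> 0 \<and> \<epsilon>' = simple_polarization \<kappa> \<kappa>t \<iota>')"
proof -
  have "(\<exists>c. \<epsilon>' = \<epsilon> + (\<i> * c) *s lower_vec k) \<longleftrightarrow> (\<exists>c. \<epsilon>' = \<epsilon> + c *s lower_vec k)"
  proof
    assume "\<exists>c. \<epsilon>' = \<epsilon> + c *s lower_vec k"
    then obtain c where "\<epsilon>' = \<epsilon> + c *s lower_vec k" by blast
    then have "\<epsilon>' = \<epsilon> + (\<i> * (- \<i> * c)) *s lower_vec k" by (simp flip: mult.assoc)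
    then show "\<exists>c. \<epsilon>' = \<epsilon> + (\<i> * c) *s lower_vec k" by blast
  qed blast
  then show ?thesis
    unfolding gluon_gauge_iff[OF T] using simple_polarization_shift_iff[OF nz, of \<epsilon>' \<kappa>t, folded k \<epsilon>]
      on_shell_simple_polarization[of \<kappa> \<kappa>t, folded k] by auto
qed

lemma graviton_diffeo_iff:
  "graviton \<epsilon>' k = diffeo_transform (\<lambda>x A. v $ A * plane_wave k x) (graviton \<epsilon> k) \<longleftrightarrow>
    (\<forall>A B. \<epsilon>' $ A * \<epsilon>' $ B = \<epsilon> $ A * \<epsilon> $ B + \<i> * lower_vec k $ A * v $ B + \<i> * lower_vec k $ B * v $ A)"
proof -
  have "graviton \<epsilon>' k x A B = diffeo_transform (\<lambda>x A. v $ A * plane_wave k x) (graviton \<epsilon> k) x A B \<longleftrightarrow>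
    \<epsilon>' $ A * \<epsilon>' $ B * plane_wave k x = (\<epsilon> $ A * \<epsilon> $ B + \<i> * lower_vec k $ A * v $ B + \<i> * lower_vec k $ B * v $ A) * plane_wave k x" for x A B
    by (simp only: graviton_def diffeo_transform_def plane_wave_deriv) (simp add: algebra_simps)
  then show ?thesis unfolding fun_eq_iff by simp
qed

lemma graviton_eq_iff: "graviton \<epsilon>' k = graviton \<epsilon> k \<longleftrightarrow> (\<forall>A B. \<epsilon>' $ A * \<epsilon>' $ B = \<epsilon> $ A * \<epsilon> $ B)"
  by (simp add: graviton_def fun_eq_iff)

text \<open>The field sees only the tensor square of \<epsilon>', so \<epsilon>' is fixed up to
  sign; this is why the right-hand side compares gravitons and not polarizations.\<close>

lemma graviton_residual_gauge:
  fixes \<kappa> \<iota> :: "complex ^ 2" and \<kappa>t :: "complex ^ ('m::finite + 'm)"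
  assumes nz: "angle_bracket \<kappa> \<iota> \<noteq> 0"
  defines "k \<equiv> spinor_product \<kappa> \<kappa>t" and "\<epsilon> \<equiv> simple_polarization \<kappa> \<kappa>t \<iota>"
  shows "((on_shell k \<epsilon>' \<and>
             (\<exists>v. graviton \<epsilon>' k = diffeo_transform (\<lambda>x A. v $ A * plane_wave k x) (graviton \<epsilon> k))) \<longleftrightarrow>
          (\<exists>\<iota>'. angle_bracket \<kappa> \<iota>' \<noteq> 0 \<and> graviton \<epsilon>' k = graviton (simple_polarization \<kappa> \<kappa>t \<iota>') k))"
    (is "?L \<longleftrightarrow> ?R")
proof
  assume ?L
  then obtain v where v: "\<And>A B. \<epsilon>' $ A * \<epsilon>' $ B = \<epsilon> $ A * \<epsilon> $ B + \<i> * lower_vec k $ A * v $ B + \<i> * lower_vec k $ B * v $ A"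
    unfolding graviton_diffeo_iff by blast
  have "\<exists>c. \<forall>A B. \<epsilon>' $ A * \<epsilon>' $ B = (\<epsilon> + c *s lower_vec k) $ A * (\<epsilon> + c *s lower_vec k) $ B"
  proof (cases "\<kappa>t = 0")
    case True
    then have "k = 0" by (simp add: k_def vec_eq_iff)
    then have "lower_vec k $ A = 0" for A by (simp add: lower_vec_def)
    then show ?thesis using v by simp
  next
    case False
    then obtain j where "\<kappa>t $ j \<noteq> 0" by (auto simp: vec_eq_iff)
    define b where "b = bar_dotted j"
    have b: "lower_dotted \<kappa>t $ b \<noteq> 0"
      using \<open>\<kappa>t $ j \<noteq> 0\<close> by (cases j) (auto simp: b_def lower_dotted_nth)
    let ?l = "lower_dotted \<kappa>t $ b"
    \<comment> \<open>the vector \<open>x\<close> with \<open>x\<^sup>\<alpha>\<^sup>b = \<kappa>\<^sup>\<alpha> / \<kappa>~\<^sub>b\<close> is dual to \<open>\<epsilon>\<close> and annihilates \<open>k\<close>\<close>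
    define x where "x \<alpha> = \<kappa> $ \<alpha> / ?l" for \<alpha>
    define ct where "ct w = x 0 * w $ (0, b) + x 1 * w $ (1, b)" for w :: "'m vec4m"
    have xk: "ct (lower_vec k) = 0"
      by (simp add: ct_def x_def k_def lower_vec_spinor_product field_simps)
    have xe: "ct \<epsilon> = 1"
    proof -
      have "ct \<epsilon> = (\<kappa> $ 0 * lower_undotted \<iota> $ 0 + \<kappa> $ 1 * lower_undotted \<iota> $ 1) / angle_bracket \<kappa> \<iota>"
        using b nz unfolding ct_def x_def \<epsilon>_def simple_polarization_def by (simp add: divide_simps)
      also have "\<dots> = 1" using nz by (simp add: angle_bracket_eq)
      finally show ?thesis .
    qed
    \<comment> \<open>Contracting the first index with x removes the term in \<open>v $ B\<close>,
      leaving \<epsilon> plus a multiple of k.\<close>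
    have c: "ct \<epsilon>' * \<epsilon>' $ B = \<epsilon> $ B + \<i> * ct v * lower_vec k $ B" for B
    proof -
      have "ct \<epsilon>' * \<epsilon>' $ B = ct \<epsilon> * \<epsilon> $ B + \<i> * ct (lower_vec k) * v $ B + \<i> * lower_vec k $ B * ct v"
        using v[of "(0, b)" B] v[of "(1, b)" B] unfolding ct_def by algebra
      then show ?thesis by (simp add: xk xe)
    qed
    \<comment> \<open>Contracting the second index too shows that \<open>ct \<epsilon>'\<close> is a
      sign, which drops out of the tensor square.\<close>
    have "ct \<epsilon>' * ct \<epsilon>' = ct \<epsilon> + \<i> * ct v * ct (lower_vec k)"
      using c[of "(0, b)"] c[of "(1, b)"] unfolding ct_def[of \<epsilon>] ct_def[of "lower_vec k"] ct_def[of \<epsilon>'] by algebra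
    then have "ct \<epsilon>' * ct \<epsilon>' = 1" by (simp add: xk xe)
    then have "\<epsilon>' $ A * \<epsilon>' $ B = (ct \<epsilon>' * \<epsilon>' $ A) * (ct \<epsilon>' * \<epsilon>' $ B)" for A B
      by algebra
    then have "\<epsilon>' $ A * \<epsilon>' $ B = (\<epsilon> + (\<i> * ct v) *s lower_vec k) $ A * (\<epsilon> + (\<i> * ct v) *s lower_vec k) $ B" for A B
      unfolding c by (simp add: mult_ac)
    then show ?thesis by blast
  qed
  then obtain c where c: "graviton \<epsilon>' k = graviton (\<epsilon> + c *s lower_vec k) k"
    unfolding graviton_eq_iff by blast
  obtain \<iota>' where "angle_bracket \<kappa> \<iota>' \<noteq> 0" "\<epsilon> + c *s lower_vec k = simple_polarization \<kappa> \<kappa>t \<iota>'"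
    using simple_polarization_shift_iff[OF nz, of "\<epsilon> + c *s lower_vec k" \<kappa>t] unfolding k_def \<epsilon>_def by blast
  then show ?R using c by metis
next
  assume ?R
  then obtain \<iota>' where \<iota>': "angle_bracket \<kappa> \<iota>' \<noteq> 0" and g: "graviton \<epsilon>' k = graviton (simple_polarization \<kappa> \<kappa>t \<iota>') k"
    by blast
  let ?\<epsilon> = "simple_polarization \<kappa> \<kappa>t \<iota>'"
  have sq: "\<epsilon>' $ A * \<epsilon>' $ B = ?\<epsilon> $ A * ?\<epsilon> $ B" for A B using g unfolding graviton_eq_iff by blast
  obtain c where c: "?\<epsilon> = \<epsilon> + c *s lower_vec k"
    using simple_polarization_shift_iff[OF nz, of ?\<epsilon> \<kappa>t] \<iota>' unfolding k_def \<epsilon>_def by blast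
  \<comment> \<open>Equal tensor squares leave only a sign, under which \<open>on_shell\<close> is
    invariant.\<close>
  have "\<epsilon>' = ?\<epsilon> \<or> \<epsilon>' = (-1) *s ?\<epsilon>"
  proof (cases "\<epsilon>' = 0")
    case True
    then have "?\<epsilon> $ A = 0" for A using sq[of A A] by simp
    then show ?thesis using True by (simp add: vec_eq_iff)
  next
    case False
    then obtain A where A: "\<epsilon>' $ A \<noteq> 0" by (auto simp: vec_eq_iff)
    have "(\<epsilon>' $ A - ?\<epsilon> $ A) * (\<epsilon>' $ A + ?\<epsilon> $ A) = 0" using sq[of A A] by algebra
    then consider "?\<epsilon> $ A = \<epsilon>' $ A" | "?\<epsilon> $ A = - \<epsilon>' $ A" by (auto simp: add_eq_0_iff)
    then show ?thesis
    proof cases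
      case 1
      then have "\<epsilon>' $ A * \<epsilon>' $ B = \<epsilon>' $ A * ?\<epsilon> $ B" for B using sq[of A B] by simp
      then show ?thesis using A by (simp add: vec_eq_iff)
    next
      case 2
      then have "\<epsilon>' $ A * \<epsilon>' $ B = \<epsilon>' $ A * ((-1) *s ?\<epsilon>) $ B" for B using sq[of A B] by simp
      then have "\<epsilon>' $ B = ((-1) *s ?\<epsilon>) $ B" for B using A by (metis mult_left_cancel)
      then show ?thesis by (simp only: vec_eq_iff) blast
    qed
  qed
  moreover have "on_shell k ?\<epsilon>" unfolding k_def by (rule on_shell_simple_polarization)
  moreover have "on_shell k ((-1) *s ?\<epsilon>)" if "on_shell k ?\<epsilon>"
    using that by (simp only: on_shell_def raise_vec_eq_lower_vec lower_vec_lin pairing_lin) simp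
  ultimately have "on_shell k \<epsilon>'" by metis
  \<comment> \<open>In w each of the two symmetrized summands carries half of the term quadratic in
    c, hence the 1/2; the factors \<open>- \<i>\<close> undo the \<open>\<i>\<close> of the
    derivative.\<close>
  moreover have "\<epsilon>' $ A * \<epsilon>' $ B = \<epsilon> $ A * \<epsilon> $ B + \<i> * lower_vec k $ A * w $ B + \<i> * lower_vec k $ B * w $ A"
    if "w = (- \<i> * c) *s \<epsilon> + (- \<i> * c * c / 2) *s lower_vec k" for w A B
    unfolding sq unfolding c that by (simp add: field_simps)
  ultimately show ?L unfolding graviton_diffeo_iff by blast
qed

section \<open>Counting polarizations\<close>

text \<open>A hyperplane: one vector a whose pairing with k is 1 completes it to the whole space, of
  dimension 2 * 2m.\<close>

lemma dim_pairing_kernel: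
  fixes k :: "'m::finite vec4m"
  assumes "k \<noteq> 0"
  shows "vec.subspace {\<epsilon>. pairing k \<epsilon> = 0}" "vec.dim {\<epsilon>. pairing k \<epsilon> = 0} = 4 * CARD('m) - 1"
proof -
  let ?W = "{\<epsilon>. pairing k \<epsilon> = 0}"
  show W: "vec.subspace ?W"
    unfolding vec.subspace_def by (auto simp: pairing_lin) (simp add: pairing_def)
  obtain A where A: "k $ A \<noteq> 0" using assms by (auto simp: vec_eq_iff)
  define a where "a = (inverse (k $ A)) *s (axis A 1 :: 'm vec4m)"
  have a: "pairing k a = 1"
  proof -
    have "pairing k (axis A 1) = (\<Sum>B\<in>UNIV. if B = A then k $ B else 0)"
      unfolding pairing_def axis_def by (intro sum.cong) auto
    then show ?thesis using A by (simp add: a_def pairing_lin)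
  qed
  then have "a \<notin> vec.span ?W" using W by (simp add: vec.span_eq_iff[THEN iffD2])
  then have "vec.dim (insert a ?W) = vec.dim ?W + 1" by (simp add: vec.dim_insert)
  moreover have "vec.span (insert a ?W) = UNIV"
  proof -
    have "w \<in> vec.span (insert a ?W)" for w
    proof -
      have "pairing k (w + (- pairing k w) *s a) = 0"
        unfolding pairing_lin a by simp
      then have "w + (- pairing k w) *s a \<in> vec.span (insert a ?W)"
        by (intro vec.span_base) simp
      moreover have "pairing k w *s a \<in> vec.span (insert a ?W)"
        by (intro vec.span_scale vec.span_base) simp
      ultimately have "w + (- pairing k w) *s a + pairing k w *s a \<in> vec.span (insert a ?W)"
        by (rule vec.span_add)
      moreover have "w + (- pairing k w) *s a + pairing k w *s a = w"
        by (simp add: vec_eq_iff)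
      ultimately show ?thesis by simp
    qed
    then show ?thesis by blast
  qed
  then have "vec.dim (insert a ?W) = CARD(2 \<times> ('m + 'm))"
    by (metis vec.dim_span vec_dim_card)
  ultimately show "vec.dim ?W = 4 * CARD('m) - 1" by simp
qed

lemma lower_vec_zero_iff [simp]: "lower_vec k = 0 \<longleftrightarrow> k = 0"
proof
  assume "lower_vec k = 0"
  then have "lower_vec (lower_vec k) = 0" by (simp add: lower_vec_def vec_eq_iff)
  then show "k = 0" by simp
qed (simp add: lower_vec_def vec_eq_iff)

text \<open>Transversality is a consequence of the curvature condition, so in
  \<open>polarization_count\<close> the set H is the full solution space, whose dimension the
  classification gives.\<close>

lemma pairing_lower_self_dual:
  fixes k :: "'m::finite vec4m"
  assumes "null_momentum k" "k \<noteq> 0" "self_dual (lower_vec k) \<epsilon>"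
  shows "pairing k \<epsilon> = 0"
proof (cases "simple_momentum (lower_vec k)")
  case False
  then obtain c where "\<epsilon> = c *s lower_vec k" using self_dual_not_simple assms(3) by blast
  then show ?thesis using assms(1) by (simp add: pairing_lin null_momentum_def)
next
  case True
  then obtain u v where uv: "lower_vec k = spinor_product u v" unfolding simple_momentum_def by blast
  then have k: "k = spinor_product (lower_undotted u) (lower_dotted v)" 
    by (metis lower_vec_lower_vec lower_vec_spinor_product)
  have "lower_vec k \<noteq> 0" using assms(2) by simp
  then obtain e where e: "\<epsilon> = spinor_product e v" using self_dual_simple assms(3) uv by metis
  \<comment> \<open>Writes v as a lowered spinor, so that the pairing becomes a bracket; its two
    arguments are parallel and it vanishes.\<close>
  have "v = lower_dotted (- lower_dotted v)" by (simp add: vec_eq_iff lower_dotted_nth)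
  then show ?thesis using pairing_spinor_product[of "lower_undotted u" "lower_dotted v" e "- lower_dotted v"]
    square_bracket_anti[of "lower_dotted v" "- lower_dotted v"]
    unfolding k e by simp
qed

lemma self_dual_set_simple:
  assumes "spinor_product u v \<noteq> 0"
  shows "{\<epsilon>. self_dual (spinor_product u v) \<epsilon>} = range (\<lambda>e. spinor_product e v)"
  using self_dual_simple[OF _ assms] self_dual_spinor_product by blast

lemma self_dual_set_not_simple:
  assumes "\<not> simple_momentum p"
  shows "{\<epsilon>. self_dual p \<epsilon>} = vec.span {p}"
  using self_dual_not_simple[OF _ assms] self_dual_scale by (auto simp: vec.span_singleton)

lemma subspace_self_dual: "vec.subspace {\<epsilon>. self_dual p \<epsilon>}"
proof -
  have add: "sym_part p (x + y) \<alpha> \<beta> a b = sym_part p x \<alpha> \<beta> a b + sym_part p y \<alpha> \<beta> a b" for x y \<alpha> \<beta> a b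
    by (simp add: sym_part_def wedge_form_def field_simps)
  have scale: "sym_part p (c *s x) \<alpha> \<beta> a b = c * sym_part p x \<alpha> \<beta> a b" for c x \<alpha> \<beta> a b
    by (simp add: sym_part_def wedge_form_def field_simps)
  have zero: "sym_part p 0 \<alpha> \<beta> a b = 0" for \<alpha> \<beta> a b
    by (simp add: sym_part_def wedge_form_def)
  show ?thesis
    unfolding vec.subspace_def by (simp add: self_dual_def add scale zero)
qed

lemma dim_spinor_product_range:
  assumes "v \<noteq> 0"
  shows "vec.dim (range (\<lambda>e. spinor_product e v)) = 2"
proof -
  obtain j where j: "v $ j \<noteq> 0" using assms by (auto simp: vec_eq_iff)
  define b where "b \<alpha> = spinor_product (axis \<alpha> 1) v" for \<alpha>
  have b: "b \<alpha> $ (\<beta>, a) = (if \<beta> = \<alpha> then v $ a else 0)" for \<alpha> \<beta> a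
    by (simp add: b_def axis_def)
  have "range (\<lambda>e. spinor_product e v) = vec.span {b 0, b 1}"
  proof
    have "spinor_product e v = e $ 0 *s b 0 + e $ 1 *s b 1" for e
      by (simp add: vec_index_eq_iff b)
    moreover have "e $ 0 *s b 0 + e $ 1 *s b 1 \<in> vec.span {b 0, b 1}" for e :: "complex ^ 2"
      by (intro vec.span_add vec.span_scale vec.span_base) auto
    ultimately show "range (\<lambda>e. spinor_product e v) \<subseteq> vec.span {b 0, b 1}" by auto
    have "vec.subspace (range (\<lambda>e. spinor_product e v))"
    proof (rule vec.subspaceI)
      have "spinor_product 0 v = 0" by (simp add: vec_eq_iff)
      then show "0 \<in> range (\<lambda>e. spinor_product e v)" by (metis rangeI)
      fix x y c
      assume "x \<in> range (\<lambda>e. spinor_product e v)"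
      then obtain d where d: "x = spinor_product d v" by blast
      have "c *s x = spinor_product (c *s d) v" by (simp add: d vec_eq_iff)
      then show "c *s x \<in> range (\<lambda>e. spinor_product e v)" by blast
      assume "y \<in> range (\<lambda>e. spinor_product e v)"
      then obtain e where e: "y = spinor_product e v" by blast
      have "x + y = spinor_product (d + e) v" by (simp add: d e vec_eq_iff algebra_simps)
      then show "x + y \<in> range (\<lambda>e. spinor_product e v)" by blast
    qed
    moreover have "{b 0, b 1} \<subseteq> range (\<lambda>e. spinor_product e v)" by (auto simp: b_def)
    ultimately show "vec.span {b 0, b 1} \<subseteq> range (\<lambda>e. spinor_product e v)"
      by (simp add: vec.span_minimal)
  qed
  moreover have "b 0 \<notin> vec.span {b 1}"
  proof
    assume "b 0 \<in> vec.span {b 1}"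
    then obtain c where "b 0 = c *s b 1" by (auto simp: vec.span_singleton)
    then have "b 0 $ (0, j) = c * b 1 $ (0, j)" by simp
    then show False using j by (simp add: b)
  qed
  moreover have "b 1 \<noteq> 0"
  proof
    assume "b 1 = 0"
    then have "b 1 $ (1, j) = 0" by simp
    then show False using j by (simp add: b)
  qed
  ultimately show ?thesis by (simp add: vec.dim_insert)
qed

text \<open>Before the gauge direction is divided out, W has dimension 4m - 1. H has dimension 2 for
  simple k, from the two components of e, and otherwise is the line through the lowered k.\<close>

lemma polarization_count:
  fixes k :: "'m::finite vec4m" and T :: "complex ^ 'g::finite"
  assumes T: "T \<noteq> 0" and k: "k \<noteq> 0" "null_momentum k"
  shows "let W = {\<epsilon>. pairing k \<epsilon> = 0};
            H = {\<epsilon> \<in> W. hyperholomorphic (gluon T \<epsilon> k)};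
            K = {\<epsilon> \<in> W. hyperkaehler (graviton \<epsilon> k)}
        in vec.subspace W \<and> lower_vec k \<in> W \<and> polarizations_mod_gauge k W = 4 * CARD('m) - 2 \<and>
           vec.subspace H \<and> lower_vec k \<in> H \<and>
           polarizations_mod_gauge k H = (if simple_momentum k then 1 else 0) \<and> K = H"
proof -
  let ?p = "lower_vec k"
  define W where "W = {\<epsilon>. pairing k \<epsilon> = 0}"
  define H where "H = {\<epsilon>. self_dual ?p \<epsilon>}"
  have H: "{\<epsilon> \<in> W. hyperholomorphic (gluon T \<epsilon> k)} = H" "{\<epsilon> \<in> W. hyperkaehler (graviton \<epsilon> k)} = H"
    using pairing_lower_self_dual[OF k(2,1)]
    by (auto simp: W_def H_def hyperholomorphic_gluon_iff[OF T] hyperkaehler_graviton_iff)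
  have "vec.subspace W" "polarizations_mod_gauge k W = 4 * CARD('m) - 2"
    using dim_pairing_kernel[OF k(1)] k(1) by (simp_all add: W_def polarizations_mod_gauge_def)
  moreover have "?p \<in> W" using k(2) by (simp add: W_def null_momentum_def)
  moreover have "?p \<in> H" using self_dual_scale[of ?p 1] by (simp add: H_def)
  moreover have "polarizations_mod_gauge k H = (if simple_momentum k then 1 else 0)"
  proof (cases "simple_momentum k")
    case True
    then obtain u v where uv: "?p = spinor_product u v"
      using simple_momentum_lower_vec[of k] unfolding simple_momentum_def by blast
    then have nz: "spinor_product u v \<noteq> 0" using k(1) by (metis lower_vec_zero_iff)
    then have "v \<noteq> 0" by (auto simp: vec_eq_iff)
    then show ?thesis
      using True k(1) unfolding H_def uv self_dual_set_simple[OF nz] polarizations_mod_gauge_def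
      by (simp add: dim_spinor_product_range nz)
  next
    case False
    then have "\<not> simple_momentum ?p" by (simp add: simple_momentum_lower_vec)
    then show ?thesis using False k(1)
      unfolding H_def self_dual_set_not_simple[OF \<open>\<not> simple_momentum ?p\<close>] polarizations_mod_gauge_def
      by (simp only: vec.dim_span) simp
  qed
  moreover have "vec.subspace H" unfolding H_def by (rule subspace_self_dual)
  ultimately show ?thesis unfolding Let_def W_def[symmetric] H by blast
qed

lemma simple_momentum_null: "simple_momentum k \<Longrightarrow> null_momentum k"
  by (auto simp: simple_momentum_def null_momentum_def lower_vec_spinor_product pairing_spinor_product)

lemma ex_nontrivial_polarization:
  fixes k :: "'m::finite vec4m"
  assumes "simple_momentum k" "k \<noteq> 0"
  shows "\<exists>\<epsilon> A B. on_shell k \<epsilon> \<and> self_dual (lower_vec k) \<epsilon> \<and> wedge_form (lower_vec k) \<epsilon> A B \<noteq> 0"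
proof -
  obtain \<kappa> \<kappa>t where k: "k = spinor_product \<kappa> \<kappa>t" using assms(1) unfolding simple_momentum_def by blast
  let ?u = "lower_undotted \<kappa>" and ?v = "lower_dotted \<kappa>t"
  have p: "lower_vec k = spinor_product ?u ?v" by (simp add: k lower_vec_spinor_product)
  have "spinor_product ?u ?v \<noteq> 0" using assms(2) p by (metis lower_vec_zero_iff)
  then obtain \<alpha> j where nz: "?u $ \<alpha> \<noteq> 0" "?v $ j \<noteq> 0" by (auto simp: vec_eq_iff)
  \<comment> \<open>The other index value: the basis spinor there is independent of the lowered
    \<kappa>, whose \<alpha> component is nonzero.\<close>
  define \<beta> :: 2 where "\<beta> = 1 - \<alpha>"
  have "\<beta> \<noteq> \<alpha>" using exhaust_undotted[of \<alpha>] by (auto simp: \<beta>_def)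
  define e where "e = (axis \<beta> 1 :: complex ^ 2)"
  have "on_shell k (spinor_product e ?v)"
    unfolding k by (simp add: on_shell_def null_momentum_def 
      raise_vec_eq_lower_vec lower_vec_spinor_product pairing_spinor_product)
  moreover have "wedge_form (lower_vec k) (spinor_product e ?v) (\<alpha>, j) (\<beta>, j) \<noteq> 0"
    unfolding p wedge_form_spinor_product using nz \<open>\<beta> \<noteq> \<alpha>\<close> by (simp add: e_def axis_def)
  ultimately show ?thesis using self_dual_spinor_product p by metis
qed

text \<open>The origin is excluded because k = 0 gives no curvature; every other simple momentum
  admits a polarization with curvature.\<close>

lemma momenta_eq:
  fixes T :: "complex ^ 'g::finite"
  assumes T: "T \<noteq> 0"
  shows "hyperholomorphic_momenta T = (simple_momenta - {0} :: 'm::finite vec4m set)"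
    and "hyperkaehler_momenta = (simple_momenta - {0} :: 'm::finite vec4m set)"
proof -
  have "(\<exists>\<epsilon>. on_shell k \<epsilon> \<and> (\<exists>A B. wedge_form (lower_vec k) \<epsilon> A B \<noteq> 0) \<and> self_dual (lower_vec k) \<epsilon>) \<longleftrightarrow>
     simple_momentum k \<and> k \<noteq> 0" for k :: "'m vec4m"
  proof
    assume "\<exists>\<epsilon>. on_shell k \<epsilon> \<and> (\<exists>A B. wedge_form (lower_vec k) \<epsilon> A B \<noteq> 0) \<and> self_dual (lower_vec k) \<epsilon>"
    then obtain \<epsilon> A B where e: "self_dual (lower_vec k) \<epsilon>" "wedge_form (lower_vec k) \<epsilon> A B \<noteq> 0" by blast
    then have "lower_vec k \<noteq> 0" by (auto simp: wedge_form_def simp del: lower_vec_zero_iff)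
    then show "simple_momentum k \<and> k \<noteq> 0"
      using self_dual_nontrivial[OF e] simple_momentum_lower_vec[of k] unfolding simple_momentum_def by auto
  qed (use ex_nontrivial_polarization[of k] in blast)
  then show "hyperholomorphic_momenta T = (simple_momenta - {0} :: 'm vec4m set)"
    and "hyperkaehler_momenta = (simple_momenta - {0} :: 'm vec4m set)"
    by (simp_all add: hyperholomorphic_momenta_def hyperkaehler_momenta_def simple_momenta_def set_eq_iff
        nontrivial_gluon_iff[OF T] nontrivial_graviton_iff hyperholomorphic_gluon_iff[OF T] hyperkaehler_graviton_iff)
qed

lemma general_parametrization:
  fixes \<kappa>t :: "2 \<Rightarrow> complex ^ ('m::finite + 'm)" and T :: "complex ^ 'g::finite"
  assumes T: "T \<noteq> 0" and sb: "square_bracket (\<kappa>t 1) (\<kappa>t 2) = 0"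
    and k: "k = general_momentum \<kappa> \<kappa>t" and \<epsilon>: "\<epsilon> = hh_polarization e \<kappa>t"
  shows "field_strength_decomposition (linearised_field_strength (gluon T \<epsilon> k) x) F_tilde F_hat F_breve \<Longrightarrow>
              ((\<forall>\<alpha> \<beta>. F_hat \<alpha> \<beta> = 0) \<longleftrightarrow> trace_condition \<kappa> e \<kappa>t) \<and>
              ((\<forall>\<alpha> \<beta> \<alpha>' \<beta>'. F_breve \<alpha> \<beta> \<alpha>' \<beta>' = 0) \<longleftrightarrow> wedge_condition \<kappa> e \<kappa>t)"
    and "hyperholomorphic (gluon T \<epsilon> k) \<longleftrightarrow> trace_condition \<kappa> e \<kappa>t \<and> wedge_condition \<kappa> e \<kappa>t"
    and "nontrivial_gluon (gluon T \<epsilon> k) \<and> wedge_condition \<kappa> e \<kappa>t \<or>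
          nontrivial_graviton (graviton \<epsilon> k) \<and> hyperkaehler (graviton \<epsilon> k) \<Longrightarrow> simple_momentum k"
proof -
  have tc: "trace_condition \<kappa> e \<kappa>t" by (rule trace_condition_null[OF sb])
  have wc: "wedge_condition \<kappa> e \<kappa>t \<longleftrightarrow> self_dual (lower_vec k) \<epsilon>"
    unfolding k \<epsilon> by (rule wedge_condition_iff)
  show "hyperholomorphic (gluon T \<epsilon> k) \<longleftrightarrow> trace_condition \<kappa> e \<kappa>t \<and> wedge_condition \<kappa> e \<kappa>t"
    using tc wc by (simp add: hyperholomorphic_gluon_iff[OF T])
  show "simple_momentum k" if "nontrivial_gluon (gluon T \<epsilon> k) \<and> wedge_condition \<kappa> e \<kappa>t \<or>
          nontrivial_graviton (graviton \<epsilon> k) \<and> hyperkaehler (graviton \<epsilon> k)"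
  proof -
    have "self_dual (lower_vec k) \<epsilon>" "\<exists>A B. wedge_form (lower_vec k) \<epsilon> A B \<noteq> 0"
      using that by (simp_all only: wc nontrivial_gluon_iff[OF T] nontrivial_graviton_iff hyperkaehler_graviton_iff) blast+
    then show ?thesis
      using self_dual_nontrivial simple_momentum_lower_vec[of k] unfolding simple_momentum_def by blast
  qed
  assume F: "field_strength_decomposition (linearised_field_strength (gluon T \<epsilon> k) x) F_tilde F_hat F_breve"
  \<comment> \<open>Uniqueness of the decomposition identifies the given components with the
    explicit ones.\<close>
  have u: "F_hat = (\<lambda>_ _. 0)" "F_breve = (\<lambda>\<alpha> \<beta> a b. (\<i> * plane_wave k x * sym_part (lower_vec k) \<epsilon> \<alpha> \<beta> a b) *s T)"
    using field_strength_decomposition_unique[OF F[unfolded k \<epsilon>] gluon_decomposition[OF sb, of T e \<kappa> x]] unfolding k \<epsilon> by blast+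
  show "((\<forall>\<alpha> \<beta>. F_hat \<alpha> \<beta> = 0) \<longleftrightarrow> trace_condition \<kappa> e \<kappa>t) \<and>
        ((\<forall>\<alpha> \<beta> \<alpha>' \<beta>'. F_breve \<alpha> \<beta> \<alpha>' \<beta>' = 0) \<longleftrightarrow> wedge_condition \<kappa> e \<kappa>t)"
    using tc T by (simp add: u wc self_dual_def)
qed

section \<open>Algebraic independence and growth\<close>

lemma poly_functions_sum:
  assumes "finite I" "\<And>i. i \<in> I \<Longrightarrow> f i \<in> poly_functions X"
  shows "(\<lambda>z. \<Sum>i\<in>I. f i z) \<in> poly_functions X"
  using assms by (induction I rule: finite_induct) (auto intro: poly_functions.intros)

lemma poly_functions_prod:
  assumes "finite I" "\<And>i. i \<in> I \<Longrightarrow> f i \<in> poly_functions X"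
  shows "(\<lambda>z. \<Prod>i\<in>I. f i z) \<in> poly_functions X"
  using assms by (induction I rule: finite_induct) (auto intro: poly_functions.intros)

lemma poly_functions_power:
  "f \<in> poly_functions X \<Longrightarrow> (\<lambda>z. f z ^ n) \<in> poly_functions X"
  by (induction n) (auto intro: poly_functions.intros)

lemma poly_functions_cmult:
  "f \<in> poly_functions X \<Longrightarrow> (\<lambda>z. c * f z) \<in> poly_functions X"
  by (intro poly_functions.mult poly_functions.const)

text \<open>Gaussian elimination by induction on the equations: B is the system with the pivot
  unknown j0 eliminated, and \<open>d j0\<close> is then solved for from equation i0.\<close>

lemma homogeneous_system_nontrivial_solution:
  fixes A :: "'i \<Rightarrow> 'j \<Rightarrow> complex"
  assumes "finite I" "finite J" "card I < card J"
  shows "\<exists>c. (\<exists>j\<in>J. c j \<noteq> 0) \<and> (\<forall>i\<in>I. (\<Sum>j\<in>J. A i j * c j) = 0)"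
  using assms
proof (induction I arbitrary: J A rule: finite_induct)
  case empty
  then obtain j where "j \<in> J" by fastforce
  then show ?case by (intro exI[of _ "\<lambda>_. 1"]) auto
next
  case (insert i0 I)
  show ?case
  proof (cases "\<exists>j0\<in>J. A i0 j0 \<noteq> 0")
    case False
    obtain c where "\<exists>j\<in>J. c j \<noteq> 0" "\<forall>i\<in>I. (\<Sum>j\<in>J. A i j * c j) = 0"
      using insert.IH[of J A] insert.prems insert.hyps by auto
    then show ?thesis using False by (intro exI[of _ c]) auto
  next
    case True
    then obtain j0 where j0: "j0 \<in> J" "A i0 j0 \<noteq> 0" by blast
    define J' where "J' = J - {j0}"
    have J': "finite J'" "card I < card J'" "J = insert j0 J'" "j0 \<notin> J'"
      using insert.prems insert.hyps j0 by (auto simp: J'_def)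
    define B where "B i j = A i j - A i j0 * A i0 j / A i0 j0" for i j
    obtain c where c: "\<exists>j\<in>J'. c j \<noteq> 0" "\<And>i. i \<in> I \<Longrightarrow> (\<Sum>j\<in>J'. B i j * c j) = 0"
      using insert.IH[of J' B] J' by blast
    define d where "d j = (if j = j0 then - (\<Sum>j\<in>J'. A i0 j * c j) / A i0 j0 else c j)" for j
    have sum: "(\<Sum>j\<in>J. A i j * d j) = (\<Sum>j\<in>J'. A i j * c j) - A i j0 * (\<Sum>j\<in>J'. A i0 j * c j) / A i0 j0" for i
    proof -
      have "(\<Sum>j\<in>J'. A i j * d j) = (\<Sum>j\<in>J'. A i j * c j)"
        using J'(4) by (intro sum.cong) (auto simp: d_def)
      then show ?thesis using J' by (simp add: d_def)
    qed
    have "(\<Sum>j\<in>J. A i j * d j) = 0" if "i \<in> insert i0 I" for i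
    proof (cases "i = i0")
      case True
      then show ?thesis using j0 by (simp add: sum)
    next
      case False
      have "(\<Sum>j\<in>J'. B i j * c j) = (\<Sum>j\<in>J'. A i j * c j) - A i j0 * (\<Sum>j\<in>J'. A i0 j * c j) / A i0 j0"
        by (simp add: B_def left_diff_distrib sum_subtractf sum_distrib_left sum_divide_distrib mult.assoc)
      then show ?thesis using c(2)[of i] False that by (simp add: sum)
    qed
    moreover have "\<exists>j\<in>J. d j \<noteq> 0" using c(1) J' by (auto simp: d_def)
    ultimately show ?thesis by blast
  qed
qed

section \<open>Linear independence of monomials\<close>

lemma digit_sum:
  fixes n M :: nat
  assumes "M > 0"
  shows "(\<Sum>j<r. (n div M ^ j mod M) * M ^ j) = n mod M ^ r"
proof (induction r)
  case (Suc r)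
  have "n mod M ^ Suc r = M ^ r * (n div M ^ r mod M) + n mod M ^ r"
    by (simp add: mod_mult2_eq power_Suc2 del: power_Suc)
  then show ?case using Suc by simp
qed simp

text \<open>Exponent vectors with entries below M are encoded as the numbers below
  \<open>M ^ r\<close>, so families of monomials are indexed by an initial segment.\<close>

definition digit_monomial :: "nat \<Rightarrow> nat \<Rightarrow> nat \<Rightarrow> (nat \<Rightarrow> complex) \<Rightarrow> complex" where
  "digit_monomial M r n w = (\<Prod>j<r. w j ^ (n div M ^ j mod M))"

text \<open>
  Under the Kronecker substitution \<open>w\<^sub>j = t ^ M ^ j\<close> the monomial with exponents the base-\<open>M\<close>
  digits of \<open>n\<close> becomes \<open>t ^ n\<close>, so distinct monomials are linearly independent.
\<close>

lemma digit_monomials_independent: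
  assumes M: "M > 0" and ne: "\<exists>n<M ^ r. c n \<noteq> 0"
  shows "\<exists>w. (\<Sum>n<M ^ r. c n * digit_monomial M r n w) \<noteq> 0"
proof -
  have kron: "digit_monomial M r n (\<lambda>j. t ^ (M ^ j)) = t ^ n" if "n < M ^ r" for n t
  proof -
    have "digit_monomial M r n (\<lambda>j. t ^ (M ^ j)) = t ^ (\<Sum>j<r. (n div M ^ j mod M) * M ^ j)"
      by (simp add: digit_monomial_def power_sum mult.commute flip: power_mult)
    then show ?thesis using that by (simp add: digit_sum[OF M])
  qed
  obtain k where k: "k < M ^ r" "c k \<noteq> 0" using ne by blast
  \<comment> \<open>A one-variable polynomial with a nonzero coefficient has finitely many roots, so
    some t avoids them.\<close>
  have "finite {t. (\<Sum>n\<le>M ^ r - 1. c n * t ^ n) = 0}"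
    unfolding polyfun_finite_roots by (rule exI[of _ k]) (use k in auto)
  then have "\<exists>t. (\<Sum>n\<le>M ^ r - 1. c n * t ^ n) \<noteq> 0"
    using infinite_UNIV_char_0 ex_new_if_finite by fastforce
  then obtain t where t: "(\<Sum>n\<le>M ^ r - 1. c n * t ^ n) \<noteq> 0" by blast
  have "{..M ^ r - 1} = {..<M ^ r}" using M by (auto simp: less_Suc_eq_le[symmetric])
  then have "(\<Sum>n<M ^ r. c n * digit_monomial M r n (\<lambda>j. t ^ (M ^ j))) \<noteq> 0"
    using t kron by simp
  then show ?thesis by blast
qed

lemma digit_monomial_poly:
  "(\<lambda>w. \<Sum>n\<in>N. c n * digit_monomial M r n w) \<in> polys_in_variables r" if "finite N"
  unfolding digit_monomial_def polys_in_variables_def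
  by (intro poly_functions_sum poly_functions_cmult poly_functions_prod poly_functions_power that)
     (auto intro: poly_functions.coord)

section \<open>Spans of functions on a variety and the growth bound\<close>

text \<open>Equality is required on S only, so the relations that hold on the variety are built in
  without naming its ideal.\<close>

definition fun_span :: "'s set \<Rightarrow> ('s \<Rightarrow> complex) set \<Rightarrow> ('s \<Rightarrow> complex) set" where
  "fun_span S G = {f. \<exists>c. \<forall>z\<in>S. f z = (\<Sum>g\<in>G. c g * g z)}"

lemma fun_span_base: "finite G \<Longrightarrow> g \<in> G \<Longrightarrow> g \<in> fun_span S G"
  unfolding fun_span_def
  by (rule CollectI, rule exI[of _ "\<lambda>h. if h = g then 1 else 0"]) (simp add: if_distrib[of "\<lambda>x. x * _"] cong: if_cong)

lemma fun_span_cong: "f \<in> fun_span S G \<Longrightarrow> (\<And>z. z \<in> S \<Longrightarrow> f z = f' z) \<Longrightarrow> f' \<in> fun_span S G"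
  unfolding fun_span_def by fastforce

lemma fun_span_add: "f \<in> fun_span S G \<Longrightarrow> f' \<in> fun_span S G \<Longrightarrow> (\<lambda>z. f z + f' z) \<in> fun_span S G"
proof -
  assume "f \<in> fun_span S G" "f' \<in> fun_span S G"
  then obtain c c' where "\<forall>z\<in>S. f z = (\<Sum>g\<in>G. c g * g z)" "\<forall>z\<in>S. f' z = (\<Sum>g\<in>G. c' g * g z)"
    by (auto simp: fun_span_def)
  then show ?thesis unfolding fun_span_def
    by (auto intro!: exI[of _ "\<lambda>g. c g + c' g"] simp: distrib_right sum.distrib)
qed

lemma fun_span_cmult: "f \<in> fun_span S G \<Longrightarrow> (\<lambda>z. a * f z) \<in> fun_span S G"
proof -
  assume "f \<in> fun_span S G"
  then obtain c where "\<forall>z\<in>S. f z = (\<Sum>g\<in>G. c g * g z)"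
    by (auto simp: fun_span_def)
  then show ?thesis unfolding fun_span_def
    by (auto intro!: exI[of _ "\<lambda>g. a * c g"] simp: sum_distrib_left mult.assoc)
qed

lemma fun_span_sum:
  assumes "finite I" "\<And>i. i \<in> I \<Longrightarrow> f i \<in> fun_span S G"
  shows "(\<lambda>z. \<Sum>i\<in>I. f i z) \<in> fun_span S G"
  using assms
proof (induction I rule: finite_induct)
  case empty
  show ?case unfolding fun_span_def by (auto intro!: exI[of _ "\<lambda>_. 0"])
qed (auto intro: fun_span_add)

lemma fun_span_multiplier:
  assumes "finite G" "\<And>g. g \<in> G \<Longrightarrow> (\<lambda>z. h z * g z) \<in> fun_span S G'" "f \<in> fun_span S G"
  shows "(\<lambda>z. h z * f z) \<in> fun_span S G'"
proof -
  obtain c where c: "\<forall>z\<in>S. f z = (\<Sum>g\<in>G. c g * g z)" using assms(3) by (auto simp: fun_span_def)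
  have "(\<lambda>z. \<Sum>g\<in>G. c g * (h z * g z)) \<in> fun_span S G'"
    using assms by (intro fun_span_sum fun_span_cmult) auto
  then show ?thesis
    by (rule fun_span_cong) (simp add: c sum_distrib_left mult_ac)
qed

lemma fun_span_mono:
  assumes "finite G'" "G \<subseteq> G'"
  shows "fun_span S G \<subseteq> fun_span S G'"
proof
  fix f assume f: "f \<in> fun_span S G"
  have "(\<lambda>z. 1 * f z) \<in> fun_span S G'"
  proof (rule fun_span_multiplier[OF _ _ f])
    show "finite G" using assms by (rule finite_subset[rotated])
    show "(\<lambda>z. 1 * g z) \<in> fun_span S G'" if "g \<in> G" for g
      using fun_span_base[OF assms(1), of g S] that assms(2) by auto
  qed
  then show "f \<in> fun_span S G'" by simp
qed

text \<open>
  \<open>G D\<close> spans the functions of degree at most \<open>D\<close> on the variety \<open>\<phi> ` S\<close>. As the number of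
  monomials of degree less than \<open>M\<close> in each of \<open>r\<close> variables is \<open>M ^ r\<close>, polynomial growth of
  \<open>card (G D)\<close> of order \<open>d\<close> bounds the number of algebraically independent functions by \<open>d\<close>.
\<close>

lemma algebraically_independent_bound:
  fixes \<phi> :: "'s \<Rightarrow> complex ^ 'n" and G :: "nat \<Rightarrow> ('s \<Rightarrow> complex) set"
  assumes fin: "\<And>D. finite (G D)" and card: "\<And>D. card (G D) \<le> C * (D + 1) ^ d"
    and one: "(\<lambda>_. 1) \<in> G 0" and mono: "\<And>D. G D \<subseteq> G (Suc D)"
    and coord: "\<And>D i g. g \<in> G D \<Longrightarrow> (\<lambda>s. \<phi> s $ i * g s) \<in> fun_span S (G (Suc D))"
    and indep: "algebraically_independent_on (\<phi> ` S) r f" and poly: "\<And>j. j < r \<Longrightarrow> f j \<in> polys_on_space"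
  shows "r \<le> d"
proof (rule ccontr)
  assume "\<not> r \<le> d"
  have mono': "fun_span S (G D) \<subseteq> fun_span S (G E)" if "D \<le> E" for D E
    using fin lift_Suc_mono_le[of G, OF mono that] by (rule fun_span_mono)
  \<comment> \<open>Multiplication by any polynomial function raises the filtration by a bounded
    amount; e plays the role of a degree.\<close>
  have deg: "\<exists>e. \<forall>D. \<forall>g \<in> fun_span S (G D). (\<lambda>s. h (\<phi> s) * g s) \<in> fun_span S (G (D + e))"
    if "h \<in> polys_on_space" for h
    using that unfolding polys_on_space_def
  proof induction
    case (const c)
    show ?case by (intro exI[of _ 0] allI ballI) (simp add: fun_span_cmult)
  next
    case (coord h)
    then obtain i where h: "h = (\<lambda>z. z $ i)" by blast
    have "(\<lambda>s. \<phi> s $ i * g s) \<in> fun_span S (G (Suc D))" if "g \<in> fun_span S (G D)" for g D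
      using fin assms(5) that by (rule fun_span_multiplier)
    then show ?case by (intro exI[of _ 1]) (simp add: h)
  next
    case (add h h')
    then obtain e e' where e: "\<And>D g. g \<in> fun_span S (G D) \<Longrightarrow> (\<lambda>s. h (\<phi> s) * g s) \<in> fun_span S (G (D + e))"
      "\<And>D g. g \<in> fun_span S (G D) \<Longrightarrow> (\<lambda>s. h' (\<phi> s) * g s) \<in> fun_span S (G (D + e'))" by blast
    have "(\<lambda>s. (h (\<phi> s) + h' (\<phi> s)) * g s) \<in> fun_span S (G (D + (e + e')))" if "g \<in> fun_span S (G D)" for D g
      unfolding distrib_right
      using e[OF that] mono'[of "D + e" "D + (e + e')"] mono'[of "D + e'" "D + (e + e')"]
      by (intro fun_span_add) auto
    then show ?case by blast
  next
    case (mult h h')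
    then obtain e e' where e: "\<And>D g. g \<in> fun_span S (G D) \<Longrightarrow> (\<lambda>s. h (\<phi> s) * g s) \<in> fun_span S (G (D + e))"
      "\<And>D g. g \<in> fun_span S (G D) \<Longrightarrow> (\<lambda>s. h' (\<phi> s) * g s) \<in> fun_span S (G (D + e'))" by blast
    have "(\<lambda>s. h (\<phi> s) * h' (\<phi> s) * g s) \<in> fun_span S (G (D + (e' + e)))" if "g \<in> fun_span S (G D)" for D g
      using e(1)[OF e(2)[OF that]] by (simp add: mult.assoc add.assoc)
    then show ?case by blast
  qed
  then have "\<forall>j\<in>{..<r}. \<exists>e. \<forall>D. \<forall>g \<in> fun_span S (G D). (\<lambda>s. f j (\<phi> s) * g s) \<in> fun_span S (G (D + e))"
    using poly by blast
  from bchoice[OF this] obtain e0 where e0: "\<And>j D g. j < r \<Longrightarrow> g \<in> fun_span S (G D) \<Longrightarrow> (\<lambda>s. f j (\<phi> s) * g s) \<in> fun_span S (G (D + e0 j))"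
    by auto
  define e where "e = (\<Sum>j<r. e0 j)"
  have e: "(\<lambda>s. f j (\<phi> s) * g s) \<in> fun_span S (G (D + e))" if "j < r" "g \<in> fun_span S (G D)" for j D g
  proof -
    have "e0 j \<le> e" unfolding e_def using that(1) by (intro member_le_sum) auto
    then show ?thesis using e0[OF that] mono'[of "D + e0 j" "D + e"] by auto
  qed
  have pow: "(\<lambda>s. f j (\<phi> s) ^ n * g s) \<in> fun_span S (G (D + n * e))" if "j < r" "g \<in> fun_span S (G D)" for j D g n
  proof (induction n)
    case (Suc n)
    then show ?case using e[OF that(1) Suc] by (simp add: mult.assoc add.assoc add.commute[of e])
  qed (simp add: that(2))
  have prod: "(\<lambda>s. \<Prod>j<q. f j (\<phi> s) ^ a j) \<in> fun_span S (G ((\<Sum>j<q. a j) * e))" if "q \<le> r" for q a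
    using that
  proof (induction q)
    case 0
    show ?case using fun_span_base[OF fin one] by simp
  next
    case (Suc q)
    then show ?case using pow[of q "\<lambda>s. \<Prod>j<q. f j (\<phi> s) ^ a j" "(\<Sum>j<q. a j) * e" "a q"]
      by (simp add: algebra_simps)
  qed
  \<comment> \<open>This M exceeds the constant \<open>C * (r * e + 1) ^ d\<close>, so the growth
    bound at E stays below \<open>M * M ^ d\<close>, which is at most \<open>M ^ r\<close>.\<close>
  define M where "M = Suc (C * (r * e + 1) ^ d)"
  have M: "M > 0" by (simp add: M_def)
  define E where "E = r * M * e"
  have mon: "(\<lambda>s. digit_monomial M r n (\<lambda>j. f j (\<phi> s))) \<in> fun_span S (G E)" for n
  proof -
    have "(\<Sum>j<r. n div M ^ j mod M) \<le> (\<Sum>j<r. M)"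
      using M by (intro sum_mono) (simp add: less_imp_le)
    then have "(\<Sum>j<r. n div M ^ j mod M) * e \<le> E" by (simp add: E_def)
    then show ?thesis using prod[of r "\<lambda>j. n div M ^ j mod M"] mono' unfolding digit_monomial_def by blast
  qed
  then obtain a where a: "\<And>n s. s \<in> S \<Longrightarrow> digit_monomial M r n (\<lambda>j. f j (\<phi> s)) = (\<Sum>g\<in>G E. a n g * g s)"
    unfolding fun_span_def by simp metis
  have "card (G E) < card {..<M ^ r}"
  proof -
    have "E + 1 \<le> (r * e + 1) * M" by (simp add: E_def M_def algebra_simps)
    then have "card (G E) \<le> C * ((r * e + 1) * M) ^ d"
      using card[of E] by (meson le_trans mult_le_mono2 power_mono zero_le)
    also have "\<dots> = (C * (r * e + 1) ^ d) * M ^ d" by (simp only: power_mult_distrib mult.assoc)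
    also have "\<dots> < M * M ^ d" using M by (simp add: M_def)
    also have "\<dots> \<le> M ^ r" using \<open>\<not> r \<le> d\<close> M by (simp flip: power_Suc add: power_increasing)
    finally show ?thesis by simp
  qed
  \<comment> \<open>There are more monomials than spanning functions, so a nonzero combination of
    monomials has all its coefficients on \<open>G E\<close> equal to zero.\<close>
  then obtain c where c: "\<exists>n<M ^ r. c n \<noteq> 0" "\<And>g. g \<in> G E \<Longrightarrow> (\<Sum>n<M ^ r. a n g * c n) = 0"
    using homogeneous_system_nontrivial_solution[of "G E" "{..<M ^ r}" "\<lambda>g n. a n g"] fin by auto
  have "(\<Sum>n<M ^ r. c n * digit_monomial M r n (\<lambda>j. f j z)) = 0" if "z \<in> \<phi> ` S" for z
  proof -
    obtain s where s: "s \<in> S" "z = \<phi> s" using \<open>z \<in> \<phi> ` S\<close> by blast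
    have "(\<Sum>n<M ^ r. c n * digit_monomial M r n (\<lambda>j. f j z)) = (\<Sum>n<M ^ r. \<Sum>g\<in>G E. c n * (a n g * g s))"
      using s by (simp add: a sum_distrib_left)
    also have "\<dots> = (\<Sum>g\<in>G E. (\<Sum>n<M ^ r. a n g * c n) * g s)"
      unfolding sum_distrib_right by (subst sum.swap, intro sum.cong refl) (simp only: mult_ac)
    finally show ?thesis by (simp add: c(2))
  qed
  then have "(\<Sum>n<M ^ r. c n * digit_monomial M r n w) = 0" for w
    by (rule indep[unfolded algebraically_independent_on_def, rule_format, OF digit_monomial_poly[OF finite_lessThan]])
  with digit_monomials_independent[of M r c] M c(1) show False by blast
qed

lemma polys_in_variables_cong:
  assumes "P \<in> polys_in_variables r" "\<And>j. j < r \<Longrightarrow> w j = w' j"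
  shows "P w = P w'"
  using assms(1) unfolding polys_in_variables_def
  by induction (auto simp: assms(2))

lemma continuous_polys_in_variables:
  assumes "P \<in> polys_in_variables r" "\<And>j. j < r \<Longrightarrow> continuous_on UNIV (\<lambda>t. w t j)"
  shows "continuous_on UNIV (\<lambda>t. P (w t))"
  using assms(1) unfolding polys_in_variables_def
  by induction (auto intro!: continuous_intros assms(2))

text \<open>\<open>GREATEST\<close> yields a maximum only for bounded candidates, hence the bound
  over arbitrary tuples among the premises.\<close>

lemma variety_dimI:
  assumes "\<forall>j<r. f j \<in> polys_on_space" "algebraically_independent_on V r f"
    and "\<And>r f. \<forall>j<r. f j \<in> polys_on_space \<Longrightarrow> algebraically_independent_on V r f \<Longrightarrow> r \<le> d" "d = r"
  shows "variety_dim V = d"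
  unfolding variety_dim_def
  using assms by (intro Greatest_equality) blast+

text \<open>The projection need not be onto: it suffices that w is approached by image points along
  a punctured line in some direction v. A relation P vanishes on that line, and by continuity at
  w.\<close>

lemma algebraically_independent_projection:
  fixes f :: "'i \<Rightarrow> complex ^ 'n \<Rightarrow> complex"
  assumes h: "bij_betw h {..<r} I" 
    and dense: "\<And>w :: 'i \<Rightarrow> complex. \<exists>v. \<forall>t. t \<noteq> 0 \<longrightarrow> (\<exists>z\<in>V. \<forall>j\<in>I. f j z = w j + t * v j)"
  shows "algebraically_independent_on V r (\<lambda>j. f (h j))"
  unfolding algebraically_independent_on_def
proof (intro ballI impI allI)
  fix P and w :: "nat \<Rightarrow> complex"
  assume P: "P \<in> polys_in_variables r" and zero: "\<forall>z\<in>V. P (\<lambda>j. f (h j) z) = 0"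
  define w' where "w' i = w (inv_into {..<r} h i)" for i
  have w': "w' (h j) = w j" if "j < r" for j
    using h that by (simp add: w'_def bij_betw_def)
  obtain v where v: "\<And>t. t \<noteq> 0 \<Longrightarrow> \<exists>z\<in>V. \<forall>j\<in>I. f j z = w' j + t * v j" using dense[of w'] by blast
  have Pt: "P (\<lambda>j. w j + t * v (h j)) = 0" if t: "t \<noteq> 0" for t
  proof -
    obtain z where z: "z \<in> V" "\<And>j. j \<in> I \<Longrightarrow> f j z = w' j + t * v j" using v[OF t] by blast
    have "P (\<lambda>j. w j + t * v (h j)) = P (\<lambda>j. f (h j) z)"
      using P by (rule polys_in_variables_cong) (use z w' h in \<open>auto simp: bij_betw_def\<close>)
    then show ?thesis using zero z by simp
  qed
  have "continuous_on UNIV (\<lambda>t. P (\<lambda>j. w j + t * v (h j)))"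
    using P by (rule continuous_polys_in_variables) (intro continuous_intros)
  then have "((\<lambda>t. P (\<lambda>j. w j + t * v (h j))) \<longlongrightarrow> P (\<lambda>j. w j + 0 * v (h j))) (at 0)"
    unfolding continuous_on_def by (rule bspec) simp
  moreover have "((\<lambda>t. P (\<lambda>j. w j + t * v (h j))) \<longlongrightarrow> 0) (at 0)"
    by (rule tendsto_eventually) (auto simp: eventually_at_filter Pt)
  ultimately show "P w = 0" using tendsto_unique[OF trivial_limit_at] by fastforce
qed

section \<open>The null cone and the simple momenta\<close>

text \<open>The metric pairs every coordinate with exactly one other, so the quadric is a signed sum
  of products of conjugate coordinates. In the type \<open>2\<close> subtraction from 1 swaps 0 and
  1.\<close>

definition bar_index :: "'m index \<Rightarrow> 'm index" where
  "bar_index A = (1 - fst A, bar_dotted (snd A))"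

definition sgn_index :: "'m index \<Rightarrow> complex" where
  "sgn_index A = (if fst A = 0 then - 1 else 1) * sgn_dotted (snd A)"

lemma bar_index_bar [simp]: "bar_index (bar_index A) = A"
  by (simp add: bar_index_def)

lemma bar_index_neq [simp]: "bar_index A \<noteq> A" "A \<noteq> bar_index A"
  using exhaust_undotted[of "fst A"] by (auto simp: bar_index_def prod_eq_iff)

lemma sgn_index_bar [simp]: "sgn_index (bar_index A) = sgn_index A"
  using exhaust_undotted[of "fst A"] by (auto simp: sgn_index_def bar_index_def)

lemma sgn_index_square [simp]: "sgn_index A * sgn_index A = 1"
  by (auto simp: sgn_index_def)

lemma lower_vec_nth_bar: "lower_vec k $ A = sgn_index A * k $ bar_index A"
  using exhaust_undotted[of "fst A"] by (cases A) (auto simp: sgn_index_def bar_index_def lower_vec_nth)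

lemma null_momentum_iff_sum:
  "null_momentum k \<longleftrightarrow> (\<Sum>A\<in>UNIV. sgn_index A * (k $ A * k $ bar_index A)) = 0"
  by (simp add: null_momentum_def pairing_def lower_vec_nth_bar mult_ac)

text \<open>A and \<open>bar_index A\<close> contribute equal summands, hence the 2, and
  \<open>sgn_index A\<close> is its own inverse. The formula is the rewriting rule of the upper
  dimension bound and the equation solved in the lower one.\<close>

lemma null_momentum_iff_product:
  fixes k :: "'m::finite vec4m"
  shows "null_momentum k \<longleftrightarrow> k $ A * k $ bar_index A =
     - (sgn_index A / 2) * (\<Sum>B\<in>UNIV - {A, bar_index A}. sgn_index B * (k $ B * k $ bar_index B))"
    (is "_ \<longleftrightarrow> _ = _ * ?s")
proof -
  have "(\<Sum>B\<in>UNIV. sgn_index B * (k $ B * k $ bar_index B)) =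
      (\<Sum>B\<in>{A, bar_index A}. sgn_index B * (k $ B * k $ bar_index B)) + ?s"
    by (subst sum.subset_diff[of "{A, bar_index A}" UNIV]) auto
  also have "\<dots> = 2 * sgn_index A * (k $ A * k $ bar_index A) + ?s"
    by (simp add: mult_ac)
  finally have *: "null_momentum k \<longleftrightarrow> 2 * sgn_index A * (k $ A * k $ bar_index A) + ?s = 0"
    by (simp add: null_momentum_iff_sum)
  show ?thesis unfolding * using sgn_index_square[of A] by algebra
qed

lemma coord_polys_on_space: "(\<lambda>z. z $ i) \<in> polys_on_space"
  unfolding polys_on_space_def by (rule poly_functions.coord) blast

lemma algebraic_null_cone: "algebraic_set (null_cone :: 'm::finite vec4m set)"
proof -
  have "(\<lambda>k :: 'm vec4m. \<Sum>A\<in>UNIV. sgn_index A * (k $ A * k $ bar_index A)) \<in> polys_on_space"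
    unfolding polys_on_space_def
    by (intro poly_functions_sum poly_functions_cmult poly_functions.mult coord_polys_on_space[unfolded polys_on_space_def]) simp
  then show ?thesis unfolding algebraic_set_def null_cone_def null_momentum_iff_sum
    by (intro exI[of _ "{\<lambda>k. \<Sum>A\<in>UNIV. sgn_index A * (k $ A * k $ bar_index A)}"]) auto
qed

lemma algebraic_simple_momenta: "algebraic_set (simple_momenta :: 'm::finite vec4m set)"
proof -
  let ?p = "\<lambda>a b (k :: 'm vec4m). k $ (0, a) * k $ (1, b) + (- 1) * (k $ (0, b) * k $ (1, a))"
  have "?p a b \<in> polys_on_space" for a b
    unfolding polys_on_space_def
    by (intro poly_functions.add poly_functions_cmult poly_functions.mult coord_polys_on_space[unfolded polys_on_space_def])
  then have "range (case_prod ?p) \<subseteq> polys_on_space" by auto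
  moreover have "simple_momenta = {z. \<forall>p\<in>range (case_prod ?p). p z = 0}"
    by (simp add: simple_momenta_def simple_momentum_iff)
  ultimately show ?thesis unfolding algebraic_set_def by blast
qed

definition monomial :: "('i::finite \<Rightarrow> nat) \<Rightarrow> complex ^ 'i \<Rightarrow> complex" where
  "monomial c z = (\<Prod>i\<in>UNIV. z $ i ^ c i)"

lemma monomial_0 [simp]: "monomial (\<lambda>_. 0) z = 1"
  by (simp add: monomial_def)

lemma monomial_upd: "monomial (c(i := Suc n)) z = z $ i * monomial (c(i := n)) z"
proof -
  have "monomial (c(i := n)) z = z $ i ^ n * (\<Prod>j\<in>UNIV - {i}. z $ j ^ c j)" for n
    unfolding monomial_def by (subst prod.remove[of _ i]) auto
  then show ?thesis by simp
qed

lemma monomial_Suc: "monomial (c(i := Suc (c i))) z = z $ i * monomial c z"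
  using monomial_upd[of c i "c i" z] by simp

lemma sum_upd_Suc: "sum (c(i := Suc (c i))) UNIV = Suc (sum c (UNIV :: 'i::finite set))"
  by (subst (1 2) sum.remove[of _ i]) auto

lemma finite_card_exponents:
  fixes X :: "('i::finite \<Rightarrow> nat) set"
  assumes "\<And>c i. c \<in> X \<Longrightarrow> c i \<in> F i" "\<And>i. finite (F i)"
  shows "finite X" "card X \<le> (\<Prod>i\<in>UNIV. card (F i))"
proof -
  have sub: "X \<subseteq> PiE UNIV F" using assms by (auto simp: PiE_def Pi_def extensional_def)
  have fin: "finite (PiE UNIV F)" using assms by (intro finite_PiE) auto
  show "finite X" using sub fin by (rule finite_subset)
  have "card X \<le> card (PiE UNIV F)" using sub fin by (rule card_mono[rotated])
  then show "card X \<le> (\<Prod>i\<in>UNIV. card (F i))" by (simp add: card_PiE)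
qed

lemma bij_betw_lessThan: "finite I \<Longrightarrow> \<exists>h. bij_betw h {..<card I} I"
  using ex_bij_betw_nat_finite[of I] by (simp add: atLeast0LessThan)

text \<open>
  On the null cone the product of the conjugate coordinates \<open>A\<close> and \<open>bar_index A\<close> is a combination
  of products of the other coordinates, so the monomials in which one of the two is absent span the
  coordinate ring.
\<close>

lemma null_cone_dim_le:
  fixes f :: "nat \<Rightarrow> 'm::finite vec4m \<Rightarrow> complex"
  assumes poly: "\<forall>j<r. f j \<in> polys_on_space" and indep: "algebraically_independent_on null_cone r f"
  shows "r \<le> 4 * CARD('m) - 1"
proof -
  define A :: "'m index" where "A = (0, Inl undefined)"
  define Q where "Q c \<longleftrightarrow> c A = 0 \<or> c (bar_index A) = (0::nat)" for c
  define E where "E D = {c. sum c UNIV \<le> D \<and> Q c}" for D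
  define G where "G D = monomial ` E D" for D
  \<comment> \<open>One exponent is pinned to zero; the other 4m - 1 range over D + 1
    values.\<close>
  have fin_card: "finite {c. (\<forall>i. c i \<le> D) \<and> c B = 0}" 
     "card {c. (\<forall>i. c i \<le> D) \<and> c B = 0} \<le> (D + 1) ^ (4 * CARD('m) - 1)" for D and B :: "'m index"
  proof -
    let ?F = "\<lambda>i. if i = B then {0} else {..D}"
    have "(\<Prod>i\<in>UNIV. card (?F i)) = (D + 1) ^ (4 * CARD('m) - 1)"
      by (subst prod.remove[of _ B]) (auto simp: card_Diff_singleton)
    then show "finite {c. (\<forall>i. c i \<le> D) \<and> c B = 0}" 
     "card {c. (\<forall>i. c i \<le> D) \<and> c B = 0} \<le> (D + 1) ^ (4 * CARD('m) - 1)"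
      using finite_card_exponents[of "{c. (\<forall>i. c i \<le> D) \<and> c B = 0}" ?F] by auto
  qed
  have E_sub: "E D \<subseteq> {c. (\<forall>i. c i \<le> D) \<and> c A = 0} \<union> {c. (\<forall>i. c i \<le> D) \<and> c (bar_index A) = 0}" for D
  proof
    fix c assume c: "c \<in> E D"
    have "c i \<le> sum c UNIV" for i by (rule member_le_sum) auto
    then have "\<forall>i. c i \<le> D" using c by (auto simp: E_def intro: le_trans)
    then show "c \<in> {c. (\<forall>i. c i \<le> D) \<and> c A = 0} \<union> {c. (\<forall>i. c i \<le> D) \<and> c (bar_index A) = 0}"
      using c by (auto simp: E_def Q_def)
  qed
  have E_fin: "finite (E D)" for D
    using E_sub fin_card(1)[of D] by (meson finite_UnI finite_subset)
  \<comment> \<open>One box for each of the two coordinates that may be absent, hence the factor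
    2.\<close>
  have E_card: "card (E D) \<le> 2 * (D + 1) ^ (4 * CARD('m) - 1)" for D
  proof -
    have "card (E D) \<le> card ({c. (\<forall>i. c i \<le> D) \<and> c A = 0} \<union> {c. (\<forall>i. c i \<le> D) \<and> c (bar_index A) = 0})"
      using fin_card(1)[of D] E_sub by (intro card_mono) auto
    also have "\<dots> \<le> 2 * (D + 1) ^ (4 * CARD('m) - 1)"
      using card_Un_le[of "{c. (\<forall>i. c i \<le> D) \<and> c A = 0}" "{c. (\<forall>i. c i \<le> D) \<and> c (bar_index A) = 0}"]
        fin_card(2)[of D A] fin_card(2)[of D "bar_index A"] by linarith
    finally show ?thesis .
  qed
  have G_fin: "finite (G D)" for D by (simp add: G_def E_fin)
  have step: "monomial (c(B := Suc (c B))) \<in> fun_span null_cone (G (Suc D))"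
    if c: "c \<in> E D" and B: "Q (c(B := Suc (c B)))" for c B D
  proof (rule fun_span_base[OF G_fin])
    show "monomial (c(B := Suc (c B))) \<in> G (Suc D)"
      unfolding G_def using c B by (intro imageI) (simp add: E_def sum_upd_Suc del: fun_upd_apply)
  qed
  \<comment> \<open>The only obstructed products: B meets its conjugate. The quadric trades these
    two factors for products of other conjugate pairs, of the same degree and free of B.\<close>
  have pair: "(\<lambda>k. k $ B * monomial c k) \<in> fun_span null_cone (G (Suc D))"
    if c: "c \<in> E D" and B: "B \<in> {A, bar_index A}" and pos: "c (bar_index B) \<noteq> 0" for c B D
  proof -
    let ?B = "bar_index B"
    obtain n where n: "c ?B = Suc n" using pos not0_implies_Suc by blast
    define c' where "c' = c(?B := n)"
    have c_eq: "c = c'(?B := Suc (c' ?B))" using n by (auto simp: c'_def)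
    have QB: "Q d" if "d B = 0" for d using B that by (auto simp: Q_def)
    have c0: "c' B = 0" using c B n by (auto simp: E_def Q_def c'_def)
    have D: "Suc (sum c' UNIV) \<le> D"
      using c sum_upd_Suc[of c' ?B] unfolding c_eq[symmetric] by (simp add: E_def)
    have product: "(\<lambda>k. k $ i * (k $ bar_index i * monomial c' k)) \<in> fun_span null_cone (G (Suc D))"
      if i: "i \<in> UNIV - {B, ?B}" for i
    proof -
      let ?c = "c'(bar_index i := Suc (c' (bar_index i)))"
      have "bar_index i \<noteq> B" using i bar_index_bar[of i] by auto
      then have "?c B = 0" using c0 by simp
      then have "(?c(i := Suc (?c i))) B = 0" using i by auto
      then have "Q (?c(i := Suc (?c i)))" by (rule QB)
      moreover have "?c \<in> E D" using D QB[of ?c, OF \<open>?c B = 0\<close>] by (simp add: E_def sum_upd_Suc del: fun_upd_apply)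
      ultimately have "monomial (?c(i := Suc (?c i))) \<in> fun_span null_cone (G (Suc D))"
        by (rule step[rotated])
      then show ?thesis by (rule fun_span_cong) (simp add: monomial_Suc del: fun_upd_apply)
    qed
    have "(\<lambda>k. - (sgn_index B / 2) * (\<Sum>i\<in>UNIV - {B, ?B}. sgn_index i * (k $ i * (k $ bar_index i * monomial c' k))))
        \<in> fun_span null_cone (G (Suc D))"
      by (intro fun_span_cmult fun_span_sum product) auto
    then show ?thesis
    proof (rule fun_span_cong)
      fix k :: "'m vec4m" assume "k \<in> null_cone"
      then have k: "k $ B * k $ ?B = - (sgn_index B / 2) * (\<Sum>i\<in>UNIV - {B, ?B}. sgn_index i * (k $ i * k $ bar_index i))"
        unfolding null_cone_def by (simp only: null_momentum_iff_product[of k B] mem_Collect_eq)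
      have "k $ B * monomial c k = (k $ B * k $ ?B) * monomial c' k"
        by (subst c_eq) (simp add: monomial_Suc del: fun_upd_apply)
      then show "- (sgn_index B / 2) * (\<Sum>i\<in>UNIV - {B, ?B}. sgn_index i * (k $ i * (k $ bar_index i * monomial c' k))) = k $ B * monomial c k"
        unfolding k by (simp add: sum_distrib_right mult.assoc)
    qed
  qed
  have coord: "(\<lambda>k. k $ B * monomial c k) \<in> fun_span null_cone (G (Suc D))" if c: "c \<in> E D" for c B D
  proof (cases "Q (c(B := Suc (c B)))")
    case True
    then have "monomial (c(B := Suc (c B))) \<in> fun_span null_cone (G (Suc D))" using step c by blast
    then show ?thesis by (rule fun_span_cong) (simp add: monomial_Suc)
  next
    case False
    then have "B \<in> {A, bar_index A}" "c (bar_index B) \<noteq> 0"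
      using c by (auto simp: Q_def E_def split: if_splits)
    then show ?thesis using pair c by blast
  qed
  have one: "(\<lambda>_. 1) \<in> G 0"
  proof -
    have "(\<lambda>_. 0) \<in> E 0" by (simp add: E_def Q_def)
    moreover have "(\<lambda>_. 1) = (monomial (\<lambda>_. 0) :: 'm vec4m \<Rightarrow> complex)" by (simp add: fun_eq_iff)
    ultimately show ?thesis unfolding G_def by blast
  qed
  show ?thesis
  proof (rule algebraically_independent_bound[where \<phi> = "\<lambda>k. k" and S = null_cone and G = G and C = 2 and f = f])
    show "card (G D) \<le> 2 * (D + 1) ^ (4 * CARD('m) - 1)" for D
      using card_image_le[OF E_fin, of monomial D] E_card[of D] by (simp add: G_def)
    show "G D \<subseteq> G (Suc D)" for D by (auto simp: G_def E_def)
    show "(\<lambda>k. k $ i * g k) \<in> fun_span null_cone (G (Suc D))" if "g \<in> G D" for D i g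
    proof -
      obtain c where "c \<in> E D" "g = monomial c" using \<open>g \<in> G D\<close> by (auto simp: G_def)
      then show ?thesis using coord[of c D i] by simp
    qed
  qed (use G_fin one indep poly in auto)
qed

text \<open>A Noether normalization. Merely dropping a coordinate would in general miss points where
  its conjugate is zero; prescribing the sum of the two instead gives a monic quadratic, always
  solvable over the complex numbers, so the projection is onto.\<close>

lemma null_cone_dim: "variety_dim (null_cone :: 'm::finite vec4m set) = 4 * CARD('m) - 1"
proof -
  define A :: "'m index" where "A = (0, Inl undefined)"
  define I where "I = UNIV - {bar_index A}"
  have cI: "card I = 4 * CARD('m) - 1" by (simp add: I_def card_Diff_singleton)
  obtain h where h: "bij_betw h {..<4 * CARD('m) - 1} I" using bij_betw_lessThan[of I] cI by auto
  define f where "f B k = (if B = A then k $ A + k $ bar_index A else k $ B)" for B and k :: "'m vec4m"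
  show ?thesis
  proof (rule variety_dimI[where r = "4 * CARD('m) - 1" and f = "\<lambda>j. f (h j)"])
    have "f B \<in> polys_on_space" for B
    proof (cases "B = A")
      case True
      have "(\<lambda>k. k $ A + k $ bar_index A) \<in> polys_on_space"
        using coord_polys_on_space coord_polys_on_space unfolding polys_on_space_def by (rule poly_functions.add)
      then show ?thesis using True unfolding f_def by simp
    next
      case False
      then show ?thesis using coord_polys_on_space unfolding f_def by auto
    qed
    then show "\<forall>j<4 * CARD('m) - 1. f (h j) \<in> polys_on_space" by blast
    show "algebraically_independent_on null_cone (4 * CARD('m) - 1) (\<lambda>j. f (h j))"
    proof (rule algebraically_independent_projection[OF h])
      fix w :: "'m index \<Rightarrow> complex"
      \<comment> \<open>the coordinates \<open>A\<close> and \<open>bar_index A\<close> of \<open>k\<close> are the roots of a quadratic with prescribed sum and product\<close>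
      define q where "q = - (sgn_index A / 2) * (\<Sum>B\<in>UNIV - {A, bar_index A}. sgn_index B * (w B * w (bar_index B)))"
      define s where "s = csqrt (w A ^ 2 - 4 * q)"
      have s: "s * s = w A * w A - 4 * q" using power2_csqrt[of "w A ^ 2 - 4 * q"] by (simp add: s_def power2_eq_square)
      define k :: "'m vec4m" where "k = (\<chi> B. if B = A then (w A + s) / 2 else if B = bar_index A then (w A - s) / 2 else w B)"
      have kA: "k $ A * k $ bar_index A = q" using s by (simp add: k_def field_simps)
      have "(\<Sum>B\<in>UNIV - {A, bar_index A}. sgn_index B * (k $ B * k $ bar_index B)) =
         (\<Sum>B\<in>UNIV - {A, bar_index A}. sgn_index B * (w B * w (bar_index B)))"
      proof (rule sum.cong)
        fix B assume B: "B \<in> UNIV - {A, bar_index A}"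
        then have "bar_index B \<noteq> A" "bar_index B \<noteq> bar_index A" by (metis DiffD2 bar_index_bar insertCI)+
        then show "sgn_index B * (k $ B * k $ bar_index B) = sgn_index B * (w B * w (bar_index B))"
          using B by (simp add: k_def)
      qed simp
      then have "k \<in> null_cone" unfolding null_cone_def mem_Collect_eq null_momentum_iff_product[of k A] kA q_def by simp
      moreover have "\<forall>B\<in>I. f B k = w B" by (auto simp: I_def f_def k_def field_simps)
      ultimately show "\<exists>v. \<forall>t. t \<noteq> 0 \<longrightarrow> (\<exists>z\<in>null_cone. \<forall>j\<in>I. f j z = w j + t * v j)"
        by (intro exI[of _ "\<lambda>_. 0"]) auto
    qed
  qed (use null_cone_dim_le in auto)
qed

section \<open>The simple momenta as the cone over a Segre variety\<close>

lemma simple_momenta_eq: "simple_momenta = range (\<lambda>(u, v). spinor_product u v)"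
  by (auto simp: simple_momenta_def simple_momentum_def)

lemma simple_momenta_dim_le:
  fixes f :: "nat \<Rightarrow> 'm::finite vec4m \<Rightarrow> complex"
  assumes poly: "\<forall>j<r. f j \<in> polys_on_space" and indep: "algebraically_independent_on simple_momenta r f"
  shows "r \<le> 2 * CARD('m) + 1"
proof -
  \<comment> \<open>the functions of bidegree \<open>(n, n)\<close> in \<open>(\<kappa>, \<kappa>~)\<close>: the exponent of \<open>\<kappa>\<^sup>1\<close> is determined by the others\<close>
  define M where "M = (\<lambda>(a, c) (u :: complex ^ 2, v :: complex ^ ('m + 'm)). u $ 0 ^ a * u $ 1 ^ (sum c UNIV - a) * monomial c v)"
  define E where "E D = {(a, c :: 'm + 'm \<Rightarrow> nat). a \<le> sum c UNIV \<and> sum c UNIV \<le> D}" for D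
  define G where "G D = M ` E D" for D
  define X where "X D = {c :: 'm + 'm \<Rightarrow> nat. \<forall>i. c i \<le> D}" for D
  have X: "finite (X D)" "card (X D) \<le> (D + 1) ^ (2 * CARD('m))" for D
    using finite_card_exponents[of "X D" "\<lambda>_. {..D}"] by (auto simp: X_def mult_2)
  have E_sub: "E D \<subseteq> {..D} \<times> X D" for D
  proof -
    have "c i \<le> sum c UNIV" for i and c :: "'m + 'm \<Rightarrow> nat" by (rule member_le_sum) auto
    then show ?thesis by (auto simp: E_def X_def intro: le_trans)
  qed
  have E_fin: "finite (E D)" for D using E_sub X(1) by (meson finite_SigmaI finite_atMost finite_subset)
  have E_card: "card (E D) \<le> (D + 1) ^ (2 * CARD('m) + 1)" for D
  proof -
    have "card (E D) \<le> card ({..D} \<times> X D)" using E_sub X(1) by (intro card_mono) auto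
    also have "\<dots> \<le> (D + 1) * (D + 1) ^ (2 * CARD('m))"
      using X(2)[of D] by (simp only: card_cartesian_product card_atMost Suc_eq_plus1 mult_le_mono2)
    finally show ?thesis by simp
  qed
  have G_fin: "finite (G D)" for D by (simp add: G_def E_fin)
  have coord: "(\<lambda>s. (case s of (u, v) \<Rightarrow> spinor_product u v) $ (\<alpha>, i) * M (a, c) s) \<in> G (Suc D)"
    if "(a, c) \<in> E D" for a c D \<alpha> i
  proof -
    \<comment> \<open>A factor with \<alpha> = 0 raises a; one with \<alpha> = 1 leaves a alone,
      because the exponent \<open>sum c UNIV - a\<close> of the other component grows with
      c.\<close>
    define a' where "a' = (if \<alpha> = 0 then Suc a else a)"
    let ?c = "c(i := Suc (c i))"
    have "(a', ?c) \<in> E (Suc D)" using that by (auto simp: E_def a'_def sum_upd_Suc simp del: fun_upd_apply)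
    moreover have "(\<lambda>s. (case s of (u, v) \<Rightarrow> spinor_product u v) $ (\<alpha>, i) * M (a, c) s) = M (a', ?c)"
      using exhaust_undotted[of \<alpha>] that
      by (auto simp: fun_eq_iff M_def E_def a'_def monomial_Suc sum_upd_Suc Suc_diff_le simp del: fun_upd_apply)
    ultimately show ?thesis unfolding G_def by (metis imageI)
  qed
  have one: "(\<lambda>_. 1) \<in> G 0"
  proof -
    have "(0, \<lambda>_. 0) \<in> E 0" by (simp add: E_def)
    moreover have "(\<lambda>_. 1) = M (0, \<lambda>_. 0)" by (simp add: fun_eq_iff M_def)
    ultimately show ?thesis unfolding G_def by blast
  qed
  show ?thesis
  proof (rule algebraically_independent_bound[where \<phi> = "\<lambda>(u, v). spinor_product u v" and S = UNIV and G = G and C = 1 and f = f])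
    show "card (G D) \<le> 1 * (D + 1) ^ (2 * CARD('m) + 1)" for D
      using card_image_le[OF E_fin, of M D] E_card[of D] by (simp add: G_def)
    show "G D \<subseteq> G (Suc D)" for D by (auto simp: G_def E_def)
    show "(\<lambda>s. (case s of (u, v) \<Rightarrow> spinor_product u v) $ i * g s) \<in> fun_span UNIV (G (Suc D))"
      if g: "g \<in> G D" for D i g
    proof (rule fun_span_base[OF G_fin])
      obtain a c where "(a, c) \<in> E D" "g = M (a, c)" using g by (auto simp: G_def)
      then show "(\<lambda>s. (case s of (u, v) \<Rightarrow> spinor_product u v) $ i * g s) \<in> G (Suc D)"
        using coord[of a c D "fst i" "snd i"] by simp
    qed
  qed (use G_fin one indep[unfolded simple_momenta_eq] poly in auto)
qed

text \<open>Row 0 and one entry of row 1 are free coordinates: where the entry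
  \<open>(0, j0)\<close> is nonzero they determine a rank-one matrix.\<close>

lemma simple_momenta_dim: "variety_dim (simple_momenta :: 'm::finite vec4m set) = 2 * CARD('m) + 1"
proof -
  define j0 where "j0 = (Inl undefined :: 'm + 'm)"
  define I :: "'m index set" where "I = insert (1, j0) (range (Pair 0))"
  have "card (range (Pair (0::2)) :: 'm index set) = 2 * CARD('m)" by (subst card_image) (auto simp: inj_on_def)
  then have cI: "card I = 2 * CARD('m) + 1" unfolding I_def by (subst card_insert_disjoint) auto
  obtain h where h: "bij_betw h {..<2 * CARD('m) + 1} I" using bij_betw_lessThan[of I] cI by auto
  show ?thesis
  proof (rule variety_dimI[where r = "2 * CARD('m) + 1" and f = "\<lambda>j z. z $ h j"])
    show "\<forall>j<2 * CARD('m) + 1. (\<lambda>z. z $ h j) \<in> polys_on_space"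
      using coord_polys_on_space by blast
    show "algebraically_independent_on (simple_momenta :: 'm vec4m set) (2 * CARD('m) + 1) (\<lambda>j z. z $ h j)"
    proof (rule algebraically_independent_projection[OF h, where f = "\<lambda>i z. z $ i"])
      fix w :: "'m index \<Rightarrow> complex"
      \<comment> \<open>Moves the entry \<open>(0, j0)\<close> off zero if w vanishes there, so that
        the division below is legitimate; all other entries stay fixed.\<close>
      define v where "v A = (if A = (0, j0) \<and> w A = 0 then 1 else 0 :: complex)" for A
      have "\<exists>z\<in>simple_momenta. \<forall>A\<in>I. z $ A = w A + t * v A" if "t \<noteq> 0" for t
      proof -
        define y where "y = (\<chi> b. w (0, b) + t * v (0, b))"
        have "y $ j0 \<noteq> 0" using that by (simp add: y_def v_def)
        then have "\<forall>A\<in>I. spinor_product (\<chi> \<alpha>. if \<alpha> = 0 then 1 else w (1, j0) / y $ j0) y $ A = w A + t * v A"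
          by (auto simp: I_def v_def) (auto simp: y_def v_def)
        then show ?thesis by (force simp: simple_momenta_def simple_momentum_def)
      qed
      then show "\<exists>v. \<forall>t. t \<noteq> 0 \<longrightarrow> (\<exists>z\<in>simple_momenta. \<forall>j\<in>I. z $ j = w j + t * v j)" by blast
    qed
  qed (use simple_momenta_dim_le in auto)
qed

lemma simple_momenta_codim:
  "subvariety_of_codim (simple_momenta :: 'm::finite vec4m set) null_cone (2 * CARD('m) - 2)"
proof -
  \<comment> \<open>Makes the truncated subtractions exact.\<close>
  have "CARD('m) > 0" by simp
  then have "2 * CARD('m) + 1 + (2 * CARD('m) - 2) = 4 * CARD('m) - 1" by linarith
  moreover have "simple_momenta \<subseteq> (null_cone :: 'm vec4m set)"
    by (auto simp: simple_momenta_def null_cone_def simple_momentum_null)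
  ultimately show ?thesis
    by (simp only: subvariety_of_codim_def algebraic_simple_momenta algebraic_null_cone null_cone_dim simple_momenta_dim simp_thms)
qed

lemma simple_momenta_proper:
  assumes "CARD('m::finite) > 1"
  shows "(simple_momenta :: 'm vec4m set) \<subset> null_cone"
proof -
  obtain i j :: 'm where ij: "i \<noteq> j"
    using assms by (metis One_nat_def card_le_Suc0_iff_eq finite not_le UNIV_I)
  \<comment> \<open>The nonzero entries lie in different rows and columns, so k has rank two, but
    they are not conjugate under the metric, so every product in the quadric vanishes.\<close>
  define k :: "'m vec4m" where "k = (\<chi> A. if A = (0, Inl i) \<or> A = (1, Inl j) then 1 else 0)"
  have "k $ A * k $ bar_index A = 0" for A
    by (cases A; cases "snd A") (auto simp: k_def bar_index_def)
  then have "k \<in> null_cone" by (simp only: null_cone_def null_momentum_iff_sum mem_Collect_eq) simp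
  moreover have "k \<notin> simple_momenta"
  proof
    assume "k \<in> simple_momenta"
    then have "k $ (0, Inl i) * k $ (1, Inl j) = k $ (0, Inl j) * k $ (1, Inl i)"
      unfolding simple_momenta_def simple_momentum_iff by blast
    then show False using ij by (simp add: k_def)
  qed
  moreover have "simple_momenta \<subseteq> (null_cone :: 'm vec4m set)"
    by (auto simp: simple_momenta_def null_cone_def simple_momentum_null)
  ultimately show ?thesis by blast
qed

section \<open>Hyperholomorphic gluons and hyperkaehler gravitons have simple momentum\<close>

theorem mainTheorem5:
  fixes T :: "complex ^ 'g::finite"
  assumes "T \<noteq> 0"
  shows
    \<comment> \<open>parametrization of general null momenta\<close>
   "(\<forall>k :: 'm::finite vec4m. null_momentum k \<longrightarrow>
       (\<exists>\<kappa> \<kappa>t. angle_bracket (\<kappa> 1) (\<kappa> 2) \<noteq> 0 \<and> square_bracket (\<kappa>t 1) (\<kappa>t 2) = 0 \<and>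
          k = general_momentum \<kappa> \<kappa>t)) \<and>
    \<comment> \<open>the hyperholomorphic and hyperkaehler conditions in this parametrization\<close>
    (\<forall>\<kappa> (\<kappa>t :: 2 \<Rightarrow> complex ^ ('m + 'm)) e k \<epsilon>.
       square_bracket (\<kappa>t 1) (\<kappa>t 2) = 0 \<and> k = general_momentum \<kappa> \<kappa>t \<and> \<epsilon> = hh_polarization e \<kappa>t \<longrightarrow>
         on_shell k \<epsilon> \<and>
         (\<forall>x F_tilde F_hat F_breve.
            field_strength_decomposition (linearised_field_strength (gluon T \<epsilon> k) x) F_tilde F_hat F_breve \<longrightarrow>
              ((\<forall>\<alpha> \<beta>. F_hat \<alpha> \<beta> = 0) \<longleftrightarrow> trace_condition \<kappa> e \<kappa>t) \<and>
              ((\<forall>\<alpha> \<beta> \<alpha>' \<beta>'. F_breve \<alpha> \<beta> \<alpha>' \<beta>' = 0) \<longleftrightarrow> wedge_condition \<kappa> e \<kappa>t)) \<and>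
         (hyperholomorphic (gluon T \<epsilon> k) \<longleftrightarrow> trace_condition \<kappa> e \<kappa>t \<and> wedge_condition \<kappa> e \<kappa>t) \<and>
         trace_condition \<kappa> e \<kappa>t \<and>
         (nontrivial_gluon (gluon T \<epsilon> k) \<and> wedge_condition \<kappa> e \<kappa>t \<or>
          nontrivial_graviton (graviton \<epsilon> k) \<and> hyperkaehler (graviton \<epsilon> k) \<longrightarrow>
            simple_momentum k \<and>
            (angle_bracket (\<kappa> 1) (\<kappa> 2) \<noteq> 0 \<longrightarrow>
               (\<forall>a b \<alpha>' \<beta>'. wedge (\<kappa>t a) (\<kappa>t b) \<alpha>' \<beta>' = 0) \<and> proportional (\<kappa>t 1) (\<kappa>t 2)))) \<and>
    \<comment> \<open>all hyperholomorphic gluons and hyperkaehler gravitons\<close>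
    (\<forall>(k :: 'm vec4m) \<epsilon>. on_shell k \<epsilon> \<and>
       (nontrivial_gluon (gluon T \<epsilon> k) \<and> hyperholomorphic (gluon T \<epsilon> k) \<or>
        nontrivial_graviton (graviton \<epsilon> k) \<and> hyperkaehler (graviton \<epsilon> k)) \<longrightarrow>
         (\<exists>\<kappa> \<kappa>t \<iota>. angle_bracket \<kappa> \<iota> \<noteq> 0 \<and> k = spinor_product \<kappa> \<kappa>t \<and>
            \<epsilon> = simple_polarization \<kappa> \<kappa>t \<iota>)) \<and>
    \<comment> \<open>the choice of iota is the residual gauge freedom\<close>
    (\<forall>\<kappa> (\<kappa>t :: complex ^ ('m + 'm)) \<iota> k \<epsilon> \<epsilon>'.
       angle_bracket \<kappa> \<iota> \<noteq> 0 \<and> k = spinor_product \<kappa> \<kappa>t \<and> \<epsilon> = simple_polarization \<kappa> \<kappa>t \<iota> \<longrightarrow>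
         ((on_shell k \<epsilon>' \<and>
             (\<exists>c. gluon T \<epsilon>' k = gauge_transform (\<lambda>x. (c * plane_wave k x) *s T) (gluon T \<epsilon> k))) \<longleftrightarrow>
          (\<exists>\<iota>'. angle_bracket \<kappa> \<iota>' \<noteq> 0 \<and> \<epsilon>' = simple_polarization \<kappa> \<kappa>t \<iota>')) \<and>
         ((on_shell k \<epsilon>' \<and>
             (\<exists>v. graviton \<epsilon>' k = diffeo_transform (\<lambda>x A. v $ A * plane_wave k x) (graviton \<epsilon> k))) \<longleftrightarrow>
          (\<exists>\<iota>'. angle_bracket \<kappa> \<iota>' \<noteq> 0 \<and> graviton \<epsilon>' k = graviton (simple_polarization \<kappa> \<kappa>t \<iota>') k))) \<and>
    \<comment> \<open>one of the on-shell polarizations is selected, and only if the momentum is simple\<close>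
    (\<forall>k :: 'm vec4m. k \<noteq> 0 \<and> null_momentum k \<longrightarrow>
       (let W = {\<epsilon>. pairing k \<epsilon> = 0};
            H = {\<epsilon> \<in> W. hyperholomorphic (gluon T \<epsilon> k)};
            K = {\<epsilon> \<in> W. hyperkaehler (graviton \<epsilon> k)}
        in vec.subspace W \<and> lower_vec k \<in> W \<and> polarizations_mod_gauge k W = 4 * CARD('m) - 2 \<and>
           vec.subspace H \<and> lower_vec k \<in> H \<and>
           polarizations_mod_gauge k H = (if simple_momentum k then 1 else 0) \<and> K = H)) \<and>
    \<comment> \<open>the constraint on the momentum\<close>
    (hyperholomorphic_momenta T = (simple_momenta - {0} :: 'm vec4m set) \<and>
     hyperkaehler_momenta = (simple_momenta - {0} :: 'm vec4m set) \<and>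
     subvariety_of_codim (simple_momenta :: 'm vec4m set) null_cone (2 * CARD('m) - 2) \<and>
     (CARD('m) > 1 \<longrightarrow> (simple_momenta :: 'm vec4m set) \<subset> null_cone))"
proof (intro conjI)
  show "\<forall>k :: 'm vec4m. null_momentum k \<longrightarrow>
       (\<exists>\<kappa> \<kappa>t. angle_bracket (\<kappa> 1) (\<kappa> 2) \<noteq> 0 \<and> square_bracket (\<kappa>t 1) (\<kappa>t 2) = 0 \<and>
          k = general_momentum \<kappa> \<kappa>t)"
    using null_momentum_parametrization by blast
  show "\<forall>\<kappa> (\<kappa>t :: 2 \<Rightarrow> complex ^ ('m + 'm)) e k \<epsilon>.
       square_bracket (\<kappa>t 1) (\<kappa>t 2) = 0 \<and> k = general_momentum \<kappa> \<kappa>t \<and> \<epsilon> = hh_polarization e \<kappa>t \<longrightarrow>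
         on_shell k \<epsilon> \<and>
         (\<forall>x F_tilde F_hat F_breve.
            field_strength_decomposition (linearised_field_strength (gluon T \<epsilon> k) x) F_tilde F_hat F_breve \<longrightarrow>
              ((\<forall>\<alpha> \<beta>. F_hat \<alpha> \<beta> = 0) \<longleftrightarrow> trace_condition \<kappa> e \<kappa>t) \<and>
              ((\<forall>\<alpha> \<beta> \<alpha>' \<beta>'. F_breve \<alpha> \<beta> \<alpha>' \<beta>' = 0) \<longleftrightarrow> wedge_condition \<kappa> e \<kappa>t)) \<and>
         (hyperholomorphic (gluon T \<epsilon> k) \<longleftrightarrow> trace_condition \<kappa> e \<kappa>t \<and> wedge_condition \<kappa> e \<kappa>t) \<and>
         trace_condition \<kappa> e \<kappa>t \<and>
         (nontrivial_gluon (gluon T \<epsilon> k) \<and> wedge_condition \<kappa> e \<kappa>t \<or>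
          nontrivial_graviton (graviton \<epsilon> k) \<and> hyperkaehler (graviton \<epsilon> k) \<longrightarrow>
            simple_momentum k \<and>
            (angle_bracket (\<kappa> 1) (\<kappa> 2) \<noteq> 0 \<longrightarrow>
               (\<forall>a b \<alpha>' \<beta>'. wedge (\<kappa>t a) (\<kappa>t b) \<alpha>' \<beta>' = 0) \<and> proportional (\<kappa>t 1) (\<kappa>t 2)))"
    (is "\<forall>\<kappa> \<kappa>t e k \<epsilon>. ?hyp \<kappa> \<kappa>t e k \<epsilon> \<longrightarrow> ?concl \<kappa> \<kappa>t e k \<epsilon>")
  proof (intro allI impI)
    fix \<kappa> e :: "2 \<Rightarrow> complex ^ 2" and \<kappa>t :: "2 \<Rightarrow> complex ^ ('m + 'm)" and k \<epsilon> :: "'m vec4m"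
    assume "?hyp \<kappa> \<kappa>t e k \<epsilon>"
    then have sb: "square_bracket (\<kappa>t 1) (\<kappa>t 2) = 0" and k: "k = general_momentum \<kappa> \<kappa>t"
      and \<epsilon>: "\<epsilon> = hh_polarization e \<kappa>t" by auto
    note par = general_parametrization[OF assms sb k \<epsilon>]
    have "on_shell k \<epsilon>" unfolding k \<epsilon> by (rule on_shell_hh_polarization[OF sb])
    then show "?concl \<kappa> \<kappa>t e k \<epsilon>"
      using par(1) par(2) par(3) trace_condition_null[OF sb] simple_general_momentum[of \<kappa> \<kappa>t, folded k]
      by (intro conjI allI impI) simp_all
  qed
  show "\<forall>(k :: 'm vec4m) \<epsilon>. on_shell k \<epsilon> \<and>
       (nontrivial_gluon (gluon T \<epsilon> k) \<and> hyperholomorphic (gluon T \<epsilon> k) \<or>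
        nontrivial_graviton (graviton \<epsilon> k) \<and> hyperkaehler (graviton \<epsilon> k)) \<longrightarrow>
         (\<exists>\<kappa> \<kappa>t \<iota>. angle_bracket \<kappa> \<iota> \<noteq> 0 \<and> k = spinor_product \<kappa> \<kappa>t \<and>
            \<epsilon> = simple_polarization \<kappa> \<kappa>t \<iota>)"
    unfolding nontrivial_gluon_iff[OF assms] nontrivial_graviton_iff
      hyperholomorphic_gluon_iff[OF assms] hyperkaehler_graviton_iff
    using simple_form by blast
  show "\<forall>\<kappa> (\<kappa>t :: complex ^ ('m + 'm)) \<iota> k \<epsilon> \<epsilon>'.
       angle_bracket \<kappa> \<iota> \<noteq> 0 \<and> k = spinor_product \<kappa> \<kappa>t \<and> \<epsilon> = simple_polarization \<kappa> \<kappa>t \<iota> \<longrightarrow>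
         ((on_shell k \<epsilon>' \<and>
             (\<exists>c. gluon T \<epsilon>' k = gauge_transform (\<lambda>x. (c * plane_wave k x) *s T) (gluon T \<epsilon> k))) \<longleftrightarrow>
          (\<exists>\<iota>'. angle_bracket \<kappa> \<iota>' \<noteq> 0 \<and> \<epsilon>' = simple_polarization \<kappa> \<kappa>t \<iota>')) \<and>
         ((on_shell k \<epsilon>' \<and>
             (\<exists>v. graviton \<epsilon>' k = diffeo_transform (\<lambda>x A. v $ A * plane_wave k x) (graviton \<epsilon> k))) \<longleftrightarrow>
          (\<exists>\<iota>'. angle_bracket \<kappa> \<iota>' \<noteq> 0 \<and> graviton \<epsilon>' k = graviton (simple_polarization \<kappa> \<kappa>t \<iota>') k))"
  proof (intro allI impI, elim conjE, intro conjI, goal_cases)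
    case 1
    then show ?case by (rule gluon_residual_gauge[OF assms])
  next
    case (2 \<kappa> \<kappa>t \<iota> k \<epsilon> \<epsilon>')
    then show ?case unfolding 2(2,3) by (intro graviton_residual_gauge)
  qed
  show "\<forall>k :: 'm vec4m. k \<noteq> 0 \<and> null_momentum k \<longrightarrow>
       (let W = {\<epsilon>. pairing k \<epsilon> = 0};
            H = {\<epsilon> \<in> W. hyperholomorphic (gluon T \<epsilon> k)};
            K = {\<epsilon> \<in> W. hyperkaehler (graviton \<epsilon> k)}
        in vec.subspace W \<and> lower_vec k \<in> W \<and> polarizations_mod_gauge k W = 4 * CARD('m) - 2 \<and>
           vec.subspace H \<and> lower_vec k \<in> H \<and>
           polarizations_mod_gauge k H = (if simple_momentum k then 1 else 0) \<and> K = H)"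
    using polarization_count[OF assms] by blast
  show "CARD('m) > 1 \<longrightarrow> (simple_momenta :: 'm vec4m set) \<subset> null_cone"
    using simple_momenta_proper by blast
qed (fact momenta_eq[OF assms] simple_momenta_codim)+

end
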